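(* Let $\mathbb K$ be an algebraically closed field of characteristic zero and let $N\ge2$, $q\ge2$ be integers. (a) Let $\mathcal A$ be an $N$-homogeneous algebra generated by $q$ elements $x^\lambda$ ($\lambda\in\{1,\dots,q\}$) which is Koszul of global dimension $3$ and Gorenstein. Then there is a 3-regular $(N+1)$-linear form $W$ on $\mathbb K^q$, with components $W_{\lambda_0\dots\lambda_N}=W(e_{\lambda_0},\dots,e_{\lambda_N})$ in the canonical basis $(e_\lambda)$ of $\mathbb K^q$, such that the relations of $\mathcal A$ read $$\sum_{\lambda_1,\dots,\lambda_N}W_{\lambda\lambda_1\dots\lambda_N}x^{\lambda_1}\cdots x^{\lambda_N}=0,\qquad \lambda\in\{1,\dots,q\}.$$ (b) Two 3-regular $(N+1)$-linear forms on $\mathbb K^q$ in the same $GL(q,\mathbb K)$-orbit correspond to isomorphic algebras, where the algebra corresponding to $W$ is the $N$-homogeneous algebra generated by $x^1,\dots,x^q$ with the relations displayed in (a).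
   Context: All algebras are associative unital algebras over $\mathbb K$. **Homogeneous algebras.** An $N$-homogeneous algebra generated by $q$ elements $x^\lambda$ is a graded algebra $\mathcal A=T(E)/(R)$, where $E=\bigoplus_{\lambda=1}^q\mathbb K x^\lambda$ has basis $(x^\lambda)$ and is placed in degree $1$, $T(E)$ is its tensor algebra, and $(R)$ is the two-sided ideal generated by a subspace $R\subset E^{\otimes N}$ (the space of relations). "The relations of $\mathcal A$ read $r_\lambda=0$" means that $R$ is the linear span of the corresponding elements $r_\lambda\in E^{\otimes N}$. $\mathcal A$ is connected, $\mathcal A_0=\mathbb K$, and $\mathbb K$ denotes also the trivial $\mathcal A$-module $\mathcal A/\bigoplus_{n\ge1}\mathcal A_n$. **Koszulity.** Let $K_n=E^{\otimes n}$ for $0\le n\le N-1$ and $K_n=\bigcap_{r+s=n-N}E^{\otimes r}\otimes R\otimes E^{\otimes s}\subset E^{\otimes n}$ for $n\ge N$. The maps $a\otimes(v_1\otimes v_2\otimes\cdots\otimes v_n)\mapsto av_1\otimes(v_2\otimes\cdots\otimes v_n)$ induce left $\mathcal A$-module homomorphisms $d:\mathcal A\otimes K_n\to\mathcal A\otimes K_{n-1}$ with $d^N=0$. The Koszul complex of $\mathcal A$ is $$\cdots\stackrel{d}{\to}\mathcal A\otimes K_{2N}\stackrel{d^{N-1}}{\to}\mathcal A\otimes K_{N+1}\stackrel{d}{\to}\mathcal A\otimes K_N\stackrel{d^{N-1}}{\to}\mathcal A\otimes K_1\stackrel{d}{\to}\mathcal A\to0$$ (the maps are alternately $d$ and $d^{N-1}$;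 the modules are $\mathcal A\otimes K_{Nk}$ in homological degree $2k$ and $\mathcal A\otimes K_{Nk+1}$ in homological degree $2k+1$). $\mathcal A$ is Koszul if this complex is acyclic in homological degrees $\ge1$ (so that it is a free resolution of the trivial left module $\mathbb K$). **Global dimension, Gorenstein.** The global dimension of $\mathcal A$ is the projective dimension of the trivial module $\mathbb K$. An algebra $\mathcal A$ of finite global dimension $D$ is Gorenstein if $\mathrm{Ext}^n_{\mathcal A}(\mathbb K,\mathcal A)=0$ for $n\neq D$ and $\mathrm{Ext}^D_{\mathcal A}(\mathbb K,\mathcal A)\simeq\mathbb K$ (one-dimensional). **Preregular forms.** Let $V$ be a vector space and $n\ge1$. An $(n+1)$-linear form $W$ on $V$ is preregular iff: (i) if $X\in V$ satisfies $W(X,X_1,\dots,X_n)=0$ for all $X_1,\dots,X_n\in V$, then $X=0$; (ii) there is $Q_W\in GL(V)$ such that $W(X_0,\dots,X_{n-1},X_n)=W(Q_WX_n,X_0,\dots,X_{n-1})$ for all $X_0,\dots,X_n\in V$. **3-regular forms.** An $(N+1)$-linear form $W$ on $V$ ($N\ge2$) is 3-regular iff it is preregular and: (iii) if $L_0,L_1\in\mathrm{End}(V)$ satisfy $W(L_0X_0,X_1,X_2,\dots,X_N)=W(X_0,L_1X_1,X_2,\dots,X_N)$ for all $X_0,\dots,X_N\in V$, then $L_0=L_1=\lambda\,\mathrm{Id}$ for some $\lambda\in\mathbb K$. The group $GL(V)$ acts on multilinear forms by $W^L(X_0,\dots,X_n)=W(L^{-1}X_0,\dots,L^{-1}X_n)$.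 *)

theory Defs
  imports
    "HOL-Analysis.Cartesian_Space"
    "HOL-Library.Poly_Mapping"
    "HOL-Algebra.QuotRing"
    "HOL-Algebra.Module"
    "HOL-Algebra.Algebraic_Closure_Type"
begin

hide_const (open) Multiset.mult Polynomial.smult

section \<open>The tensor algebra\<close>

text \<open>
  Words form the free monoid, written additively because \<^theory>\<open>HOL-Library.Poly_Mapping\<close> builds
  monoid algebras over additive monoids.  Hence \<open>'q list \<Rightarrow>\<^sub>0 'k\<close>, with the library's ring
  structure, is the tensor algebra \<open>T(E)\<close> of the \<open>'k\<close>-vector space \<open>E\<close> with basis \<open>x\<^sup>\<lambda>\<close>, \<open>\<lambda> :: 'q\<close>.
\<close>

instantiation list :: (type) monoid_add
begin

definition zero_list :: "'a list" where "zero_list = []"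

definition plus_list :: "'a list \<Rightarrow> 'a list \<Rightarrow> 'a list" where "plus_list = (@)"

instance
  by standard (simp_all add: zero_list_def plus_list_def)

end

type_synonym ('q, 'k) tensor_alg = "'q list \<Rightarrow>\<^sub>0 'k"

definition gen :: "'q \<Rightarrow> ('q, 'k::field) tensor_alg" where
  "gen l = Poly_Mapping.single [l] 1"

definition tscale :: "'k::field \<Rightarrow> ('q, 'k) tensor_alg \<Rightarrow> ('q, 'k) tensor_alg" where
  "tscale c p = Poly_Mapping.map ((*) c) p"

lemma lookup_tscale: "Poly_Mapping.lookup (tscale c p) w = c * Poly_Mapping.lookup p w"
  unfolding tscale_def by transfer (simp add: when_def)

interpretation tensor_alg: vector_space "tscale :: 'k::field \<Rightarrow> ('q, 'k) tensor_alg \<Rightarrow> _"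
  by unfold_locales
    (rule poly_mapping_eqI, simp add: lookup_tscale lookup_add algebra_simps)+

definition tensor_power :: "nat \<Rightarrow> ('q, 'k::field) tensor_alg set" where
  "tensor_power n = {p. \<forall>w \<in> Poly_Mapping.keys p. length w = n}"


section \<open>Homogeneous algebras\<close>

text \<open>
  The record \<^type>\<open>module\<close> carries a ring structure together with a scalar multiplication; it is
  used both for (non-commutative) \<open>'k\<close>-algebras and for left modules.  For modules that carry no
  product the fields \<open>mult\<close> and \<open>one\<close> are irrelevant.
\<close>

abbreviation tensor_ring :: "('q, 'k::field) tensor_alg ring" where
  "tensor_ring \<equiv> ring_of_type_algebra"

definition rel_ideal :: "('q, 'k::field) tensor_alg set \<Rightarrow> ('q, 'k) tensor_alg set" where
  "rel_ideal R = Idl\<^bsub>tensor_ring\<^esub> R"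

definition cls :: "('q, 'k::field) tensor_alg set \<Rightarrow> ('q, 'k) tensor_alg \<Rightarrow> ('q, 'k) tensor_alg set" where
  "cls R p = rel_ideal R +>\<^bsub>tensor_ring\<^esub> p"

definition hom_alg ::
    "('q, 'k::field) tensor_alg set \<Rightarrow> ('k, ('q, 'k) tensor_alg set) module" where
  "hom_alg R = (let Q = tensor_ring Quot rel_ideal R in
     \<lparr>carrier = carrier Q, mult = mult Q, one = one Q, zero = zero Q, add = add Q,
      smult = (\<lambda>c a. \<Union>p\<in>a. cls R (tscale c p))\<rparr>)"

definition hom_alg_grade ::
    "('q, 'k::field) tensor_alg set \<Rightarrow> nat \<Rightarrow> ('q, 'k) tensor_alg set set" where
  "hom_alg_grade R n = cls R ` tensor_power n"

text \<open>Homogeneous algebras are graded algebras, so isomorphisms are required to preserve degrees.\<close>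

definition hom_alg_isomorphic ::
    "('q, 'k::field) tensor_alg set \<Rightarrow> ('q, 'k) tensor_alg set \<Rightarrow> bool" where
  "hom_alg_isomorphic R S \<longleftrightarrow>
     (\<exists>h \<in> ring_iso (hom_alg R) (hom_alg S).
        (\<forall>c. \<forall>a \<in> carrier (hom_alg R). h (c \<odot>\<^bsub>hom_alg R\<^esub> a) = c \<odot>\<^bsub>hom_alg S\<^esub> h a) \<and>
        (\<forall>n. h ` hom_alg_grade R n = hom_alg_grade S n))"


section \<open>Left modules over non-commutative rings\<close>

text \<open>The library's locale \<^locale>\<open>module\<close> requires the ring to be commutative.\<close>

locale left_module = R?: ring R + M?: abelian_group M
  for R :: "('a, 'r) ring_scheme" (structure) and M :: "('a, 'm, 's) module_scheme" (structure) +
  assumes lsmult_closed: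
      "\<lbrakk>a \<in> carrier R; x \<in> carrier M\<rbrakk> \<Longrightarrow> a \<odot>\<^bsub>M\<^esub> x \<in> carrier M"
    and lsmult_l_distr:
      "\<lbrakk>a \<in> carrier R; b \<in> carrier R; x \<in> carrier M\<rbrakk> \<Longrightarrow>
        (a \<oplus> b) \<odot>\<^bsub>M\<^esub> x = a \<odot>\<^bsub>M\<^esub> x \<oplus>\<^bsub>M\<^esub> b \<odot>\<^bsub>M\<^esub> x"
    and lsmult_r_distr:
      "\<lbrakk>a \<in> carrier R; x \<in> carrier M; y \<in> carrier M\<rbrakk> \<Longrightarrow>
        a \<odot>\<^bsub>M\<^esub> (x \<oplus>\<^bsub>M\<^esub> y) = a \<odot>\<^bsub>M\<^esub> x \<oplus>\<^bsub>M\<^esub> a \<odot>\<^bsub>M\<^esub> y"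
    and lsmult_assoc:
      "\<lbrakk>a \<in> carrier R; b \<in> carrier R; x \<in> carrier M\<rbrakk> \<Longrightarrow>
        (a \<otimes> b) \<odot>\<^bsub>M\<^esub> x = a \<odot>\<^bsub>M\<^esub> (b \<odot>\<^bsub>M\<^esub> x)"
    and lsmult_one:
      "x \<in> carrier M \<Longrightarrow> \<one> \<odot>\<^bsub>M\<^esub> x = x"

definition lmod_hom ::
    "('a, 'r) ring_scheme \<Rightarrow> ('a, 'm, 's) module_scheme \<Rightarrow> ('a, 'n, 't) module_scheme \<Rightarrow> ('m \<Rightarrow> 'n) set" where
  "lmod_hom A M N = {f \<in> carrier M \<rightarrow> carrier N.
     (\<forall>x \<in> carrier M. \<forall>y \<in> carrier M. f (x \<oplus>\<^bsub>M\<^esub> y) = f x \<oplus>\<^bsub>N\<^esub> f y) \<and>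
     (\<forall>a \<in> carrier A. \<forall>x \<in> carrier M. f (a \<odot>\<^bsub>M\<^esub> x) = a \<odot>\<^bsub>N\<^esub> f x)}"

definition lmod_isomorphic ::
    "('a, 'r) ring_scheme \<Rightarrow> ('a, 'm, 's) module_scheme \<Rightarrow> ('a, 'n, 't) module_scheme \<Rightarrow> bool" where
  "lmod_isomorphic A M N \<longleftrightarrow> (\<exists>f \<in> lmod_hom A M N. bij_betw f (carrier M) (carrier N))"

definition regular_module :: "('a, 'r) ring_scheme \<Rightarrow> ('a, 'a) module" where
  "regular_module A = \<lparr>carrier = carrier A, mult = mult A, one = one A, zero = zero A, add = add A,
     smult = mult A\<rparr>"

definition quotient_module :: "('a, 'm, 's) module_scheme \<Rightarrow> 'm set \<Rightarrow> ('a, 'm set) module" where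
  "quotient_module M B = \<lparr>carrier = a_rcosets\<^bsub>M\<^esub> B, mult = undefined, one = undefined,
     zero = B, add = set_add M, smult = (\<lambda>a C. \<Union>x\<in>C. B +>\<^bsub>M\<^esub> (a \<odot>\<^bsub>M\<^esub> x))\<rparr>"

text \<open>The free left module with basis \<open>S\<close>: finitely supported functions from \<open>S\<close> to \<open>A\<close>.\<close>

definition free_module :: "('a, 'r) ring_scheme \<Rightarrow> 'i set \<Rightarrow> ('a, 'i \<Rightarrow> 'a) module" where
  "free_module A S = \<lparr>
     carrier = {f. (\<forall>i \<in> S. f i \<in> carrier A) \<and> (\<forall>i. i \<notin> S \<longrightarrow> f i = \<zero>\<^bsub>A\<^esub>) \<and>
                   finite {i. f i \<noteq> \<zero>\<^bsub>A\<^esub>}},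
     mult = undefined, one = undefined,
     zero = (\<lambda>i. \<zero>\<^bsub>A\<^esub>), add = (\<lambda>f g i. f i \<oplus>\<^bsub>A\<^esub> g i),
     smult = (\<lambda>a f i. a \<otimes>\<^bsub>A\<^esub> f i)\<rparr>"

text \<open>
  Projective means direct summand of a free module.  It suffices to consider bases \<open>S\<close> in
  the carrier type of \<open>P\<close>: if \<open>P\<close> is projective, the canonical surjection onto \<open>P\<close> from the free
  module with basis \<open>carrier P\<close> splits.
\<close>

definition projective_lmod :: "('a, 'r) ring_scheme \<Rightarrow> ('a, 'm, 's) module_scheme \<Rightarrow> bool" where
  "projective_lmod A P \<longleftrightarrow> left_module A P \<and>
     (\<exists>(S :: 'm set). \<exists>s \<in> lmod_hom A P (free_module A S). \<exists>r \<in> lmod_hom A (free_module A S) P.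
        \<forall>x \<in> carrier P. r (s x) = x)"


section \<open>Projective dimension and Ext\<close>

text \<open>The augmented complex is \<open>\<dots> \<rightarrow> P 1 \<rightarrow> P 0 \<rightarrow> M \<rightarrow> 0\<close> with \<open>\<delta> n : P (n + 1) \<rightarrow> P n\<close> and \<open>\<epsilon> : P 0 \<rightarrow> M\<close>.\<close>

definition projective_resolution ::
    "('a, 'r) ring_scheme \<Rightarrow> ('a, 'x) module \<Rightarrow>
     (nat \<Rightarrow> ('a, 'm) module) \<Rightarrow> (nat \<Rightarrow> 'm \<Rightarrow> 'm) \<Rightarrow> ('m \<Rightarrow> 'x) \<Rightarrow> bool" where
  "projective_resolution A M P \<delta> \<epsilon> \<longleftrightarrow>
     (\<forall>n. projective_lmod A (P n)) \<and>
     \<epsilon> \<in> lmod_hom A (P 0) M \<and>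
     (\<forall>n. \<delta> n \<in> lmod_hom A (P (Suc n)) (P n)) \<and>
     \<epsilon> ` carrier (P 0) = carrier M \<and>
     {x \<in> carrier (P 0). \<epsilon> x = \<zero>\<^bsub>M\<^esub>} = \<delta> 0 ` carrier (P 1) \<and>
     (\<forall>n. {x \<in> carrier (P (Suc n)). \<delta> n x = \<zero>\<^bsub>P n\<^esub>} = \<delta> (Suc n) ` carrier (P (Suc (Suc n))))"

definition has_projective_resolution_of_length ::
    "'m itself \<Rightarrow> ('a, 'r) ring_scheme \<Rightarrow> ('a, 'x) module \<Rightarrow> nat \<Rightarrow> bool" where
  "has_projective_resolution_of_length TYPE('m) A M D \<longleftrightarrow>
     (\<exists>(P :: nat \<Rightarrow> ('a, 'm) module) \<delta> \<epsilon>. projective_resolution A M P \<delta> \<epsilon> \<and>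
        (\<forall>n > D. carrier (P n) = {\<zero>\<^bsub>P n\<^esub>}))"

definition has_projective_dimension ::
    "'m itself \<Rightarrow> ('a, 'r) ring_scheme \<Rightarrow> ('a, 'x) module \<Rightarrow> nat \<Rightarrow> bool" where
  "has_projective_dimension TYPE('m) A M D \<longleftrightarrow>
     has_projective_resolution_of_length TYPE('m) A M D \<and>
     (\<forall>D' < D. \<not> has_projective_resolution_of_length TYPE('m) A M D')"

text \<open>
  \<open>Hom\<^sub>A(M, N)\<close> as a \<open>'k\<close>-vector space, for a \<open>'k\<close>-algebra \<open>A\<close>; the scalar \<open>c\<close> acts on \<open>N\<close> as
  \<open>c 1\<^sub>A\<close>.  Homomorphisms are made extensional, so that equality in the carrier is equality of
  maps on \<open>M\<close>.
\<close>

definition Hom_space ::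
    "('k, 'a) module \<Rightarrow> ('a, 'm) module \<Rightarrow> ('a, 'n) module \<Rightarrow> ('k, 'm \<Rightarrow> 'n) module" where
  "Hom_space A M N = \<lparr>
     carrier = lmod_hom A M N \<inter> extensional (carrier M),
     mult = undefined, one = undefined,
     zero = (\<lambda>x \<in> carrier M. \<zero>\<^bsub>N\<^esub>),
     add = (\<lambda>f g. \<lambda>x \<in> carrier M. f x \<oplus>\<^bsub>N\<^esub> g x),
     smult = (\<lambda>c f. \<lambda>x \<in> carrier M. (c \<odot>\<^bsub>A\<^esub> \<one>\<^bsub>A\<^esub>) \<odot>\<^bsub>N\<^esub> f x)\<rparr>"

definition cocycles ::
    "('k, 'a) module \<Rightarrow> (nat \<Rightarrow> ('a, 'm) module) \<Rightarrow> (nat \<Rightarrow> 'm \<Rightarrow> 'm) \<Rightarrow> ('a, 'n) module \<Rightarrow> nat \<Rightarrow>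
     ('m \<Rightarrow> 'n) set" where
  "cocycles A P \<delta> N n =
     {f \<in> carrier (Hom_space A (P n) N). \<forall>x \<in> carrier (P (Suc n)). f (\<delta> n x) = \<zero>\<^bsub>N\<^esub>}"

definition coboundaries ::
    "('k, 'a) module \<Rightarrow> (nat \<Rightarrow> ('a, 'm) module) \<Rightarrow> (nat \<Rightarrow> 'm \<Rightarrow> 'm) \<Rightarrow> ('a, 'n) module \<Rightarrow> nat \<Rightarrow>
     ('m \<Rightarrow> 'n) set" where
  "coboundaries A P \<delta> N n =
     (case n of
        0 \<Rightarrow> {\<zero>\<^bsub>Hom_space A (P 0) N\<^esub>}
      | Suc m \<Rightarrow> (\<lambda>g. \<lambda>x \<in> carrier (P (Suc m)). g (\<delta> m x)) ` carrier (Hom_space A (P m) N))"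

text \<open>\<open>Ext\<^sup>n\<^sub>A(M, N)\<close> computed from a projective resolution \<open>(P, \<delta>, \<epsilon>)\<close> of \<open>M\<close>.\<close>

definition Ext ::
    "('k, 'a) module \<Rightarrow> (nat \<Rightarrow> ('a, 'm) module) \<Rightarrow> (nat \<Rightarrow> 'm \<Rightarrow> 'm) \<Rightarrow> ('a, 'n) module \<Rightarrow> nat \<Rightarrow>
     ('k, ('m \<Rightarrow> 'n) set) module" where
  "Ext A P \<delta> N n =
     quotient_module (Hom_space A (P n) N \<lparr>carrier := cocycles A P \<delta> N n\<rparr>) (coboundaries A P \<delta> N n)"


section \<open>Global dimension and the Gorenstein property\<close>

definition trivial_module ::
    "('q, 'k::field) tensor_alg set \<Rightarrow>
     (('q, 'k) tensor_alg set, ('q, 'k) tensor_alg set set) module" where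
  "trivial_module R =
     quotient_module (regular_module (hom_alg R)) (cls R ` {p. \<forall>w \<in> Poly_Mapping.keys p. length w \<ge> 1})"

text \<open>
  The universe in which resolutions are taken.  It is large enough to contain an isomorphic copy
  of every countably generated module over \<^term>\<open>hom_alg R\<close>.  As \<^term>\<open>hom_alg R\<close> has countable
  dimension over \<open>'k\<close>, submodules of countably generated modules are countably generated, so
  a projective resolution of the trivial module of least length exists in this universe.
\<close>

type_synonym ('q, 'k) universe = "'q list \<Rightarrow> ('q, 'k) tensor_alg set"

definition has_global_dimension :: "('q, 'k::field) tensor_alg set \<Rightarrow> nat \<Rightarrow> bool" where
  "has_global_dimension R D \<longleftrightarrow>
     has_projective_dimension TYPE(('q, 'k) universe) (hom_alg R) (trivial_module R) D"

text \<open>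
  Up to isomorphism Ext does not depend on the projective resolution, and there is one because
  the global dimension is finite; the conditions are therefore required of all of them.
\<close>

definition gorenstein :: "('q, 'k::field) tensor_alg set \<Rightarrow> nat \<Rightarrow> bool" where
  "gorenstein R D \<longleftrightarrow> has_global_dimension R D \<and>
     (\<forall>(P :: nat \<Rightarrow> (('q, 'k) tensor_alg set, ('q, 'k) universe) module) \<delta> \<epsilon>.
        projective_resolution (hom_alg R) (trivial_module R) P \<delta> \<epsilon> \<longrightarrow>
          (let H = Ext (hom_alg R) P \<delta> (regular_module (hom_alg R)) in
             (\<forall>n. n \<noteq> D \<longrightarrow> carrier (H n) = {\<zero>\<^bsub>H n\<^esub>}) \<and>
             lmod_isomorphic (ring_of_type_algebra :: 'k ring) (H D)
               (regular_module (ring_of_type_algebra :: 'k ring))))"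


section \<open>Koszulity\<close>

definition koszul_space ::
    "nat \<Rightarrow> ('q, 'k::field) tensor_alg set \<Rightarrow> nat \<Rightarrow> ('q, 'k) tensor_alg set" where
  "koszul_space N R n =
     (if n < N then tensor_power n
      else (\<Inter>r \<in> {..n - N}. tensor_alg.span
              {u * p * v | u p v. u \<in> tensor_power r \<and> p \<in> R \<and> v \<in> tensor_power (n - N - r)}))"

text \<open>
  For a subspace \<open>V\<close> of \<open>T(E)\<close>, \<open>A \<otimes> V\<close> is the set of finite sums of pure tensors in \<open>A \<otimes> T(E)\<close>,
  the latter being identified with the finitely supported functions from words to \<open>A\<close>:
  \<open>(a \<otimes> v)(w) = v\<^sub>w a\<close>, where \<open>v\<^sub>w\<close> is the coefficient of the word \<open>w\<close> in \<open>v\<close>.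
\<close>

inductive_set tensor ::
    "('k, 'a) module \<Rightarrow> ('q, 'k::field) tensor_alg set \<Rightarrow> ('q list \<Rightarrow> 'a) set"
  for A :: "('k, 'a) module" and V :: "('q, 'k) tensor_alg set" where
  zero: "(\<lambda>w. \<zero>\<^bsub>A\<^esub>) \<in> tensor A V"
| add: "\<lbrakk>t \<in> tensor A V; a \<in> carrier A; v \<in> V\<rbrakk> \<Longrightarrow>
    (\<lambda>w. t w \<oplus>\<^bsub>A\<^esub> (Poly_Mapping.lookup v w \<odot>\<^bsub>A\<^esub> a)) \<in> tensor A V"

text \<open>
  On basis elements the map \<open>d\<close> sends \<open>a \<otimes> (x\<^sup>\<lambda> \<otimes> w)\<close> to \<open>a x\<^sup>\<lambda> \<otimes> w\<close>.
\<close>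

definition koszul_d ::
    "('q::finite, 'k::field) tensor_alg set \<Rightarrow> ('q, 'k) universe \<Rightarrow> ('q, 'k) universe" where
  "koszul_d R t = (\<lambda>w. finsum (hom_alg R) (\<lambda>l. t (l # w) \<otimes>\<^bsub>hom_alg R\<^esub> cls R (gen l)) UNIV)"

definition koszul_complex ::
    "nat \<Rightarrow> ('q::finite, 'k::field) tensor_alg set \<Rightarrow> nat \<Rightarrow> ('q, 'k) universe set" where
  "koszul_complex N R m =
     tensor (hom_alg R) (koszul_space N R (if even m then N * (m div 2) else N * (m div 2) + 1))"

text \<open>The differential from homological degree \<open>m\<close> to \<open>m - 1\<close>, for \<open>m \<ge> 1\<close>.\<close>

definition koszul_diff ::
    "nat \<Rightarrow> ('q::finite, 'k::field) tensor_alg set \<Rightarrow> nat \<Rightarrow> ('q, 'k) universe \<Rightarrow> ('q, 'k) universe" where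
  "koszul_diff N R m = (if even m then koszul_d R ^^ (N - 1) else koszul_d R)"

definition koszul :: "nat \<Rightarrow> ('q::finite, 'k::field) tensor_alg set \<Rightarrow> bool" where
  "koszul N R \<longleftrightarrow>
     (\<forall>m \<ge> 1. {t \<in> koszul_complex N R m. koszul_diff N R m t = (\<lambda>w. \<zero>\<^bsub>hom_alg R\<^esub>)} =
              koszul_diff N R (Suc m) ` koszul_complex N R (Suc m))"


section \<open>Multilinear forms\<close>

text \<open>An \<open>m\<close>-linear form on \<open>'k ^ 'q\<close> is given by its values on lists of vectors of length \<open>m\<close>.\<close>

type_synonym ('q, 'k) form = "('k ^ 'q) list \<Rightarrow> 'k"

definition multilinear :: "nat \<Rightarrow> ('q::finite, 'k::field) form \<Rightarrow> bool" where
  "multilinear m W \<longleftrightarrow>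
     (\<forall>xs ys. length xs + 1 + length ys = m \<longrightarrow>
        Vector_Spaces.linear (*s) (*) (\<lambda>x. W (xs @ x # ys)))"

definition GL :: "('k::field ^ 'q::finite \<Rightarrow> 'k ^ 'q) set" where
  "GL = {L. Vector_Spaces.linear (*s) (*s) L \<and> bij L}"

definition preregular :: "nat \<Rightarrow> ('q::finite, 'k::field) form \<Rightarrow> bool" where
  "preregular n W \<longleftrightarrow> multilinear (n + 1) W \<and>
     (\<forall>x. (\<forall>xs. length xs = n \<longrightarrow> W (x # xs) = 0) \<longrightarrow> x = 0) \<and>
     (\<exists>Q \<in> GL. \<forall>xs x. length xs = n \<longrightarrow> W (xs @ [x]) = W (Q x # xs))"

definition three_regular :: "nat \<Rightarrow> ('q::finite, 'k::field) form \<Rightarrow> bool" where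
  "three_regular N W \<longleftrightarrow> preregular N W \<and>
     (\<forall>L0 L1. Vector_Spaces.linear (*s) (*s) L0 \<and> Vector_Spaces.linear (*s) (*s) L1 \<and>
        (\<forall>x0 x1 xs. length xs = N - 1 \<longrightarrow> W (L0 x0 # x1 # xs) = W (x0 # L1 x1 # xs)) \<longrightarrow>
        (\<exists>c. L0 = (\<lambda>x. c *s x) \<and> L1 = (\<lambda>x. c *s x)))"

definition form_act ::
    "('k::field ^ 'q::finite \<Rightarrow> 'k ^ 'q) \<Rightarrow> ('q, 'k) form \<Rightarrow> ('q, 'k) form" where
  "form_act L W = (\<lambda>xs. W (map (inv_into UNIV L) xs))"

definition same_GL_orbit :: "nat \<Rightarrow> ('q::finite, 'k::field) form \<Rightarrow> ('q, 'k) form \<Rightarrow> bool" where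
  "same_GL_orbit m W W' \<longleftrightarrow> (\<exists>L \<in> GL. \<forall>xs. length xs = m \<longrightarrow> W' xs = form_act L W xs)"

definition form_relation :: "nat \<Rightarrow> ('q::finite, 'k::field) form \<Rightarrow> 'q \<Rightarrow> ('q, 'k) tensor_alg" where
  "form_relation N W l =
     (\<Sum>w | length w = N. tscale (W (map (\<lambda>i. axis i 1) (l # w))) (prod_list (map gen w)))"

definition form_relations :: "nat \<Rightarrow> ('q::finite, 'k::field) form \<Rightarrow> ('q, 'k) tensor_alg set" where
  "form_relations N W = tensor_alg.span (range (form_relation N W))"

end

theory Submission
  imports Defs
begin

text \<open>
  (a) The Koszul complex is a resolution of the trivial module by projective modules
  \<open>A \<otimes> K\<^sub>n\<close>.  Comparing it with a resolution of length three gives \<open>K\<^sub>2\<^sub>N = 0\<close>, so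
  homomorphisms \<open>A \<otimes> K\<^sub>N\<^sub>+\<^sub>1 \<rightarrow> A\<close> are the cocycles of degree three.  Since boundaries have
  coefficients in the augmentation ideal and \<open>Ext\<^sup>3\<close> is one-dimensional, \<open>K\<^sub>N\<^sub>+\<^sub>1\<close> is spanned by
  a single tensor \<open>k = \<Sum>\<^sub>\<lambda> x\<^sup>\<lambda> \<otimes> r\<^sub>\<lambda>\<close>, and the form \<open>W\<close> has the coefficients of \<open>k\<close> as components.
  The \<open>r\<^sub>\<lambda>\<close> are independent by one-dimensionality of \<open>Ext\<^sup>3\<close> and span \<open>R\<close> because \<open>Ext\<^sup>2 = 0\<close>.
  As \<open>k \<in> R \<otimes> E\<close>, moving the last argument of \<open>W\<close> to the front defines \<open>Q\<close>, and
  \<open>Ext\<^sup>1 = 0\<close> makes \<open>Q\<close> injective.  Condition (iii) for \<open>L\<^sub>0, L\<^sub>1\<close> becomes, after a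
  cyclic rotation, a statement on the first and last arguments: substituting \<open>Q\<^sup>-\<^sup>1 L\<^sub>0 Q\<close> for the last
  letter of the relations preserves \<open>R\<close>, hence defines a 1-cocycle with values in degree one, and
  \<open>Ext\<^sup>1 = 0\<close> forces it to be scalar.

  (b) If \<open>W' = W \<circ> L\<^sup>-\<^sup>1\<close>, the linear substitution of generators given by the transpose of \<open>L\<^sup>-\<^sup>1\<close>
  maps relations of \<open>W\<close> onto relations of \<open>W'\<close>.
\<close>

section \<open>Left modules\<close>

text \<open>No grading is put on Ext; two facts replace it. The ideal of relations starts in degree
  \<open>N\<close>, so a class determines the coefficients of its representatives on shorter words;
  as \<open>N \<ge> 2\<close>, constant terms and coefficients of single letters can be read off.
  And the Koszul differentials have coefficients without constant term, so the value of a coboundary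
  at 1 \<otimes> v has none either. Each condition on Ext becomes a comparison of such coefficients.
  Independence of the r_l: the class of k \<mapsto> 1 spans Ext^3, and constant terms show that k
  \<mapsto> x^m is a coboundary. So x^m is the sum of the x^l g(r_l) for some g, and the constant
  terms of the g(r_l) separate r_m from the other r_l. For Ext^1, coboundaries have the form x^l
  \<mapsto> x^l q with q independent of l: no constant part, and a scalar multiple of the identity
  in degree one. Injectivity of Q and condition (iii) are these two cases of one statement. The
  modules A \<otimes> V come without a basis; projecting words onto V makes them summands of free
  modules, and homomorphisms are expanded along words.\<close>

lemma lmod_homI:
  assumes "\<And>x. x \<in> carrier M \<Longrightarrow> f x \<in> carrier N"
    and "\<And>x y. x \<in> carrier M \<Longrightarrow> y \<in> carrier M \<Longrightarrow> f (x \<oplus>\<^bsub>M\<^esub> y) = f x \<oplus>\<^bsub>N\<^esub> f y"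
    and "\<And>a x. a \<in> carrier A \<Longrightarrow> x \<in> carrier M \<Longrightarrow> f (a \<odot>\<^bsub>M\<^esub> x) = a \<odot>\<^bsub>N\<^esub> f x"
  shows "f \<in> lmod_hom A M N"
  using assms by (auto simp: lmod_hom_def)

lemma lmod_homD:
  assumes "f \<in> lmod_hom A M N"
  shows lmod_hom_closed: "x \<in> carrier M \<Longrightarrow> f x \<in> carrier N"
    and lmod_hom_add: "x \<in> carrier M \<Longrightarrow> y \<in> carrier M \<Longrightarrow> f (x \<oplus>\<^bsub>M\<^esub> y) = f x \<oplus>\<^bsub>N\<^esub> f y"
    and lmod_hom_smult: "a \<in> carrier A \<Longrightarrow> x \<in> carrier M \<Longrightarrow> f (a \<odot>\<^bsub>M\<^esub> x) = a \<odot>\<^bsub>N\<^esub> f x"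
  using assms by (auto simp: lmod_hom_def)

lemma lmod_hom_comp:
  "f \<in> lmod_hom A L M \<Longrightarrow> g \<in> lmod_hom A M N \<Longrightarrow> (\<lambda>x. g (f x)) \<in> lmod_hom A L N"
  by (rule lmod_homI) (simp_all add: lmod_homD)

lemma lmod_hom_abelian_group_hom:
  assumes "f \<in> lmod_hom A M N" "abelian_group M" "abelian_group N"
  shows "abelian_group_hom M N f"
  using assms
  by (intro abelian_group_homI group_hom.intro group_hom_axioms.intro abelian_group.a_group)
    (auto simp: lmod_homD hom_def)

lemma lmod_hom_zero:
  assumes "f \<in> lmod_hom A M N" "abelian_group M" "abelian_group N"
  shows "f \<zero>\<^bsub>M\<^esub> = \<zero>\<^bsub>N\<^esub>"
  using abelian_group_hom.hom_zero[OF lmod_hom_abelian_group_hom[OF assms]] .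

lemma lmod_hom_minus:
  assumes "f \<in> lmod_hom A M N" "abelian_group M" "abelian_group N"
    and "x \<in> carrier M" "y \<in> carrier M"
  shows "f (x \<ominus>\<^bsub>M\<^esub> y) = f x \<ominus>\<^bsub>N\<^esub> f y"
proof -
  interpret abelian_group_hom M N f by (rule lmod_hom_abelian_group_hom) fact+
  show ?thesis using assms(4,5) by (simp add: a_minus_def)
qed

lemma lmod_hom_finsum:
  assumes "f \<in> lmod_hom A M N" "abelian_group M" "abelian_group N"
    and "finite T" "\<And>i. i \<in> T \<Longrightarrow> g i \<in> carrier M"
  shows "f (finsum M g T) = finsum N (\<lambda>i. f (g i)) T"
proof -
  interpret M: abelian_group M by fact
  interpret N: abelian_group N by fact
  show ?thesis using assms(4,5)
  proof (induction T)
    case empty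
    then show ?case using lmod_hom_zero[OF assms(1-3)] by simp
  next
    case (insert i T)
    then have "g \<in> insert i T \<rightarrow> carrier M" by auto
    with insert show ?case
      by (simp add: lmod_homD[OF assms(1)] M.finsum_insert N.finsum_insert)
  qed
qed

context left_module
begin

lemma lsmult_r_null:
  assumes "a \<in> carrier R"
  shows "a \<odot>\<^bsub>M\<^esub> \<zero>\<^bsub>M\<^esub> = \<zero>\<^bsub>M\<^esub>"
proof -
  have "a \<odot>\<^bsub>M\<^esub> \<zero>\<^bsub>M\<^esub> \<oplus>\<^bsub>M\<^esub> a \<odot>\<^bsub>M\<^esub> \<zero>\<^bsub>M\<^esub> = a \<odot>\<^bsub>M\<^esub> \<zero>\<^bsub>M\<^esub>"
    using lsmult_r_distr[OF assms M.zero_closed M.zero_closed] by simp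
  then show ?thesis
    using lsmult_closed[OF assms M.zero_closed] by (metis M.add.r_cancel_one')
qed

lemma lsmult_l_null:
  assumes "x \<in> carrier M"
  shows "\<zero>\<^bsub>R\<^esub> \<odot>\<^bsub>M\<^esub> x = \<zero>\<^bsub>M\<^esub>"
proof -
  have "\<zero>\<^bsub>R\<^esub> \<odot>\<^bsub>M\<^esub> x \<oplus>\<^bsub>M\<^esub> \<zero>\<^bsub>R\<^esub> \<odot>\<^bsub>M\<^esub> x = \<zero>\<^bsub>R\<^esub> \<odot>\<^bsub>M\<^esub> x"
    using lsmult_l_distr[OF R.zero_closed R.zero_closed assms] by simp
  then show ?thesis
    using lsmult_closed[OF R.zero_closed assms] by (metis M.add.r_cancel_one')
qed

lemma lsmult_r_minus:
  assumes "a \<in> carrier R" "x \<in> carrier M"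
  shows "a \<odot>\<^bsub>M\<^esub> (\<ominus>\<^bsub>M\<^esub> x) = \<ominus>\<^bsub>M\<^esub> (a \<odot>\<^bsub>M\<^esub> x)"
proof -
  have "a \<odot>\<^bsub>M\<^esub> (\<ominus>\<^bsub>M\<^esub> x) \<oplus>\<^bsub>M\<^esub> a \<odot>\<^bsub>M\<^esub> x = a \<odot>\<^bsub>M\<^esub> (\<ominus>\<^bsub>M\<^esub> x \<oplus>\<^bsub>M\<^esub> x)"
    using assms by (simp add: lsmult_r_distr)
  also have "\<dots> = \<zero>\<^bsub>M\<^esub>" using assms by (simp add: M.l_neg lsmult_r_null)
  finally show ?thesis
    using assms lsmult_closed by (metis M.a_inv_closed M.minus_equality)
qed

lemma lsmult_finsum:
  assumes "finite T" "a \<in> carrier R" "\<And>i. i \<in> T \<Longrightarrow> g i \<in> carrier M"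
  shows "a \<odot>\<^bsub>M\<^esub> finsum M g T = finsum M (\<lambda>i. a \<odot>\<^bsub>M\<^esub> g i) T"
  using assms(1,3)
proof (induction T)
  case empty
  then show ?case using assms(2) by (simp add: lsmult_r_null)
next
  case (insert i T)
  then have "g \<in> insert i T \<rightarrow> carrier M" "(\<lambda>i. a \<odot>\<^bsub>M\<^esub> g i) \<in> insert i T \<rightarrow> carrier M"
    using assms(2) lsmult_closed by auto
  with insert show ?case using assms(2)
    by (simp add: M.finsum_insert lsmult_r_distr)
qed

end

lemma lmod_hom_diff:
  assumes "f \<in> lmod_hom A M N" "g \<in> lmod_hom A M N" "left_module A M" "left_module A N"
  shows "(\<lambda>x. f x \<ominus>\<^bsub>N\<^esub> g x) \<in> lmod_hom A M N"
proof -
  interpret M: left_module A M by fact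
  interpret N: left_module A N by fact
  show ?thesis
    using assms(1,2)
    by (intro lmod_homI)
      (auto simp: lmod_homD a_minus_def N.lsmult_r_distr N.lsmult_r_minus N.M.minus_add
        N.M.a_ac)
qed

subsection \<open>Lifting homomorphisms from projective modules\<close>

definition free_basis :: "('a, 'r) ring_scheme \<Rightarrow> 'i \<Rightarrow> 'i \<Rightarrow> 'a" where
  "free_basis A i = (\<lambda>j. if j = i then \<one>\<^bsub>A\<^esub> else \<zero>\<^bsub>A\<^esub>)"

lemma free_basis_closed:
  assumes "ring A" "i \<in> S"
  shows "free_basis A i \<in> carrier (free_module A S)"
proof -
  interpret ring A by fact
  have "{j. free_basis A i j \<noteq> \<zero>\<^bsub>A\<^esub>} \<subseteq> {i}" by (auto simp: free_basis_def)
  then have "finite {j. free_basis A i j \<noteq> \<zero>\<^bsub>A\<^esub>}" by (rule finite_subset) simp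
  moreover have "free_basis A i j \<in> carrier A" for j by (simp add: free_basis_def)
  moreover have "free_basis A i j = \<zero>\<^bsub>A\<^esub>" if "j \<notin> S" for j
    using that assms(2) by (auto simp: free_basis_def)
  ultimately show ?thesis by (simp add: free_module_def)
qed

lemma left_module_free_module:
  assumes "ring A"
  shows "left_module A (free_module A S)"
proof -
  interpret ring A by fact
  have fin: "finite {i. f i \<oplus>\<^bsub>A\<^esub> g i \<noteq> \<zero>\<^bsub>A\<^esub>}"
    if "finite {i. f i \<noteq> \<zero>\<^bsub>A\<^esub>}" "finite {i. g i \<noteq> \<zero>\<^bsub>A\<^esub>}" for f g :: "'c \<Rightarrow> 'a"
    by (rule finite_subset[OF _ finite_UnI[OF that]]) auto
  have fin2: "finite {i. a \<otimes>\<^bsub>A\<^esub> f i \<noteq> \<zero>\<^bsub>A\<^esub>}"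
    if "finite {i. f i \<noteq> \<zero>\<^bsub>A\<^esub>}" "a \<in> carrier A" for a and f :: "'c \<Rightarrow> 'a"
    by (rule finite_subset[OF _ that(1)]) (use that(2) in auto)
  have inv: "\<exists>g\<in>carrier (free_module A S). g \<oplus>\<^bsub>free_module A S\<^esub> f = \<zero>\<^bsub>free_module A S\<^esub>"
    if f: "f \<in> carrier (free_module A S)" for f
  proof
    have c: "f i \<in> carrier A" for i using f by (cases "i \<in> S") (auto simp: free_module_def)
    have "finite {i. \<ominus>\<^bsub>A\<^esub> f i \<noteq> \<zero>\<^bsub>A\<^esub>}"
      by (rule finite_subset[of _ "{i. f i \<noteq> \<zero>\<^bsub>A\<^esub>}"]) (use f in \<open>auto simp: free_module_def\<close>)
    then show "(\<lambda>i. \<ominus>\<^bsub>A\<^esub> f i) \<in> carrier (free_module A S)"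
      using f by (auto simp: free_module_def)
    show "(\<lambda>i. \<ominus>\<^bsub>A\<^esub> f i) \<oplus>\<^bsub>free_module A S\<^esub> f = \<zero>\<^bsub>free_module A S\<^esub>"
      using c by (auto simp: free_module_def l_neg)
  qed
  have car: "f i \<in> carrier A" if "f \<in> carrier (free_module A S)" for f i
    using that by (cases "i \<in> S") (auto simp: free_module_def)
  show ?thesis
  proof (intro left_module.intro left_module_axioms.intro \<open>ring A\<close> abelian_groupI)
    fix f assume f: "f \<in> carrier (free_module A S)"
    show "\<exists>g\<in>carrier (free_module A S). g \<oplus>\<^bsub>free_module A S\<^esub> f = \<zero>\<^bsub>free_module A S\<^esub>"
      using inv[OF f] .
  next
    fix f g h assume *: "f \<in> carrier (free_module A S)" "g \<in> carrier (free_module A S)"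
      "h \<in> carrier (free_module A S)"
    note c = car[OF *(1)] car[OF *(2)] car[OF *(3)]
    show "f \<oplus>\<^bsub>free_module A S\<^esub> g \<oplus>\<^bsub>free_module A S\<^esub> h =
        f \<oplus>\<^bsub>free_module A S\<^esub> (g \<oplus>\<^bsub>free_module A S\<^esub> h)"
      using c by (simp add: free_module_def a_assoc)
  next
    fix f g assume *: "f \<in> carrier (free_module A S)" "g \<in> carrier (free_module A S)"
    note c = car[OF *(1)] car[OF *(2)]
    show "f \<oplus>\<^bsub>free_module A S\<^esub> g = g \<oplus>\<^bsub>free_module A S\<^esub> f"
      using c by (simp add: free_module_def a_comm)
    show "f \<oplus>\<^bsub>free_module A S\<^esub> g \<in> carrier (free_module A S)"
      using * fin by (auto simp: free_module_def)
    fix a assume "a \<in> carrier A"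
    then show "a \<odot>\<^bsub>free_module A S\<^esub> (f \<oplus>\<^bsub>free_module A S\<^esub> g) =
        a \<odot>\<^bsub>free_module A S\<^esub> f \<oplus>\<^bsub>free_module A S\<^esub> a \<odot>\<^bsub>free_module A S\<^esub> g"
      using c by (simp add: free_module_def r_distr)
  next
    fix a f assume a: "a \<in> carrier A" and f: "f \<in> carrier (free_module A S)"
    show "a \<odot>\<^bsub>free_module A S\<^esub> f \<in> carrier (free_module A S)"
      using a f fin2 by (auto simp: free_module_def)
    fix b assume b: "b \<in> carrier A"
    show "(a \<oplus>\<^bsub>A\<^esub> b) \<odot>\<^bsub>free_module A S\<^esub> f =
        a \<odot>\<^bsub>free_module A S\<^esub> f \<oplus>\<^bsub>free_module A S\<^esub> b \<odot>\<^bsub>free_module A S\<^esub> f"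
      using a b car[OF f] by (simp add: free_module_def l_distr)
    show "(a \<otimes>\<^bsub>A\<^esub> b) \<odot>\<^bsub>free_module A S\<^esub> f =
        a \<odot>\<^bsub>free_module A S\<^esub> (b \<odot>\<^bsub>free_module A S\<^esub> f)"
      using a b car[OF f] by (simp add: free_module_def m_assoc)
  next
    fix f assume f: "f \<in> carrier (free_module A S)"
    show "\<zero>\<^bsub>free_module A S\<^esub> \<oplus>\<^bsub>free_module A S\<^esub> f = f" "\<one>\<^bsub>A\<^esub> \<odot>\<^bsub>free_module A S\<^esub> f = f"
      using car[OF f] by (simp_all add: free_module_def)
  next
    show "\<zero>\<^bsub>free_module A S\<^esub> \<in> carrier (free_module A S)"
      by (simp add: free_module_def)
  qed
qed

text \<open>\<open>T\<close> may be any finite set containing the support, not only the support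
  itself: the induction clears one coordinate of \<open>f\<close> at a time and keeps the remaining
  support inside the smaller set.\<close>

lemma free_module_hom_expand:
  assumes "ring A" "left_module A N" "k \<in> lmod_hom A (free_module A S) N"
    and "finite T" "T \<subseteq> S" "f \<in> carrier (free_module A S)" "\<And>i. i \<notin> T \<Longrightarrow> f i = \<zero>\<^bsub>A\<^esub>"
  shows "k f = finsum N (\<lambda>i. f i \<odot>\<^bsub>N\<^esub> k (free_basis A i)) T"
  using assms(4-7)
proof (induction T arbitrary: f)
  case empty
  interpret F: left_module A "free_module A S" by (rule left_module_free_module) fact
  interpret N: left_module A N by fact
  have "f = \<zero>\<^bsub>free_module A S\<^esub>" using empty by (auto simp: free_module_def)
  then show ?case
    using lmod_hom_zero[OF assms(3) F.M.abelian_group_axioms N.M.abelian_group_axioms] by simp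
next
  case (insert i T)
  interpret F: left_module A "free_module A S" by (rule left_module_free_module) fact
  interpret N: left_module A N by fact
  have car: "f j \<in> carrier A" for j
    using insert.prems by (cases "j \<in> S") (auto simp: free_module_def)
  define f' where "f' = f(i := \<zero>\<^bsub>A\<^esub>)"
  have "finite {j. f' j \<noteq> \<zero>\<^bsub>A\<^esub>}"
    by (rule finite_subset[of _ T]) (use insert in \<open>auto simp: f'_def\<close>)
  then have f': "f' \<in> carrier (free_module A S)"
    using insert.prems by (auto simp: f'_def free_module_def)
  have b: "free_basis A i \<in> carrier (free_module A S)"
    using insert.prems by (intro free_basis_closed assms(1)) auto
  have f: "f = (f i \<odot>\<^bsub>free_module A S\<^esub> free_basis A i) \<oplus>\<^bsub>free_module A S\<^esub> f'"
    using car by (auto simp: free_module_def f'_def free_basis_def fun_eq_iff)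
  have IH: "k f' = finsum N (\<lambda>j. f' j \<odot>\<^bsub>N\<^esub> k (free_basis A j)) T"
    using insert by (intro insert.IH f') (auto simp: f'_def)
  have kb: "k (free_basis A j) \<in> carrier N" if "j \<in> S" for j
    using free_basis_closed[OF assms(1) that] assms(3) by (auto simp: lmod_homD)
  have kb': "f j \<odot>\<^bsub>N\<^esub> k (free_basis A j) \<in> carrier N" if "j \<in> S" for j
    using N.lsmult_closed[OF car kb[OF that]] .
  have sub: "finsum N (\<lambda>j. f' j \<odot>\<^bsub>N\<^esub> k (free_basis A j)) T =
      finsum N (\<lambda>j. f j \<odot>\<^bsub>N\<^esub> k (free_basis A j)) T"
  proof (rule N.M.finsum_cong'[OF refl])
    show "(\<lambda>j. f j \<odot>\<^bsub>N\<^esub> k (free_basis A j)) \<in> T \<rightarrow> carrier N"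
      using kb' insert.prems by blast
    show "f' j \<odot>\<^bsub>N\<^esub> k (free_basis A j) = f j \<odot>\<^bsub>N\<^esub> k (free_basis A j)" if "j \<in> T" for j
      using that insert.hyps by (auto simp: f'_def)
  qed
  have "k f = f i \<odot>\<^bsub>N\<^esub> k (free_basis A i) \<oplus>\<^bsub>N\<^esub> k f'"
  proof -
    have "k (f i \<odot>\<^bsub>free_module A S\<^esub> free_basis A i \<oplus>\<^bsub>free_module A S\<^esub> f') =
        f i \<odot>\<^bsub>N\<^esub> k (free_basis A i) \<oplus>\<^bsub>N\<^esub> k f'"
      using car b f' by (simp add: lmod_homD[OF assms(3)] F.lsmult_closed)
    then show ?thesis using f by simp
  qed
  also have "\<dots> = finsum N (\<lambda>i. f i \<odot>\<^bsub>N\<^esub> k (free_basis A i)) (insert i T)"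
    unfolding IH sub using insert.hyps insert.prems kb'
    by (intro N.M.finsum_insert[symmetric]) blast+
  finally show ?case .
qed

lemma free_module_lift:
  assumes "ring A" "left_module A N" "\<And>i. i \<in> S \<Longrightarrow> q i \<in> carrier N"
  shows "\<exists>h \<in> lmod_hom A (free_module A S) N. \<forall>i \<in> S. h (free_basis A i) = q i"
proof -
  interpret F: left_module A "free_module A S" by (rule left_module_free_module) fact
  interpret N: left_module A N by fact
  define h where "h f = finsum N (\<lambda>i. f i \<odot>\<^bsub>N\<^esub> q i) {i. f i \<noteq> \<zero>\<^bsub>A\<^esub>}" for f
  have car: "f j \<in> carrier A" if "f \<in> carrier (free_module A S)" for f j
    using that by (cases "j \<in> S") (auto simp: free_module_def)
  have supp: "{i. f i \<noteq> \<zero>\<^bsub>A\<^esub>} \<subseteq> S" "finite {i. f i \<noteq> \<zero>\<^bsub>A\<^esub>}"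
    if "f \<in> carrier (free_module A S)" for f
    using that by (auto simp: free_module_def)
  \<comment> \<open>The support depends on \<open>f\<close>, so sums over different supports are not
    directly comparable. Zero coordinates contribute nothing, and two elements can be evaluated over
    the union of their supports.\<close>
  have hT: "h f = finsum N (\<lambda>i. f i \<odot>\<^bsub>N\<^esub> q i) T"
    if "f \<in> carrier (free_module A S)" "finite T" "T \<subseteq> S" "{i. f i \<noteq> \<zero>\<^bsub>A\<^esub>} \<subseteq> T" for f T
    unfolding h_def using that car[OF that(1)] assms(3)
    by (intro N.M.add.finprod_mono_neutral_cong_left) (auto intro!: N.lsmult_closed N.lsmult_l_null)
  have "h \<in> lmod_hom A (free_module A S) N"
  proof (rule lmod_homI)
    show "h f \<in> carrier N" if "f \<in> carrier (free_module A S)" for f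
      unfolding h_def using car[OF that] supp[OF that] assms(3)
      by (auto intro!: N.M.finsum_closed N.lsmult_closed)
    show "h (f \<oplus>\<^bsub>free_module A S\<^esub> g) = h f \<oplus>\<^bsub>N\<^esub> h g"
      if "f \<in> carrier (free_module A S)" "g \<in> carrier (free_module A S)" for f g
    proof -
      let ?T = "{i. f i \<noteq> \<zero>\<^bsub>A\<^esub>} \<union> {i. g i \<noteq> \<zero>\<^bsub>A\<^esub>}"
      have T: "finite ?T" "?T \<subseteq> S" using supp that by auto
      have fg: "f \<oplus>\<^bsub>free_module A S\<^esub> g \<in> carrier (free_module A S)" using that by simp
      have e: "(f \<oplus>\<^bsub>free_module A S\<^esub> g) i = f i \<oplus>\<^bsub>A\<^esub> g i" for i by (simp add: free_module_def)
      have "h (f \<oplus>\<^bsub>free_module A S\<^esub> g) = finsum N (\<lambda>i. (f i \<oplus>\<^bsub>A\<^esub> g i) \<odot>\<^bsub>N\<^esub> q i) ?T"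
        by (subst hT[OF fg T]) (auto simp: e)
      also have "\<dots> = finsum N (\<lambda>i. f i \<odot>\<^bsub>N\<^esub> q i \<oplus>\<^bsub>N\<^esub> g i \<odot>\<^bsub>N\<^esub> q i) ?T"
        using T car that assms(3)
        by (intro N.M.finsum_cong') (auto intro!: N.lsmult_closed N.lsmult_l_distr N.M.a_closed)
      also have "\<dots> = finsum N (\<lambda>i. f i \<odot>\<^bsub>N\<^esub> q i) ?T \<oplus>\<^bsub>N\<^esub> finsum N (\<lambda>i. g i \<odot>\<^bsub>N\<^esub> q i) ?T"
        using T car that assms(3)
        by (intro N.M.finsum_addf) (auto intro!: N.lsmult_closed)
      also have "\<dots> = h f \<oplus>\<^bsub>N\<^esub> h g"
        using hT[OF that(1) T] hT[OF that(2) T] by simp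
      finally show ?thesis .
    qed
    show "h (a \<odot>\<^bsub>free_module A S\<^esub> f) = a \<odot>\<^bsub>N\<^esub> h f"
      if "a \<in> carrier A" "f \<in> carrier (free_module A S)" for a f
    proof -
      let ?T = "{i. f i \<noteq> \<zero>\<^bsub>A\<^esub>}"
      have T: "finite ?T" "?T \<subseteq> S" using supp that by auto
      have af: "a \<odot>\<^bsub>free_module A S\<^esub> f \<in> carrier (free_module A S)"
        using that by (simp add: F.lsmult_closed)
      have e: "(a \<odot>\<^bsub>free_module A S\<^esub> f) i = a \<otimes>\<^bsub>A\<^esub> f i" for i by (simp add: free_module_def)
      have "h (a \<odot>\<^bsub>free_module A S\<^esub> f) = finsum N (\<lambda>i. (a \<otimes>\<^bsub>A\<^esub> f i) \<odot>\<^bsub>N\<^esub> q i) ?T"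
        by (subst hT[OF af T]) (use that in \<open>auto simp: e\<close>)
      also have "\<dots> = finsum N (\<lambda>i. a \<odot>\<^bsub>N\<^esub> (f i \<odot>\<^bsub>N\<^esub> q i)) ?T"
        using T car that assms(3)
        by (intro N.M.finsum_cong') (auto intro!: N.lsmult_closed simp: N.lsmult_assoc)
      also have "\<dots> = a \<odot>\<^bsub>N\<^esub> finsum N (\<lambda>i. f i \<odot>\<^bsub>N\<^esub> q i) ?T"
        using T car that assms(3)
        by (intro N.lsmult_finsum[symmetric]) (auto intro!: N.lsmult_closed)
      also have "\<dots> = a \<odot>\<^bsub>N\<^esub> h f" by (simp add: h_def)
      finally show ?thesis .
    qed
  qed
  moreover have "h (free_basis A i) = q i" if "i \<in> S" for i
  proof -
    have "h (free_basis A i) = finsum N (\<lambda>j. free_basis A i j \<odot>\<^bsub>N\<^esub> q j) {i}"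
      using that by (intro hT free_basis_closed assms(1)) (auto simp: free_basis_def)
    then show ?thesis using assms(3)[OF that]
      by (simp add: N.M.finsum_insert free_basis_def N.lsmult_one)
  qed
  ultimately show ?thesis by blast
qed

text \<open>Comparing images instead of asking for a surjective \<open>g\<close> lets exactness be
  used directly, without making kernels into modules. Preimages are chosen on the basis of the free
  module, and the resulting map is precomposed with the section \<open>s\<close>.\<close>

lemma projective_lift:
  assumes P: "projective_lmod A P" and Q: "left_module A Q" and N: "left_module A N"
    and g: "g \<in> lmod_hom A Q N" and f: "f \<in> lmod_hom A P N"
    and im: "f ` carrier P \<subseteq> g ` carrier Q"
  shows "\<exists>h \<in> lmod_hom A P Q. \<forall>x \<in> carrier P. g (h x) = f x"
proof -
  interpret P: left_module A P using P by (simp add: projective_lmod_def)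
  interpret Q: left_module A Q by fact
  interpret N: left_module A N by fact
  have A: "ring A" by (rule P.R.ring_axioms)
  obtain S s r where s: "s \<in> lmod_hom A P (free_module A (S :: 'c set))"
    and r: "r \<in> lmod_hom A (free_module A S) P" and rs: "\<And>x. x \<in> carrier P \<Longrightarrow> r (s x) = x"
    using P by (auto simp: projective_lmod_def)
  have "\<forall>i \<in> S. \<exists>y. y \<in> carrier Q \<and> g y = f (r (free_basis A i))"
  proof
    fix i assume that: "i \<in> S"
    have "f (r (free_basis A i)) \<in> g ` carrier Q"
      using im lmod_hom_closed[OF r free_basis_closed[OF A that]] by blast
    then obtain y where y: "f (r (free_basis A i)) = g y" "y \<in> carrier Q" by (rule imageE)
    show "\<exists>y. y \<in> carrier Q \<and> g y = f (r (free_basis A i))"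
      by (intro exI[of _ y] conjI y(2) y(1)[symmetric])
  qed
  then obtain q where "\<forall>i \<in> S. q i \<in> carrier Q \<and> g (q i) = f (r (free_basis A i))"
    by (rule bchoice[THEN exE])
  then have q: "\<And>i. i \<in> S \<Longrightarrow> q i \<in> carrier Q"
    "\<And>i. i \<in> S \<Longrightarrow> g (q i) = f (r (free_basis A i))" by simp_all
  have "\<exists>h \<in> lmod_hom A (free_module A S) Q. \<forall>i \<in> S. h (free_basis A i) = q i"
    using A Q q(1) by (rule free_module_lift)
  then obtain h where h: "h \<in> lmod_hom A (free_module A S) Q"
    "\<forall>i \<in> S. h (free_basis A i) = q i"
    by (elim bexE)
  have "g (h \<phi>) = f (r \<phi>)" if "\<phi> \<in> carrier (free_module A S)" for \<phi>
  proof -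
    let ?T = "{i. \<phi> i \<noteq> \<zero>\<^bsub>A\<^esub>}"
    have T: "finite ?T" "?T \<subseteq> S" using that by (auto simp: free_module_def)
    have gh: "(\<lambda>\<phi>. g (h \<phi>)) \<in> lmod_hom A (free_module A S) N" using h(1) g by (rule lmod_hom_comp)
    have fr: "(\<lambda>\<phi>. f (r \<phi>)) \<in> lmod_hom A (free_module A S) N" using r f by (rule lmod_hom_comp)
    have "finsum N (\<lambda>i. \<phi> i \<odot>\<^bsub>N\<^esub> g (h (free_basis A i))) ?T
        = finsum N (\<lambda>i. \<phi> i \<odot>\<^bsub>N\<^esub> f (r (free_basis A i))) ?T"
    proof (rule N.M.finsum_cong')
      show "(\<lambda>i. \<phi> i \<odot>\<^bsub>N\<^esub> f (r (free_basis A i))) \<in> ?T \<rightarrow> carrier N"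
        using T that
        by (auto intro!: N.lsmult_closed lmod_hom_closed[OF f] lmod_hom_closed[OF r]
            free_basis_closed A simp: free_module_def)
    qed (use T h(2) q(2) in auto)
    then show ?thesis
      using free_module_hom_expand[OF A N gh T that] free_module_hom_expand[OF A N fr T that]
      by simp
  qed
  then have "\<forall>x \<in> carrier P. g (h (s x)) = f x"
    using rs lmod_hom_closed[OF s] by auto
  then show ?thesis using lmod_hom_comp[OF s h(1)] by (rule bexI[where x = "\<lambda>x. h (s x)"])
qed

subsection \<open>Comparison of projective resolutions\<close>

lemma projective_resolutionD:
  assumes "projective_resolution A M P \<delta> \<epsilon>"
  shows "projective_lmod A (P n)" "left_module A (P n)" "abelian_group (P n)"
    and "\<epsilon> \<in> lmod_hom A (P 0) M" "\<delta> n \<in> lmod_hom A (P (Suc n)) (P n)"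
    and "\<epsilon> ` carrier (P 0) = carrier M"
    and "{x \<in> carrier (P 0). \<epsilon> x = \<zero>\<^bsub>M\<^esub>} = \<delta> 0 ` carrier (P 1)"
    and "{x \<in> carrier (P (Suc n)). \<delta> n x = \<zero>\<^bsub>P n\<^esub>} = \<delta> (Suc n) ` carrier (P (Suc (Suc n)))"
  using assms by (auto simp: projective_resolution_def projective_lmod_def left_module_def)

lemma projective_resolution_cycle:
  assumes "projective_resolution A M P \<delta> \<epsilon>"
  shows "x \<in> carrier (P 1) \<Longrightarrow> \<epsilon> (\<delta> 0 x) = \<zero>\<^bsub>M\<^esub>"
    and "y \<in> carrier (P (Suc (Suc n))) \<Longrightarrow> \<delta> n (\<delta> (Suc n) y) = \<zero>\<^bsub>P n\<^esub>"
  using projective_resolutionD(7)[OF assms] projective_resolutionD(8)[OF assms, of n] by blast+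

lemma projective_resolution_exact:
  assumes "projective_resolution A M P \<delta> \<epsilon>"
  shows "x \<in> carrier (P 0) \<Longrightarrow> \<epsilon> x = \<zero>\<^bsub>M\<^esub> \<Longrightarrow> x \<in> \<delta> 0 ` carrier (P 1)"
    and "y \<in> carrier (P (Suc n)) \<Longrightarrow> \<delta> n y = \<zero>\<^bsub>P n\<^esub> \<Longrightarrow> y \<in> \<delta> (Suc n) ` carrier (P (Suc (Suc n)))"
  using projective_resolutionD(7)[OF assms] projective_resolutionD(8)[OF assms, of n] by blast+

lemma chain_map_lift:
  assumes P: "projective_resolution A M P \<delta> \<epsilon>" and F: "projective_resolution A M F d \<eta>"
    and M: "left_module A M"
  shows "\<exists>\<phi>. (\<forall>n. \<phi> n \<in> lmod_hom A (P n) (F n)) \<and>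
    (\<forall>x \<in> carrier (P 0). \<eta> (\<phi> 0 x) = \<epsilon> x) \<and>
    (\<forall>n. \<forall>x \<in> carrier (P (Suc n)). d n (\<phi> (Suc n) x) = \<phi> n (\<delta> n x))"
proof -
  note PD = projective_resolutionD[OF P] and FD = projective_resolutionD[OF F]
  have start: "\<exists>f \<in> lmod_hom A (P 0) (F 0). \<forall>x \<in> carrier (P 0). \<eta> (f x) = \<epsilon> x"
    using PD(4,6) FD(6) by (intro projective_lift[OF PD(1) FD(2) M FD(4)]) simp_all
  have base: "\<exists>g \<in> lmod_hom A (P 1) (F 1). \<forall>x \<in> carrier (P 1). d 0 (g x) = f (\<delta> 0 x)"
    if f: "f \<in> lmod_hom A (P 0) (F 0)" and fe: "\<forall>x \<in> carrier (P 0). \<eta> (f x) = \<epsilon> x" for f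
  proof (rule projective_lift[OF PD(1) FD(2) FD(2)])
    show "(\<lambda>x. f (\<delta> 0 x)) \<in> lmod_hom A (P 1) (F 0)"
      using PD(5)[of 0] f by (auto intro: lmod_hom_comp)
    show "d 0 \<in> lmod_hom A (F 1) (F 0)" using FD(5)[of 0] by simp
    show "(\<lambda>x. f (\<delta> 0 x)) ` carrier (P 1) \<subseteq> d 0 ` carrier (F 1)"
    proof
      fix y assume "y \<in> (\<lambda>x. f (\<delta> 0 x)) ` carrier (P 1)"
      then obtain x where x: "x \<in> carrier (P 1)" and y: "y = f (\<delta> 0 x)" by (elim imageE)
      have dx: "\<delta> 0 x \<in> carrier (P 0)" using x PD(5)[of 0] by (simp add: lmod_homD)
      have "\<eta> y = \<zero>\<^bsub>M\<^esub>"
        using fe dx projective_resolution_cycle(1)[OF P x] by (simp add: y)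
      then show "y \<in> d 0 ` carrier (F 1)"
        using projective_resolution_exact(1)[OF F] lmod_hom_closed[OF f dx] by (simp add: y)
    qed
  qed
  have step: "\<exists>h \<in> lmod_hom A (P (Suc (Suc n))) (F (Suc (Suc n))).
      \<forall>x \<in> carrier (P (Suc (Suc n))). d (Suc n) (h x) = g (\<delta> (Suc n) x)"
    if f: "f \<in> lmod_hom A (P n) (F n)" and g: "g \<in> lmod_hom A (P (Suc n)) (F (Suc n))"
      and fg: "\<forall>x \<in> carrier (P (Suc n)). d n (g x) = f (\<delta> n x)" for n f g
  proof (rule projective_lift[OF PD(1) FD(2) FD(2) FD(5)])
    show "(\<lambda>x. g (\<delta> (Suc n) x)) \<in> lmod_hom A (P (Suc (Suc n))) (F (Suc n))"
      using PD(5)[of "Suc n"] g by (rule lmod_hom_comp)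
    show "(\<lambda>x. g (\<delta> (Suc n) x)) ` carrier (P (Suc (Suc n))) \<subseteq> d (Suc n) ` carrier (F (Suc (Suc n)))"
    proof
      fix y assume "y \<in> (\<lambda>x. g (\<delta> (Suc n) x)) ` carrier (P (Suc (Suc n)))"
      then obtain x where x: "x \<in> carrier (P (Suc (Suc n)))" and y: "y = g (\<delta> (Suc n) x)"
        by (elim imageE)
      have dx: "\<delta> (Suc n) x \<in> carrier (P (Suc n))" using x PD(5)[of "Suc n"] by (simp add: lmod_homD)
      have "d n y = \<zero>\<^bsub>F n\<^esub>"
        using fg dx projective_resolution_cycle(2)[OF P x] lmod_hom_zero[OF f PD(3) FD(3)]
        by (simp add: y)
      then show "y \<in> d (Suc n) ` carrier (F (Suc (Suc n)))"
        using projective_resolution_exact(2)[OF F] lmod_hom_closed[OF g dx] by (simp add: y)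
    qed
  qed
  \<comment> \<open>The next component is a lift that exists only because the preceding square
    commutes, so dependent choice runs over pairs of consecutive components.\<close>
  define Q where "Q n fg \<longleftrightarrow> fst fg \<in> lmod_hom A (P n) (F n) \<and> snd fg \<in> lmod_hom A (P (Suc n)) (F (Suc n)) \<and>
      (\<forall>x \<in> carrier (P (Suc n)). d n (snd fg x) = fst fg (\<delta> n x)) \<and>
      (n = 0 \<longrightarrow> (\<forall>x \<in> carrier (P 0). \<eta> (fst fg x) = \<epsilon> x))" for n fg
  have "\<exists>s. \<forall>n. Q n (s n) \<and> fst (s (Suc n)) = snd (s n)"
  proof (rule dependent_nat_choice)
    obtain f where f: "f \<in> lmod_hom A (P 0) (F 0)" "\<forall>x \<in> carrier (P 0). \<eta> (f x) = \<epsilon> x"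
      using start by blast
    obtain g where "g \<in> lmod_hom A (P 1) (F 1)" "\<forall>x \<in> carrier (P 1). d 0 (g x) = f (\<delta> 0 x)"
      using base[OF f] by blast
    then have "Q 0 (f, g)" using f by (simp add: Q_def)
    then show "\<exists>fg. Q 0 fg" by blast
  next
    fix fg n assume "Q n fg"
    then have fg: "fst fg \<in> lmod_hom A (P n) (F n)" "snd fg \<in> lmod_hom A (P (Suc n)) (F (Suc n))"
      "\<forall>x \<in> carrier (P (Suc n)). d n (snd fg x) = fst fg (\<delta> n x)" by (simp_all add: Q_def)
    obtain h where "h \<in> lmod_hom A (P (Suc (Suc n))) (F (Suc (Suc n)))"
      "\<forall>x \<in> carrier (P (Suc (Suc n))). d (Suc n) (h x) = snd fg (\<delta> (Suc n) x)"
      using step[OF fg] by blast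
    then have "Q (Suc n) (snd fg, h)" using fg by (simp add: Q_def)
    then show "\<exists>fg'. Q (Suc n) fg' \<and> fst fg' = snd fg" by (intro exI[of _ "(snd fg, h)"]) simp
  qed
  then obtain s where s: "\<And>n. Q n (s n)" "\<And>n. fst (s (Suc n)) = snd (s n)" by blast
  show ?thesis
  proof (intro exI[of _ "\<lambda>n. fst (s n)"] conjI allI ballI)
    show "fst (s n) \<in> lmod_hom A (P n) (F n)" for n using s(1)[of n] by (simp add: Q_def)
    show "\<eta> (fst (s 0) x) = \<epsilon> x" if "x \<in> carrier (P 0)" for x
      using s(1)[of 0] that by (simp add: Q_def)
    show "d n (fst (s (Suc n)) x) = fst (s n) (\<delta> n x)" if "x \<in> carrier (P (Suc n))" for n x
      using s(1)[of n] that by (simp add: Q_def s(2))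
  qed
qed

text \<open>The map \<open>h n\<close> contracts \<open>\<theta>\<close>: it is built from the lift of \<open>\<theta> (n + 1) - h n \<circ> d n\<close> through \<open>d (n + 1)\<close>.\<close>

lemma null_homotopy:
  assumes F: "projective_resolution A M F d \<eta>" and M: "left_module A M"
    and \<theta>: "\<And>n. \<theta> n \<in> lmod_hom A (F n) (F n)"
    and \<theta>0: "\<And>x. x \<in> carrier (F 0) \<Longrightarrow> \<eta> (\<theta> 0 x) = \<zero>\<^bsub>M\<^esub>"
    and \<theta>d: "\<And>n x. x \<in> carrier (F (Suc n)) \<Longrightarrow> d n (\<theta> (Suc n) x) = \<theta> n (d n x)"
  shows "\<exists>h. (\<forall>n. h n \<in> lmod_hom A (F n) (F (Suc n))) \<and>
    (\<forall>n. \<forall>x \<in> carrier (F (Suc n)). d (Suc n) (h (Suc n) x) = \<theta> (Suc n) x \<ominus>\<^bsub>F (Suc n)\<^esub> h n (d n x))"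
proof -
  note FD = projective_resolutionD[OF F]
  have base: "\<exists>h \<in> lmod_hom A (F 0) (F 1). \<forall>x \<in> carrier (F 0). d 0 (h x) = \<theta> 0 x"
  proof (rule projective_lift[OF FD(1) FD(2) FD(2)])
    show "d 0 \<in> lmod_hom A (F 1) (F 0)" using FD(5)[of 0] by simp
    show "\<theta> 0 ` carrier (F 0) \<subseteq> d 0 ` carrier (F 1)"
      using projective_resolution_exact(1)[OF F] \<theta>0 lmod_hom_closed[OF \<theta>] by blast
  qed (rule \<theta>)
  have step: "\<exists>k \<in> lmod_hom A (F (Suc n)) (F (Suc (Suc n))).
      \<forall>x \<in> carrier (F (Suc n)). d (Suc n) (k x) = \<theta> (Suc n) x \<ominus>\<^bsub>F (Suc n)\<^esub> h (d n x)"
    if h: "h \<in> lmod_hom A (F n) (F (Suc n))"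
      and dh: "\<forall>x \<in> d n ` carrier (F (Suc n)). d n (h x) = \<theta> n x" for n h
  proof (rule projective_lift[OF FD(1) FD(2) FD(2) FD(5)])
    interpret Fn: left_module A "F n" by (rule FD(2))
    interpret Fs: left_module A "F (Suc n)" by (rule FD(2))
    have hd: "(\<lambda>x. h (d n x)) \<in> lmod_hom A (F (Suc n)) (F (Suc n))"
      using FD(5)[of n] h by (rule lmod_hom_comp)
    show *: "(\<lambda>x. \<theta> (Suc n) x \<ominus>\<^bsub>F (Suc n)\<^esub> h (d n x)) \<in> lmod_hom A (F (Suc n)) (F (Suc n))"
      using \<theta> hd FD(2) FD(2) by (rule lmod_hom_diff)
    show "(\<lambda>x. \<theta> (Suc n) x \<ominus>\<^bsub>F (Suc n)\<^esub> h (d n x)) ` carrier (F (Suc n))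
        \<subseteq> d (Suc n) ` carrier (F (Suc (Suc n)))"
    proof
      fix y assume "y \<in> (\<lambda>x. \<theta> (Suc n) x \<ominus>\<^bsub>F (Suc n)\<^esub> h (d n x)) ` carrier (F (Suc n))"
      then obtain x where x: "x \<in> carrier (F (Suc n))" and y: "y = \<theta> (Suc n) x \<ominus>\<^bsub>F (Suc n)\<^esub> h (d n x)"
        by (elim imageE)
      have c: "\<theta> (Suc n) x \<in> carrier (F (Suc n))" "h (d n x) \<in> carrier (F (Suc n))"
        "\<theta> n (d n x) \<in> carrier (F n)"
        using lmod_hom_closed[OF \<theta> x] lmod_hom_closed[OF hd x]
        lmod_hom_closed[OF \<theta> lmod_hom_closed[OF FD(5) x]] .
      have "d n y = d n (\<theta> (Suc n) x) \<ominus>\<^bsub>F n\<^esub> d n (h (d n x))"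
        unfolding y using c by (intro lmod_hom_minus[OF FD(5) FD(3) FD(3)])
      also have "\<dots> = \<theta> n (d n x) \<ominus>\<^bsub>F n\<^esub> \<theta> n (d n x)" using \<theta>d[OF x] dh x by simp
      also have "\<dots> = \<zero>\<^bsub>F n\<^esub>" using c(3) by (simp add: a_minus_def Fn.M.r_neg)
      finally show "y \<in> d (Suc n) ` carrier (F (Suc (Suc n)))"
        using projective_resolution_exact(2)[OF F] c by (simp add: y)
    qed
  qed
  \<comment> \<open>Only on boundaries must d h agree with \<theta>. This makes \<theta> - h d take
    values in cycles, and it is reproduced in the next degree since \<open>d n\<close> vanishes on
    boundaries.\<close>
  define Q where "Q n h \<longleftrightarrow> h \<in> lmod_hom A (F n) (F (Suc n)) \<and>
      (\<forall>x \<in> d n ` carrier (F (Suc n)). d n (h x) = \<theta> n x)" for n h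
  have "\<exists>h. \<forall>n. Q n (h n) \<and>
      (\<forall>x \<in> carrier (F (Suc n)). d (Suc n) (h (Suc n) x) = \<theta> (Suc n) x \<ominus>\<^bsub>F (Suc n)\<^esub> h n (d n x))"
  proof (rule dependent_nat_choice)
    obtain h where "h \<in> lmod_hom A (F 0) (F 1)" "\<forall>x \<in> carrier (F 0). d 0 (h x) = \<theta> 0 x"
      using base by blast
    then have "Q 0 h" using lmod_hom_closed[OF FD(5)[of 0]] by (simp add: Q_def image_subset_iff)
    then show "\<exists>h. Q 0 h" by blast
  next
    fix h n assume "Q n h"
    then obtain k where k: "k \<in> lmod_hom A (F (Suc n)) (F (Suc (Suc n)))"
      "\<forall>x \<in> carrier (F (Suc n)). d (Suc n) (k x) = \<theta> (Suc n) x \<ominus>\<^bsub>F (Suc n)\<^esub> h (d n x)"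
      using step[of h n] by (auto simp: Q_def)
    interpret Fs: left_module A "F (Suc n)" by (rule FD(2))
    have hh: "h \<in> lmod_hom A (F n) (F (Suc n))" using \<open>Q n h\<close> by (simp add: Q_def)
    have h0: "h \<zero>\<^bsub>F n\<^esub> = \<zero>\<^bsub>F (Suc n)\<^esub>"
      using hh FD(3) FD(3) by (rule lmod_hom_zero)
    have "d (Suc n) (k x) = \<theta> (Suc n) x" if x: "x \<in> d (Suc n) ` carrier (F (Suc (Suc n)))" for x
    proof -
      have "x \<in> carrier (F (Suc n))" "d n x = \<zero>\<^bsub>F n\<^esub>"
        using x FD(8)[of n] by auto
      then show ?thesis using k(2) h0 lmod_hom_closed[OF \<theta>]
        by (simp add: a_minus_def)
    qed
    then have "Q (Suc n) k" using k(1) by (simp add: Q_def)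
    then show "\<exists>k. Q (Suc n) k \<and>
        (\<forall>x \<in> carrier (F (Suc n)). d (Suc n) (k x) = \<theta> (Suc n) x \<ominus>\<^bsub>F (Suc n)\<^esub> h (d n x))"
      using k(2) by blast
  qed
  then show ?thesis by (auto simp: Q_def)
qed

text \<open>If \<open>M\<close> has a projective resolution of length \<open>D\<close>, then the composite of comparison maps
  \<open>F \<rightarrow> P \<rightarrow> F\<close> vanishes on boundaries in degree \<open>D\<close>, while it is homotopic to the identity.\<close>

lemma resolution_retract_above_length:
  assumes P: "projective_resolution A M P \<delta> \<epsilon>" and F: "projective_resolution A M F d \<eta>"
    and M: "left_module A M" and len: "carrier (P (Suc (Suc n))) = {\<zero>\<^bsub>P (Suc (Suc n))\<^esub>}"
  shows "\<exists>h \<in> lmod_hom A (F (Suc n)) (F (Suc (Suc n))). \<forall>x \<in> carrier (F (Suc (Suc n))).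
      x \<ominus>\<^bsub>F (Suc (Suc n))\<^esub> h (d (Suc n) x) \<in> d (Suc (Suc n)) ` carrier (F (Suc (Suc (Suc n))))"
proof -
  note PD = projective_resolutionD[OF P] and FD = projective_resolutionD[OF F]
  obtain \<phi> where \<phi>': "\<forall>n. \<phi> n \<in> lmod_hom A (F n) (P n)"
    "\<forall>x \<in> carrier (F 0). \<epsilon> (\<phi> 0 x) = \<eta> x"
    "\<forall>n. \<forall>x \<in> carrier (F (Suc n)). \<delta> n (\<phi> (Suc n) x) = \<phi> n (d n x)"
    using chain_map_lift[OF F P M] by (elim exE conjE)
  note \<phi> = \<phi>'[rule_format]
  obtain \<psi> where \<psi>': "\<forall>n. \<psi> n \<in> lmod_hom A (P n) (F n)"
    "\<forall>x \<in> carrier (P 0). \<eta> (\<psi> 0 x) = \<epsilon> x"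
    "\<forall>n. \<forall>x \<in> carrier (P (Suc n)). d n (\<psi> (Suc n) x) = \<psi> n (\<delta> n x)"
    using chain_map_lift[OF P F M] by (elim exE conjE)
  note \<psi> = \<psi>'[rule_format]
  define \<theta> where "\<theta> n x = x \<ominus>\<^bsub>F n\<^esub> \<psi> n (\<phi> n x)" for n x
  have \<psi>\<phi>: "(\<lambda>x. \<psi> n (\<phi> n x)) \<in> lmod_hom A (F n) (F n)" for n
    using \<phi>(1) \<psi>(1) by (rule lmod_hom_comp)
  have id: "(\<lambda>x. x) \<in> lmod_hom A (F n) (F n)" for n by (rule lmod_homI) auto
  have \<theta>: "\<theta> n \<in> lmod_hom A (F n) (F n)" for n
    unfolding \<theta>_def using id \<psi>\<phi> FD(2) FD(2) by (rule lmod_hom_diff)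
  interpret M: left_module A M by fact
  have \<theta>0: "\<eta> (\<theta> 0 x) = \<zero>\<^bsub>M\<^esub>" if x: "x \<in> carrier (F 0)" for x
  proof -
    have "\<eta> (\<theta> 0 x) = \<eta> x \<ominus>\<^bsub>M\<^esub> \<eta> (\<psi> 0 (\<phi> 0 x))"
      unfolding \<theta>_def
      by (rule lmod_hom_minus[OF FD(4) FD(3) M.M.abelian_group_axioms x lmod_hom_closed[OF \<psi>\<phi> x]])
    also have "\<dots> = \<eta> x \<ominus>\<^bsub>M\<^esub> \<eta> x" using \<psi>(2)[OF lmod_hom_closed[OF \<phi>(1) x]] \<phi>(2)[OF x] by simp
    finally show ?thesis using lmod_hom_closed[OF FD(4) x] by (simp add: a_minus_def M.M.r_neg)
  qed
  have \<theta>d: "d n (\<theta> (Suc n) x) = \<theta> n (d n x)" if x: "x \<in> carrier (F (Suc n))" for n x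
  proof -
    have "d n (\<theta> (Suc n) x) = d n x \<ominus>\<^bsub>F n\<^esub> d n (\<psi> (Suc n) (\<phi> (Suc n) x))"
      unfolding \<theta>_def
      by (rule lmod_hom_minus[OF FD(5) FD(3) FD(3) x lmod_hom_closed[OF \<psi>\<phi> x]])
    also have "d n (\<psi> (Suc n) (\<phi> (Suc n) x)) = \<psi> n (\<phi> n (d n x))"
      using \<psi>(3) \<phi>(3)[OF x] lmod_hom_closed[OF \<phi>(1) x] by simp
    finally show ?thesis by (simp add: \<theta>_def)
  qed
  have "\<exists>h. (\<forall>n. h n \<in> lmod_hom A (F n) (F (Suc n))) \<and>
    (\<forall>n. \<forall>x \<in> carrier (F (Suc n)). d (Suc n) (h (Suc n) x) = \<theta> (Suc n) x \<ominus>\<^bsub>F (Suc n)\<^esub> h n (d n x))"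
    using F M \<theta> \<theta>0 \<theta>d by (rule null_homotopy)
  then obtain h where h': "\<forall>n. h n \<in> lmod_hom A (F n) (F (Suc n))"
    "\<forall>n. \<forall>x \<in> carrier (F (Suc n)). d (Suc n) (h (Suc n) x) = \<theta> (Suc n) x \<ominus>\<^bsub>F (Suc n)\<^esub> h n (d n x)"
    by (elim exE conjE)
  note h = h'[rule_format]
  show ?thesis
  proof (intro bexI[of _ "h (Suc n)"] ballI h(1))
    fix x assume x: "x \<in> carrier (F (Suc (Suc n)))"
    interpret Fn: left_module A "F n" by (rule FD(2))
    interpret Fs: left_module A "F (Suc n)" by (rule FD(2))
    interpret Fss: left_module A "F (Suc (Suc n))" by (rule FD(2))
    let ?y = "d (Suc n) x"
    have y: "?y \<in> carrier (F (Suc n))" using x FD(5)[of "Suc n"] by (simp add: lmod_homD)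
    have dy: "d n ?y = \<zero>\<^bsub>F n\<^esub>" using projective_resolution_cycle(2)[OF F x] .
    \<comment> \<open>Here the length of \<open>P\<close> enters: the image of the boundary
      \<open>?y\<close> under \<phi> is a boundary coming from the zero module
      \<open>P (n + 2)\<close>. So the composite of the comparison maps kills \<open>?y\<close>, and
      \<theta> fixes it.\<close>
    have "\<delta> (Suc n) (\<phi> (Suc (Suc n)) x) = \<zero>\<^bsub>P (Suc n)\<^esub>"
      using lmod_hom_closed[OF \<phi>(1) x] lmod_hom_zero[OF PD(5) PD(3) PD(3)] len by auto
    then have "\<phi> (Suc n) ?y = \<zero>\<^bsub>P (Suc n)\<^esub>" using \<phi>(3)[OF x] by simp
    then have "\<psi> (Suc n) (\<phi> (Suc n) ?y) = \<zero>\<^bsub>F (Suc n)\<^esub>"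
      using lmod_hom_zero[OF \<psi>(1) PD(3) FD(3)] by simp
    then have "\<theta> (Suc n) ?y = ?y" using y by (simp add: \<theta>_def a_minus_def)
    then have dh: "d (Suc n) (h (Suc n) ?y) = ?y"
      using h(2)[OF y] dy lmod_hom_zero[OF h(1) FD(3) FD(3)] y by (simp add: a_minus_def)
    have hy: "h (Suc n) ?y \<in> carrier (F (Suc (Suc n)))" using lmod_hom_closed[OF h(1) y] .
    \<comment> \<open>Both \<open>x\<close> and \<open>h (Suc n) ?y\<close> have boundary
      \<open>?y\<close>, so their difference is a cycle and exactness applies.\<close>
    have "d (Suc n) (x \<ominus>\<^bsub>F (Suc (Suc n))\<^esub> h (Suc n) ?y) = ?y \<ominus>\<^bsub>F (Suc n)\<^esub> ?y"
      using lmod_hom_minus[OF FD(5) FD(3) FD(3) x hy] dh by simp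
    also have "\<dots> = \<zero>\<^bsub>F (Suc n)\<^esub>" using y by (simp add: a_minus_def Fs.M.r_neg)
    finally show "x \<ominus>\<^bsub>F (Suc (Suc n))\<^esub> h (Suc n) ?y \<in> d (Suc (Suc n)) ` carrier (F (Suc (Suc (Suc n))))"
      using projective_resolution_exact(2)[OF F] x hy by simp
  qed
qed

section \<open>The tensor algebra\<close>

lemma tensor_alg_induct [case_names zero add single]:
  fixes p :: "('q, 'k::field) tensor_alg"
  assumes "P 0" "\<And>p q. P p \<Longrightarrow> P q \<Longrightarrow> P (p + q)" "\<And>w c. P (Poly_Mapping.single w c)"
  shows "P p"
proof (induction p rule: update_induct)
  case const
  show ?case by (rule assms(1))
next
  case (update f a b)
  have "Poly_Mapping.update a b f = f + Poly_Mapping.single a b"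
    using update(1)
    by (intro poly_mapping_eqI) (auto simp: lookup_add lookup_update lookup_single when_def in_keys_iff)
  then show ?case using assms update by simp
qed

lemma tscale_single: "tscale c (Poly_Mapping.single w d) = Poly_Mapping.single w (c * d)"
  by (rule poly_mapping_eqI) (simp add: lookup_tscale lookup_single when_def)

text \<open>Scalars are multiples of the empty word, on either side by
  \<open>mult_single_Nil\<close>. Hence they are central, and two-sided ideals are closed under
  scaling.\<close>

lemma tscale_eq_mult: "tscale c p = Poly_Mapping.single [] c * p"
proof (induction p rule: tensor_alg_induct)
  case zero
  then show ?case by simp
next
  case (add p q)
  then show ?case by (simp add: tensor_alg.scale_right_distrib distrib_left)
next
  case (single w d)
  then show ?case by (simp add: tscale_single mult_single plus_list_def)
qed

lemma mult_single_Nil: "p * Poly_Mapping.single [] c = tscale c p"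
proof (induction p rule: tensor_alg_induct)
  case (add p q)
  then show ?case by (simp add: tensor_alg.scale_right_distrib distrib_right)
qed (simp_all add: tscale_single mult_single plus_list_def mult.commute)

lemma tscale_mult_left: "tscale c p * q = tscale c (p * q)"
  by (simp add: tscale_eq_mult mult.assoc)

lemma tscale_mult_right: "p * tscale c q = tscale c (p * q)"
  by (metis tscale_eq_mult mult_single_Nil mult.assoc)

lemma single_one_Nil: "Poly_Mapping.single [] 1 = (1 :: ('q, 'k::field) tensor_alg)"
  by (metis single_one zero_list_def)

lemma prod_list_gen: "prod_list (map gen w) = (Poly_Mapping.single w 1 :: ('q, 'k::field) tensor_alg)"
proof (induction w)
  case (Cons l w)
  then show ?case by (simp add: gen_def mult_single plus_list_def)
qed (simp add: single_one_Nil)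

lemma lookup_single_mult:
  fixes p :: "('q, 'k::field) tensor_alg"
  assumes "length a = length b"
  shows "Poly_Mapping.lookup (Poly_Mapping.single a c * p) (b @ w) =
    (if a = b then c * Poly_Mapping.lookup p w else 0)"
proof (induction p rule: tensor_alg_induct)
  case (single v d)
  then show ?case using assms by (auto simp: mult_single lookup_single plus_list_def when_def)
qed (simp_all add: lookup_add distrib_left)

lemma lookup_mult_single:
  fixes p :: "('q, 'k::field) tensor_alg"
  assumes "length a = length b"
  shows "Poly_Mapping.lookup (p * Poly_Mapping.single a c) (w @ b) =
    (if a = b then Poly_Mapping.lookup p w * c else 0)"
proof (induction p rule: tensor_alg_induct)
  case (single v d)
  then show ?case using assms by (auto simp: mult_single lookup_single plus_list_def when_def)
qed (simp_all add: lookup_add distrib_right)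

lemma sum_keys_single:
  fixes p :: "('q, 'k::field) tensor_alg"
  shows
  "p = (\<Sum>w\<in>Poly_Mapping.keys p. Poly_Mapping.single w (Poly_Mapping.lookup p w))"
  by (rule poly_mapping_eqI)
    (simp add: lookup_sum lookup_single when_def in_keys_iff sum.delta' flip: if_distrib)

text \<open>A left factor homogeneous of degree \<open>length a\<close> allows only the cut of the
  word directly after \<open>a\<close>, so the convolution collapses to one product.\<close>

lemma lookup_mult_append:
  fixes p :: "('q, 'k::field) tensor_alg"
  assumes "p \<in> tensor_power (length a)"
  shows "Poly_Mapping.lookup (p * q) (a @ w) = Poly_Mapping.lookup p a * Poly_Mapping.lookup q w"
proof -
  have "p * q = (\<Sum>u\<in>Poly_Mapping.keys p. Poly_Mapping.single u (Poly_Mapping.lookup p u) * q)"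
    by (subst sum_keys_single[of p]) (simp add: sum_distrib_right)
  then have "Poly_Mapping.lookup (p * q) (a @ w) =
      (\<Sum>u\<in>Poly_Mapping.keys p. if u = a then Poly_Mapping.lookup p u * Poly_Mapping.lookup q w else 0)"
    using assms by (simp add: lookup_sum lookup_single_mult tensor_power_def)
  also have "\<dots> = Poly_Mapping.lookup p a * Poly_Mapping.lookup q w"
    by (simp add: in_keys_iff sum.delta)
  finally show ?thesis .
qed

lemma lookup_mult_append':
  fixes p :: "('q, 'k::field) tensor_alg"
  assumes "q \<in> tensor_power (length a)"
  shows "Poly_Mapping.lookup (p * q) (w @ a) = Poly_Mapping.lookup p w * Poly_Mapping.lookup q a"
proof -
  have "p * q = (\<Sum>u\<in>Poly_Mapping.keys q. p * Poly_Mapping.single u (Poly_Mapping.lookup q u))"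
    by (subst sum_keys_single[of q]) (simp add: sum_distrib_left)
  then have "Poly_Mapping.lookup (p * q) (w @ a) =
      (\<Sum>u\<in>Poly_Mapping.keys q. if u = a then Poly_Mapping.lookup p w * Poly_Mapping.lookup q u else 0)"
    using assms by (simp add: lookup_sum lookup_mult_single tensor_power_def)
  also have "\<dots> = Poly_Mapping.lookup p w * Poly_Mapping.lookup q a"
    by (simp add: in_keys_iff sum.delta)
  finally show ?thesis .
qed

section \<open>Homogeneous components of the tensor algebra and sums over words of fixed
  length\<close>

lemma tensor_powerI:
  "(\<And>w. length w \<noteq> n \<Longrightarrow> Poly_Mapping.lookup p w = 0) \<Longrightarrow> p \<in> tensor_power n"
  by (auto simp: tensor_power_def in_keys_iff)

lemma tensor_powerD: "p \<in> tensor_power n \<Longrightarrow> length w \<noteq> n \<Longrightarrow> Poly_Mapping.lookup p w = 0"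
  by (auto simp: tensor_power_def in_keys_iff)

lemma subspace_tensor_power: "tensor_alg.subspace (tensor_power n)"
  by (rule tensor_alg.subspaceI)
    (auto intro!: tensor_powerI simp: lookup_add lookup_tscale tensor_powerD)

lemma single_tensor_power: "Poly_Mapping.single w c \<in> tensor_power (length w)"
  by (rule tensor_powerI) (auto simp: lookup_single when_def)

lemma finite_words [simp]: "finite {w :: 'q::finite list. length w = n}"
  using finite_lists_length_eq[of "UNIV :: 'q set" n] by simp

lemma sum_words_Suc:
  fixes f :: "'q::finite list \<Rightarrow> 'b::comm_monoid_add"
  shows "(\<Sum>w | length w = Suc n. f w) = (\<Sum>l\<in>UNIV. \<Sum>w | length w = n. f (l # w))"
proof -
  have "{w :: 'q list. length w = Suc n} = (\<lambda>(l, w). l # w) ` (UNIV \<times> {w. length w = n})"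
    by (auto simp: length_Suc_conv image_iff)
  moreover have "inj_on (\<lambda>(l, w). l # w) (UNIV \<times> {w :: 'q list. length w = n})"
    by (auto simp: inj_on_def)
  ultimately show ?thesis
    by (simp add: sum.reindex sum.cartesian_product case_prod_unfold)
qed

lemma sum_words_one:
  fixes f :: "'q::finite list \<Rightarrow> 'b::comm_monoid_add"
  shows "(\<Sum>w | length w = 1. f w) = (\<Sum>l\<in>UNIV. f [l])"
  using sum_words_Suc[of f 0] by simp

lemma tensor_power_expand:
  fixes p :: "('q::finite, 'k::field) tensor_alg"
  assumes "p \<in> tensor_power n"
  shows "p = (\<Sum>w | length w = n. tscale (Poly_Mapping.lookup p w) (Poly_Mapping.single w 1))"
proof -
  have "p = (\<Sum>w\<in>Poly_Mapping.keys p. Poly_Mapping.single w (Poly_Mapping.lookup p w))"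
    by (rule sum_keys_single)
  also have "\<dots> = (\<Sum>w | length w = n. Poly_Mapping.single w (Poly_Mapping.lookup p w))"
    using assms by (intro sum.mono_neutral_left) (auto simp: tensor_power_def in_keys_iff)
  finally show ?thesis by (simp add: tscale_single)
qed

subsection \<open>Stripping the first or the last letter\<close>

text \<open>Contraction of the first tensor factor with the coordinate functional dual to
  \<open>gen l\<close>. Applied to a tensor spanning K in degree \<open>N + 1\<close> it yields the
  relations; the counterpart \<open>strip_right\<close> yields the twist \<open>Q\<close> of the
  form.\<close>

lift_definition strip_left :: "'q \<Rightarrow> ('q, 'k::field) tensor_alg \<Rightarrow> ('q, 'k) tensor_alg"
  is "\<lambda>l p w. p (l # w)"
proof -
  fix l :: 'q and p :: "'q list \<Rightarrow> 'k" assume "finite {w. p w \<noteq> 0}"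
  then have "finite (Cons l -` {w. p w \<noteq> 0})" by (rule finite_vimageI) (simp add: inj_def)
  then show "finite {w. p (l # w) \<noteq> 0}" by (simp add: vimage_def)
qed

lift_definition strip_right :: "'q \<Rightarrow> ('q, 'k::field) tensor_alg \<Rightarrow> ('q, 'k) tensor_alg"
  is "\<lambda>l p w. p (w @ [l])"
proof -
  fix l :: 'q and p :: "'q list \<Rightarrow> 'k" assume "finite {w. p w \<noteq> 0}"
  then have "finite ((\<lambda>w. w @ [l]) -` {w. p w \<noteq> 0})" by (rule finite_vimageI) (simp add: inj_def)
  then show "finite {w. p (w @ [l]) \<noteq> 0}" by (simp add: vimage_def)
qed

lemma lookup_strip_left: "Poly_Mapping.lookup (strip_left l p) w = Poly_Mapping.lookup p (l # w)"
  by transfer simp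

lemma lookup_strip_right: "Poly_Mapping.lookup (strip_right l p) w = Poly_Mapping.lookup p (w @ [l])"
  by transfer simp

lemma strip_linear:
  "strip_left l 0 = 0" "strip_left l (p + q) = strip_left l p + strip_left l q"
  "strip_left l (tscale c p) = tscale c (strip_left l p)"
  "strip_right l 0 = 0" "strip_right l (p + q) = strip_right l p + strip_right l q"
  "strip_right l (tscale c p) = tscale c (strip_right l p)"
  by (rule poly_mapping_eqI;
      simp add: lookup_strip_left lookup_strip_right lookup_add lookup_tscale)+

text \<open>In degree \<open>N + 1\<close> the intersection has two members. The one with r = 1 is E
  \<otimes> R and puts left contractions into \<open>R\<close>, the one with r = 0 is R \<otimes> E
  and puts right contractions there: contracting the letter next to \<open>p\<close> leaves a scalar
  multiple of \<open>p\<close>.\<close>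

lemma koszul_space_strip:
  assumes "tensor_alg.subspace R" "k \<in> koszul_space N R (N + 1)"
  shows "strip_left l k \<in> R" "strip_right l k \<in> R"
proof -
  have k: "k \<in> tensor_alg.span {u * p * v | u p v. u \<in> tensor_power r \<and> p \<in> R \<and> v \<in> tensor_power (1 - r)}"
    if "r \<le> 1" for r
    using assms(2) that by (auto simp: koszul_space_def)
  have "tensor_alg.span {u * p * v | u p v. u \<in> tensor_power 1 \<and> p \<in> R \<and> v \<in> tensor_power 0}
      \<subseteq> {q. strip_left l q \<in> R}"
  proof (rule tensor_alg.span_minimal)
    show "tensor_alg.subspace {q. strip_left l q \<in> R}"
      using assms(1) by (auto simp: tensor_alg.subspace_def strip_linear)
    have "strip_left l (u * p * v) \<in> R" if "u \<in> tensor_power 1" "p \<in> R" "v \<in> tensor_power 0" for u p v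
    proof -
      have "strip_left l (u * p * v) = tscale (Poly_Mapping.lookup u [l] * Poly_Mapping.lookup v []) p"
      proof (rule poly_mapping_eqI)
        fix w
        show "Poly_Mapping.lookup (strip_left l (u * p * v)) w =
            Poly_Mapping.lookup (tscale (Poly_Mapping.lookup u [l] * Poly_Mapping.lookup v []) p) w"
          using lookup_mult_append'[of v "[]" "u * p" "l # w"] lookup_mult_append[of u "[l]" p w] that
          by (simp add: lookup_strip_left lookup_tscale)
      qed
      then show ?thesis using assms(1) that(2) by (simp add: tensor_alg.subspace_scale)
    qed
    then show "{u * p * v | u p v. u \<in> tensor_power 1 \<and> p \<in> R \<and> v \<in> tensor_power 0}
        \<subseteq> {q. strip_left l q \<in> R}" by auto
  qed
  then show "strip_left l k \<in> R" using k[of 1] by auto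
  have "tensor_alg.span {u * p * v | u p v. u \<in> tensor_power 0 \<and> p \<in> R \<and> v \<in> tensor_power 1}
      \<subseteq> {q. strip_right l q \<in> R}"
  proof (rule tensor_alg.span_minimal)
    show "tensor_alg.subspace {q. strip_right l q \<in> R}"
      using assms(1) by (auto simp: tensor_alg.subspace_def strip_linear)
    have "strip_right l (u * p * v) \<in> R" if "u \<in> tensor_power 0" "p \<in> R" "v \<in> tensor_power 1" for u p v
    proof -
      have "strip_right l (u * p * v) = tscale (Poly_Mapping.lookup u [] * Poly_Mapping.lookup v [l]) p"
      proof (rule poly_mapping_eqI)
        fix w
        show "Poly_Mapping.lookup (strip_right l (u * p * v)) w =
            Poly_Mapping.lookup (tscale (Poly_Mapping.lookup u [] * Poly_Mapping.lookup v [l]) p) w"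
          using lookup_mult_append'[of v "[l]" "u * p" w] lookup_mult_append[of u "[]" p w] that
          by (simp add: lookup_strip_right lookup_tscale)
      qed
      then show ?thesis using assms(1) that(2) by (simp add: tensor_alg.subspace_scale)
    qed
    then show "{u * p * v | u p v. u \<in> tensor_power 0 \<and> p \<in> R \<and> v \<in> tensor_power 1}
        \<subseteq> {q. strip_right l q \<in> R}" by auto
  qed
  then show "strip_right l k \<in> R" using k[of 0] by auto
qed

section \<open>Koszul spaces as homogeneous subspaces\<close>

lemma subspace_koszul_space: "tensor_alg.subspace (koszul_space N R n)"
  by (auto simp: koszul_space_def subspace_tensor_power intro!: tensor_alg.subspace_Inter)

lemma tensor_power_mult: "p \<in> tensor_power m \<Longrightarrow> q \<in> tensor_power n \<Longrightarrow> p * q \<in> tensor_power (m + n)"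
  using keys_mult[of p q] by (fastforce simp: tensor_power_def plus_list_def)

lemma koszul_space_tensor_power:
  assumes "R \<subseteq> tensor_power N"
  shows "koszul_space N R n \<subseteq> tensor_power n"
proof (cases "n < N")
  case False
  have "u * p * v \<in> tensor_power n"
    if "u \<in> tensor_power 0" "p \<in> R" "v \<in> tensor_power (n - N)" for u p v
    using tensor_power_mult[OF tensor_power_mult[OF that(1), of p N] that(3)] that(2) assms False by auto
  then have "tensor_alg.span {u * p * v | u p v. u \<in> tensor_power 0 \<and> p \<in> R \<and> v \<in> tensor_power (n - N - 0)}
      \<subseteq> tensor_power n"
    by (intro tensor_alg.span_minimal subspace_tensor_power) auto
  moreover have "koszul_space N R n \<subseteq>
      tensor_alg.span {u * p * v | u p v. u \<in> tensor_power 0 \<and> p \<in> R \<and> v \<in> tensor_power (n - N - 0)}"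
    unfolding koszul_space_def if_not_P[OF False] by (rule INF_lower) simp
  ultimately show ?thesis by (rule subset_trans[rotated])
qed (simp add: koszul_space_def)

lemma koszul_space_N:
  fixes R :: "('q, 'k::field) tensor_alg set"
  assumes "tensor_alg.subspace R"
  shows "koszul_space N R N = R"
proof -
  have "u * p * v \<in> R" if "u \<in> tensor_power 0" "p \<in> R" "v \<in> tensor_power 0" for u p v
  proof -
    have "u * p * v = tscale (Poly_Mapping.lookup u [] * Poly_Mapping.lookup v []) p"
    proof (rule poly_mapping_eqI)
      fix w
      show "Poly_Mapping.lookup (u * p * v) w =
          Poly_Mapping.lookup (tscale (Poly_Mapping.lookup u [] * Poly_Mapping.lookup v []) p) w"
        using lookup_mult_append'[of v "[]" "u * p" w] lookup_mult_append[of u "[]" p w] that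
        by (simp add: lookup_tscale)
    qed
    then show ?thesis using assms that(2) by (simp add: tensor_alg.subspace_scale)
  qed
  then have "tensor_alg.span {u * p * v | u p v. u \<in> tensor_power 0 \<and> p \<in> R \<and> v \<in> tensor_power 0} \<subseteq> R"
    by (intro tensor_alg.span_minimal assms) auto
  moreover have "R \<subseteq> {u * p * v | u p v. u \<in> tensor_power 0 \<and> p \<in> R \<and> v \<in> tensor_power 0}"
  proof
    fix p assume "p \<in> R"
    moreover have "(1 :: ('q, 'k) tensor_alg) \<in> tensor_power 0"
      using single_tensor_power[of "[]" "1 :: 'k"] by (simp add: single_one_Nil)
    ultimately show "p \<in> {u * p * v | u p v. u \<in> tensor_power 0 \<and> p \<in> R \<and> v \<in> tensor_power 0}"
      by (intro CollectI exI[of _ "1 :: ('q, 'k) tensor_alg"] exI[of _ p]) simp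
  qed
  then have "R \<subseteq> tensor_alg.span {u * p * v | u p v. u \<in> tensor_power 0 \<and> p \<in> R \<and> v \<in> tensor_power 0}"
    using tensor_alg.span_superset by (rule subset_trans)
  ultimately have "tensor_alg.span {u * p * v | u p v. u \<in> tensor_power 0 \<and> p \<in> R \<and> v \<in> tensor_power 0} = R"
    by (rule subset_antisym)
  then show ?thesis by (simp add: koszul_space_def)
qed

section \<open>The algebra defined by relations\<close>

lemma ring_of_type_algebra_simps [simp]:
  "carrier ring_of_type_algebra = UNIV" "mult ring_of_type_algebra = (*)"
  "one ring_of_type_algebra = 1" "zero ring_of_type_algebra = 0" "add ring_of_type_algebra = (+)"
  by (simp_all add: ring_of_type_algebra_def)

lemma ring_ring_of_type_algebra: "ring (ring_of_type_algebra :: 'a::ring_1 ring)"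
proof (intro ringI abelian_groupI monoidI)
  fix x :: 'a
  show "\<exists>y\<in>carrier ring_of_type_algebra. y \<oplus>\<^bsub>ring_of_type_algebra\<^esub> x = \<zero>\<^bsub>ring_of_type_algebra\<^esub>"
    by (intro bexI[of _ "- x"]) simp_all
qed (simp_all add: algebra_simps)

lemma a_minus_ring_of_type_algebra [simp]:
  "a_inv (ring_of_type_algebra :: 'a::ring_1 ring) x = - x"
proof -
  interpret ring "ring_of_type_algebra :: 'a ring" by (rule ring_ring_of_type_algebra)
  show ?thesis using minus_equality[of "- x" x] by simp
qed

lemma ideal_rel_ideal: "ideal (rel_ideal R) tensor_ring"
  unfolding rel_ideal_def by (rule ring.genideal_ideal[OF ring_ring_of_type_algebra]) simp

lemma rel_ideal_closed:
  shows rel_ideal_zero: "0 \<in> rel_ideal R"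
    and rel_ideal_add: "p \<in> rel_ideal R \<Longrightarrow> q \<in> rel_ideal R \<Longrightarrow> p + q \<in> rel_ideal R"
    and rel_ideal_uminus: "p \<in> rel_ideal R \<Longrightarrow> - p \<in> rel_ideal R"
    and rel_ideal_mult_left: "p \<in> rel_ideal R \<Longrightarrow> q * p \<in> rel_ideal R"
    and rel_ideal_mult_right: "p \<in> rel_ideal R \<Longrightarrow> p * q \<in> rel_ideal R"
    and rel_ideal_tscale: "p \<in> rel_ideal R \<Longrightarrow> tscale c p \<in> rel_ideal R"
proof -
  interpret ideal "rel_ideal R" tensor_ring by (rule ideal_rel_ideal)
  note sub = additive_subgroup_axioms
  show "0 \<in> rel_ideal R" using additive_subgroup.zero_closed[OF sub] by simp
  show "p + q \<in> rel_ideal R" if "p \<in> rel_ideal R" "q \<in> rel_ideal R" using additive_subgroup.a_closed[OF sub that] by simp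
  show "- p \<in> rel_ideal R" if "p \<in> rel_ideal R" using additive_subgroup.a_inv_closed[OF sub that] by simp
  show l: "q * p \<in> rel_ideal R" if "p \<in> rel_ideal R" for p q using I_l_closed[OF that] by simp
  show "p * q \<in> rel_ideal R" if "p \<in> rel_ideal R" using I_r_closed[OF that] by simp
  show "tscale c p \<in> rel_ideal R" if "p \<in> rel_ideal R" using l[OF that] by (simp add: tscale_eq_mult)
qed

lemma rel_ideal_superset: "R \<subseteq> rel_ideal R"
  unfolding rel_ideal_def by (rule ring.genideal_self[OF ring_ring_of_type_algebra]) simp

lemma rel_ideal_minimal:
  assumes "R \<subseteq> J" "0 \<in> J" "\<And>p q. p \<in> J \<Longrightarrow> q \<in> J \<Longrightarrow> p + q \<in> J"
    and "\<And>p q. p \<in> J \<Longrightarrow> q * p \<in> J" "\<And>p q. p \<in> J \<Longrightarrow> p * q \<in> J"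
  shows "rel_ideal R \<subseteq> J"
proof -
  have m: "- p \<in> J" if "p \<in> J" for p using assms(4)[OF that, of "- 1"] by simp
  have inv: "inv\<^bsub>add_monoid tensor_ring\<^esub> p = - p" for p :: "('a, 'b) tensor_alg"
    using a_minus_ring_of_type_algebra[of p] unfolding a_inv_def .
  have "ideal J tensor_ring"
  proof (rule idealI[OF ring_ring_of_type_algebra])
    show "subgroup J (add_monoid tensor_ring)"
      using assms(2,3) m by (intro subgroup.intro) (simp_all add: inv[simplified])
  qed (use assms(4,5) in simp_all)
  then show ?thesis
    unfolding rel_ideal_def using assms(1)
    by (intro ring.genideal_minimal[OF ring_ring_of_type_algebra])
qed

lemma rel_ideal_diff: "p \<in> rel_ideal R \<Longrightarrow> q \<in> rel_ideal R \<Longrightarrow> p - q \<in> rel_ideal R"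
  using rel_ideal_add[OF _ rel_ideal_uminus] by fastforce

lemma mem_cls: "x \<in> cls R p \<longleftrightarrow> x - p \<in> rel_ideal R"
  by (force simp: cls_def a_r_coset_def')

lemma cls_eq_iff: "cls R p = cls R q \<longleftrightarrow> p - q \<in> rel_ideal R"
proof
  assume "cls R p = cls R q"
  moreover have "p \<in> cls R p" by (simp add: mem_cls rel_ideal_zero)
  ultimately show "p - q \<in> rel_ideal R" by (simp add: mem_cls)
next
  assume "p - q \<in> rel_ideal R"
  then have "x - p \<in> rel_ideal R \<longleftrightarrow> x - q \<in> rel_ideal R" for x
    using rel_ideal_add[of "x - p" R "p - q"] rel_ideal_diff[of "x - q" R "p - q"] by auto
  then show "cls R p = cls R q" by (auto simp: mem_cls)
qed

lemma carrier_hom_alg: "carrier (hom_alg R) = range (cls R)"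
  by (auto simp: hom_alg_def Let_def FactRing_def A_RCOSETS_def RCOSETS_def cls_def a_r_coset_def)

lemma cls_closed [simp]: "cls R p \<in> carrier (hom_alg R)"
  by (simp add: carrier_hom_alg)

lemma hom_alg_ops:
  shows cls_mult: "cls R p \<otimes>\<^bsub>hom_alg R\<^esub> cls R q = cls R (p * q)"
    and cls_add: "cls R p \<oplus>\<^bsub>hom_alg R\<^esub> cls R q = cls R (p + q)"
    and cls_one: "\<one>\<^bsub>hom_alg R\<^esub> = cls R 1"
    and cls_zero: "\<zero>\<^bsub>hom_alg R\<^esub> = cls R 0"
    and cls_smult: "c \<odot>\<^bsub>hom_alg R\<^esub> cls R p = cls R (tscale c p)"
proof -
  interpret ideal "rel_ideal R" tensor_ring by (rule ideal_rel_ideal)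
  show "cls R p \<otimes>\<^bsub>hom_alg R\<^esub> cls R q = cls R (p * q)"
    using rcoset_mult_add[of p q] by (simp add: hom_alg_def FactRing_def cls_def Let_def)
  show "cls R p \<oplus>\<^bsub>hom_alg R\<^esub> cls R q = cls R (p + q)"
    using a_rcos_sum[of p q] by (simp add: hom_alg_def FactRing_def cls_def Let_def)
  show "\<one>\<^bsub>hom_alg R\<^esub> = cls R 1" by (simp add: hom_alg_def FactRing_def cls_def Let_def)
  show "\<zero>\<^bsub>hom_alg R\<^esub> = cls R 0"
    using mem_cls[of _ R 0] by (auto simp: hom_alg_def FactRing_def Let_def)
  \<comment> \<open>The action is defined as a union over all representatives; they yield the same
    coset, so the union collapses.\<close>
  have *: "cls R (tscale c x) = cls R (tscale c p)" if "x \<in> cls R p" for x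
    using that rel_ideal_tscale[of "x - p" R c]
    by (simp add: mem_cls cls_eq_iff tensor_alg.scale_right_diff_distrib)
  have "c \<odot>\<^bsub>hom_alg R\<^esub> cls R p = (\<Union>x\<in>cls R p. cls R (tscale c x))"
    by (simp add: hom_alg_def Let_def)
  also have "\<dots> = (\<Union>x\<in>cls R p. cls R (tscale c p))"
    by (rule SUP_cong[OF refl *])
  also have "\<dots> = cls R (tscale c p)"
  proof -
    have "p \<in> cls R p" by (simp add: mem_cls rel_ideal_zero)
    then show ?thesis by blast
  qed
  finally show "c \<odot>\<^bsub>hom_alg R\<^esub> cls R p = cls R (tscale c p)" .
qed

lemma hom_alg_cases:
  assumes "a \<in> carrier (hom_alg R)"
  obtains p where "a = cls R p"
  using assms by (auto simp: carrier_hom_alg)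

lemma ring_hom_alg: "ring (hom_alg R)"
proof (intro ringI abelian_groupI monoidI)
  fix x assume "x \<in> carrier (hom_alg R)"
  then obtain p where "x = cls R p" by (rule hom_alg_cases)
  then show "\<exists>y\<in>carrier (hom_alg R). y \<oplus>\<^bsub>hom_alg R\<^esub> x = \<zero>\<^bsub>hom_alg R\<^esub>"
    by (intro bexI[of _ "cls R (- p)"]) (simp_all add: cls_add cls_zero)
qed (auto elim!: hom_alg_cases simp: hom_alg_ops algebra_simps)

lemma cls_sum: "finsum (hom_alg R) (\<lambda>i. cls R (f i)) T = cls R (sum f T)"
proof -
  interpret ring "hom_alg R" by (rule ring_hom_alg)
  show ?thesis
    by (induction T rule: infinite_finite_induct)
      (simp_all add: cls_zero cls_add finsum_insert Pi_def)
qed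

text \<open>A filtration of the tensor algebra by two-sided ideals. Its level \<open>N\<close>
  contains the ideal of relations, which suffices to compare classes in degrees below
  \<open>N\<close> without decomposing the quotient into homogeneous parts.\<close>

definition words_ge :: "nat \<Rightarrow> ('q, 'k::field) tensor_alg set" where
  "words_ge n = {p. \<forall>w. length w < n \<longrightarrow> Poly_Mapping.lookup p w = 0}"

lemma words_ge_mult:
  assumes "p \<in> words_ge n"
  shows "p * q \<in> words_ge n" "q * p \<in> words_ge n"
proof -
  have *: "length a \<ge> n" if "a \<in> Poly_Mapping.keys p" for a
    using assms that by (auto simp: words_ge_def in_keys_iff not_less[symmetric])
  have "length w \<ge> n" if "w \<in> Poly_Mapping.keys (p * q)" for w
    using keys_mult[of p q] that * by (fastforce simp: plus_list_def)
  then show "p * q \<in> words_ge n" by (auto simp: words_ge_def in_keys_iff not_less[symmetric])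
  have "length w \<ge> n" if "w \<in> Poly_Mapping.keys (q * p)" for w
    using keys_mult[of q p] that * by (fastforce simp: plus_list_def)
  then show "q * p \<in> words_ge n" by (auto simp: words_ge_def in_keys_iff not_less[symmetric])
qed

lemma words_ge_add: "p \<in> words_ge n \<Longrightarrow> q \<in> words_ge n \<Longrightarrow> p + q \<in> words_ge n"
  by (simp add: words_ge_def lookup_add)

lemma rel_ideal_words_ge:
  assumes "R \<subseteq> tensor_power N"
  shows "rel_ideal R \<subseteq> words_ge N"
proof (rule rel_ideal_minimal)
  show "R \<subseteq> words_ge N"
    using assms by (auto simp: words_ge_def intro: tensor_powerD)
qed (auto simp: words_ge_mult words_ge_add, simp add: words_ge_def)

text \<open>Coefficients of a class on words shorter than the degree of the relations; the choice of the
  representative is irrelevant for those words only.\<close>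

definition cls_coeff :: "('q, 'k::field) tensor_alg set \<Rightarrow> 'q list \<Rightarrow> 'k" where
  "cls_coeff a w = Poly_Mapping.lookup (SOME p. p \<in> a) w"

lemma cls_coeff_cls:
  assumes "R \<subseteq> tensor_power N" "length w < N"
  shows "cls_coeff (cls R p) w = Poly_Mapping.lookup p w"
proof -
  have "p \<in> cls R p" by (simp add: mem_cls rel_ideal_zero)
  then have "(SOME x. x \<in> cls R p) \<in> cls R p" by (rule someI)
  then have "(SOME x. x \<in> cls R p) - p \<in> words_ge N"
    using rel_ideal_words_ge[OF assms(1)] by (auto simp: mem_cls)
  then show ?thesis using assms(2) by (simp add: cls_coeff_def words_ge_def lookup_minus)
qed

section \<open>Modules of tensors over the algebra\<close>

definition tensor_module ::
  "('q, 'k::field) tensor_alg set \<Rightarrow> ('q, 'k) tensor_alg set \<Rightarrow>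
    (('q, 'k) tensor_alg set, ('q, 'k) universe) module" where
  "tensor_module R V = \<lparr>carrier = tensor (hom_alg R) V, mult = undefined, one = undefined,
     zero = (\<lambda>w. \<zero>\<^bsub>hom_alg R\<^esub>), add = (\<lambda>f g w. f w \<oplus>\<^bsub>hom_alg R\<^esub> g w),
     smult = (\<lambda>a f w. a \<otimes>\<^bsub>hom_alg R\<^esub> f w)\<rparr>"

lemma tensor_module_simps [simp]:
  "carrier (tensor_module R V) = tensor (hom_alg R) V"
  "\<zero>\<^bsub>tensor_module R V\<^esub> = (\<lambda>w. \<zero>\<^bsub>hom_alg R\<^esub>)"
  "f \<oplus>\<^bsub>tensor_module R V\<^esub> g = (\<lambda>w. f w \<oplus>\<^bsub>hom_alg R\<^esub> g w)"
  "a \<odot>\<^bsub>tensor_module R V\<^esub> f = (\<lambda>w. a \<otimes>\<^bsub>hom_alg R\<^esub> f w)"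
  by (simp_all add: tensor_module_def)

text \<open>The tensor of the class of \<open>p\<close> with \<open>v\<close>. Passing a
  representative instead of a class keeps computations inside the tensor algebra.\<close>

definition pure_tensor ::
  "('q, 'k::field) tensor_alg set \<Rightarrow> ('q, 'k) tensor_alg \<Rightarrow> ('q, 'k) tensor_alg \<Rightarrow> ('q, 'k) universe" where
  "pure_tensor R p v = (\<lambda>w. cls R (tscale (Poly_Mapping.lookup v w) p))"

lemma tensor_value:
  fixes R V :: "('q, 'k::field) tensor_alg set"
  assumes "t \<in> tensor (hom_alg R) V"
  shows "t w \<in> carrier (hom_alg R)"
proof -
  interpret ring "hom_alg R" by (rule ring_hom_alg)
  show ?thesis using assms by induction (auto elim!: hom_alg_cases simp: cls_smult)
qed

lemma tensor_add_pure:
  fixes R V :: "('q, 'k::field) tensor_alg set"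
  assumes "t \<in> tensor (hom_alg R) V" "v \<in> V"
  shows "(\<lambda>w. t w \<oplus>\<^bsub>hom_alg R\<^esub> pure_tensor R p v w) \<in> tensor (hom_alg R) V"
  using tensor.add[OF assms(1) cls_closed assms(2), of p] by (simp add: pure_tensor_def cls_smult)

lemma pure_tensor_closed:
  fixes R V :: "('q, 'k::field) tensor_alg set"
  shows "v \<in> V \<Longrightarrow> pure_tensor R p v \<in> tensor (hom_alg R) V"
proof -
  interpret ring "hom_alg R" by (rule ring_hom_alg)
  assume "v \<in> V"
  moreover have "(\<lambda>w. \<zero>\<^bsub>hom_alg R\<^esub> \<oplus>\<^bsub>hom_alg R\<^esub> pure_tensor R p v w) = pure_tensor R p v"
    by (simp add: pure_tensor_def)
  ultimately show ?thesis using tensor_add_pure[OF tensor.zero, where v = v and V = V and p = p and R = R] by simp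
qed

lemma tensor_induct_pure [consumes 1, case_names zero add]:
  fixes R V :: "('q, 'k::field) tensor_alg set"
  assumes "t \<in> tensor (hom_alg R) V"
    and "P (\<lambda>w. \<zero>\<^bsub>hom_alg R\<^esub>)"
    and "\<And>t p v. t \<in> tensor (hom_alg R) V \<Longrightarrow> P t \<Longrightarrow> v \<in> V \<Longrightarrow>
      P (\<lambda>w. t w \<oplus>\<^bsub>hom_alg R\<^esub> pure_tensor R p v w)"
  shows "P t"
  using assms(1)
proof induction
  case (add t a v)
  from add(2) obtain p where p: "a = cls R p" by (rule hom_alg_cases)
  show ?case using assms(3)[OF add(1) add(4) add(3), where p = p] by (simp add: p pure_tensor_def cls_smult)
qed (rule assms(2))

lemma tensor_closed:
  fixes R V :: "('q, 'k::field) tensor_alg set"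
  assumes "t \<in> tensor (hom_alg R) V"
  shows tensor_add_closed:
      "s \<in> tensor (hom_alg R) V \<Longrightarrow> (\<lambda>w. s w \<oplus>\<^bsub>hom_alg R\<^esub> t w) \<in> tensor (hom_alg R) V"
    and tensor_smult_closed:
      "a \<in> carrier (hom_alg R) \<Longrightarrow> (\<lambda>w. a \<otimes>\<^bsub>hom_alg R\<^esub> t w) \<in> tensor (hom_alg R) V"
proof -
  interpret ring "hom_alg R" by (rule ring_hom_alg)
  have pc: "pure_tensor R p v w \<in> carrier (hom_alg R)" for p v w by (simp add: pure_tensor_def)
  show "(\<lambda>w. s w \<oplus>\<^bsub>hom_alg R\<^esub> t w) \<in> tensor (hom_alg R) V" if s: "s \<in> tensor (hom_alg R) V"
    using assms
  proof (induction rule: tensor_induct_pure)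
    case zero
    then show ?case using s tensor_value[OF s] by simp
  next
    case (add t p v)
    have "(\<lambda>w. s w \<oplus>\<^bsub>hom_alg R\<^esub> (t w \<oplus>\<^bsub>hom_alg R\<^esub> pure_tensor R p v w)) =
        (\<lambda>w. (s w \<oplus>\<^bsub>hom_alg R\<^esub> t w) \<oplus>\<^bsub>hom_alg R\<^esub> pure_tensor R p v w)"
      using tensor_value[OF s] tensor_value[OF add(1)] pc by (simp add: a_assoc)
    then show ?case using tensor_add_pure[OF add(3,2)] by simp
  qed
  show "(\<lambda>w. a \<otimes>\<^bsub>hom_alg R\<^esub> t w) \<in> tensor (hom_alg R) V" if a: "a \<in> carrier (hom_alg R)"
    using assms
  proof (induction rule: tensor_induct_pure)
    case zero
    then show ?case using a by (simp add: tensor.zero)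
  next
    case (add t p v)
    from a obtain b where b: "a = cls R b" by (rule hom_alg_cases)
    have "(\<lambda>w. a \<otimes>\<^bsub>hom_alg R\<^esub> (t w \<oplus>\<^bsub>hom_alg R\<^esub> pure_tensor R p v w)) =
        (\<lambda>w. (a \<otimes>\<^bsub>hom_alg R\<^esub> t w) \<oplus>\<^bsub>hom_alg R\<^esub> pure_tensor R (b * p) v w)"
      using tensor_value[OF add(1)] pc a
      by (simp add: r_distr) (simp add: b pure_tensor_def cls_mult tscale_mult_right)
    then show ?case using tensor_add_pure[OF add(3,2)] by simp
  qed
qed

lemma left_module_tensor_module: "left_module (hom_alg R) (tensor_module R V)"
proof -
  interpret ring "hom_alg R" by (rule ring_hom_alg)
  note tv = tensor_value[where R = R and V = V]
  show ?thesis
  proof (intro left_module.intro left_module_axioms.intro ring_hom_alg abelian_groupI)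
    fix f assume f: "f \<in> carrier (tensor_module R V)"
    have "(\<lambda>w. (\<ominus>\<^bsub>hom_alg R\<^esub> \<one>\<^bsub>hom_alg R\<^esub>) \<otimes>\<^bsub>hom_alg R\<^esub> f w) \<in> carrier (tensor_module R V)"
      using f by (simp add: tensor_smult_closed)
    moreover have "(\<lambda>w. (\<ominus>\<^bsub>hom_alg R\<^esub> \<one>\<^bsub>hom_alg R\<^esub>) \<otimes>\<^bsub>hom_alg R\<^esub> f w) \<oplus>\<^bsub>tensor_module R V\<^esub> f
        = \<zero>\<^bsub>tensor_module R V\<^esub>"
      using f tv by (auto simp: l_minus l_neg)
    ultimately show "\<exists>g\<in>carrier (tensor_module R V). g \<oplus>\<^bsub>tensor_module R V\<^esub> f = \<zero>\<^bsub>tensor_module R V\<^esub>"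
      by blast
  next
    fix f g assume "f \<in> carrier (tensor_module R V)" "g \<in> carrier (tensor_module R V)"
    then have "f w \<in> carrier (hom_alg R)" "g w \<in> carrier (hom_alg R)" for w using tv by auto
    then show "f \<oplus>\<^bsub>tensor_module R V\<^esub> g = g \<oplus>\<^bsub>tensor_module R V\<^esub> f"
      by (simp add: a_comm)
  next
    fix f g h assume "f \<in> carrier (tensor_module R V)" "g \<in> carrier (tensor_module R V)"
      "h \<in> carrier (tensor_module R V)"
    then have "f w \<in> carrier (hom_alg R)" "g w \<in> carrier (hom_alg R)" "h w \<in> carrier (hom_alg R)" for w
      using tv by auto
    then show "f \<oplus>\<^bsub>tensor_module R V\<^esub> g \<oplus>\<^bsub>tensor_module R V\<^esub> h =
        f \<oplus>\<^bsub>tensor_module R V\<^esub> (g \<oplus>\<^bsub>tensor_module R V\<^esub> h)"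
      by (simp add: a_assoc)
  next
    fix f assume f: "f \<in> carrier (tensor_module R V)"
    then have fw: "f w \<in> carrier (hom_alg R)" for w using tv by auto
    show "\<zero>\<^bsub>tensor_module R V\<^esub> \<oplus>\<^bsub>tensor_module R V\<^esub> f = f"
      "\<one>\<^bsub>hom_alg R\<^esub> \<odot>\<^bsub>tensor_module R V\<^esub> f = f"
      using fw by simp_all
    fix g assume g: "g \<in> carrier (tensor_module R V)"
    then have gw: "g w \<in> carrier (hom_alg R)" for w using tv by auto
    show "f \<oplus>\<^bsub>tensor_module R V\<^esub> g \<in> carrier (tensor_module R V)"
      using f g by (simp add: tensor_add_closed)
    fix a assume a: "a \<in> carrier (hom_alg R)"
    show "a \<odot>\<^bsub>tensor_module R V\<^esub> (f \<oplus>\<^bsub>tensor_module R V\<^esub> g) =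
        a \<odot>\<^bsub>tensor_module R V\<^esub> f \<oplus>\<^bsub>tensor_module R V\<^esub> a \<odot>\<^bsub>tensor_module R V\<^esub> g"
      using fw gw a by (simp add: r_distr)
  next
    fix f a assume f: "f \<in> carrier (tensor_module R V)" and a: "a \<in> carrier (hom_alg R)"
    then have fw: "f w \<in> carrier (hom_alg R)" for w using tv by auto
    show "a \<odot>\<^bsub>tensor_module R V\<^esub> f \<in> carrier (tensor_module R V)"
      using f a by (simp add: tensor_smult_closed)
    fix b assume b: "b \<in> carrier (hom_alg R)"
    show "(a \<oplus>\<^bsub>hom_alg R\<^esub> b) \<odot>\<^bsub>tensor_module R V\<^esub> f =
        a \<odot>\<^bsub>tensor_module R V\<^esub> f \<oplus>\<^bsub>tensor_module R V\<^esub> b \<odot>\<^bsub>tensor_module R V\<^esub> f"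
      "(a \<otimes>\<^bsub>hom_alg R\<^esub> b) \<odot>\<^bsub>tensor_module R V\<^esub> f =
        a \<odot>\<^bsub>tensor_module R V\<^esub> (b \<odot>\<^bsub>tensor_module R V\<^esub> f)"
      using fw a b by (simp_all add: l_distr m_assoc)
  next
    show "\<zero>\<^bsub>tensor_module R V\<^esub> \<in> carrier (tensor_module R V)" by (simp add: tensor.zero)
  qed
qed

text \<open>Addition in A \<otimes> V is pointwise and can be carried out on representatives, so
  identities of tensors reduce to identities between ordinary sums in the tensor algebra.\<close>

lemma finsum_tensor_module:
  assumes "\<And>i. i \<in> T \<Longrightarrow> (\<lambda>w. cls R (f i w)) \<in> tensor (hom_alg R) V" "finite T"
  shows "finsum (tensor_module R V) (\<lambda>i w. cls R (f i w)) T = (\<lambda>w. cls R (\<Sum>i\<in>T. f i w))"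
proof -
  interpret left_module "hom_alg R" "tensor_module R V" by (rule left_module_tensor_module)
  show ?thesis using assms(2,1)
  proof (induction T)
    case empty
    then show ?case by (simp add: cls_zero)
  next
    case (insert i T)
    have c: "(\<lambda>i w. cls R (f i w)) \<in> T \<rightarrow> carrier (tensor_module R V)"
      "(\<lambda>w. cls R (f i w)) \<in> carrier (tensor_module R V)"
      using insert.prems by auto
    have "finsum (tensor_module R V) (\<lambda>i w. cls R (f i w)) (insert i T) =
        (\<lambda>w. cls R (f i w)) \<oplus>\<^bsub>tensor_module R V\<^esub> finsum (tensor_module R V) (\<lambda>i w. cls R (f i w)) T"
      using insert.hyps c by (rule M.finsum_insert)
    then show ?case using insert by (simp add: cls_add)
  qed
qed

section \<open>Quotient modules\<close>

lemma finsum_mem: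
  assumes "abelian_group M" "finite T"
    and "\<And>i. i \<in> T \<Longrightarrow> g i \<in> carrier M" "\<And>i. i \<in> T \<Longrightarrow> g i \<in> B"
    and "\<zero>\<^bsub>M\<^esub> \<in> B" "\<And>x y. x \<in> B \<Longrightarrow> y \<in> B \<Longrightarrow> x \<oplus>\<^bsub>M\<^esub> y \<in> B"
  shows "finsum M g T \<in> B"
proof -
  interpret abelian_group M by fact
  show ?thesis using assms(2-4)
  proof (induction T)
    case empty
    then show ?case using assms(5) by simp
  next
    case (insert i T)
    have "finsum M g (insert i T) = g i \<oplus>\<^bsub>M\<^esub> finsum M g T"
      using insert by (intro finsum_insert) auto
    then show ?case using insert assms(6) by simp
  qed
qed

locale left_submodule = left_module R M
  for R :: "('a, 'r) ring_scheme" (structure) and M :: "('a, 'm, 's) module_scheme" (structure) +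
  fixes B :: "'m set"
  assumes sub_carrier: "B \<subseteq> carrier M"
    and sub_zero: "\<zero>\<^bsub>M\<^esub> \<in> B"
    and sub_add: "\<lbrakk>x \<in> B; y \<in> B\<rbrakk> \<Longrightarrow> x \<oplus>\<^bsub>M\<^esub> y \<in> B"
    and sub_smult: "\<lbrakk>a \<in> carrier R; x \<in> B\<rbrakk> \<Longrightarrow> a \<odot>\<^bsub>M\<^esub> x \<in> B"
begin

lemma sub_uminus:
  assumes "x \<in> B"
  shows "\<ominus>\<^bsub>M\<^esub> x \<in> B"
proof -
  have x: "x \<in> carrier M" using assms sub_carrier by blast
  have "(\<ominus>\<^bsub>R\<^esub> \<one>\<^bsub>R\<^esub>) \<odot>\<^bsub>M\<^esub> x \<oplus>\<^bsub>M\<^esub> \<one>\<^bsub>R\<^esub> \<odot>\<^bsub>M\<^esub> x = (\<ominus>\<^bsub>R\<^esub> \<one>\<^bsub>R\<^esub> \<oplus>\<^bsub>R\<^esub> \<one>\<^bsub>R\<^esub>) \<odot>\<^bsub>M\<^esub> x"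
    using x by (intro lsmult_l_distr[symmetric]) simp_all
  also have "\<dots> = \<zero>\<^bsub>M\<^esub>" using x by (simp add: R.l_neg lsmult_l_null)
  finally have "\<ominus>\<^bsub>M\<^esub> x = (\<ominus>\<^bsub>R\<^esub> \<one>\<^bsub>R\<^esub>) \<odot>\<^bsub>M\<^esub> x"
    using x lsmult_closed[OF _ x, of "\<ominus>\<^bsub>R\<^esub> \<one>\<^bsub>R\<^esub>"] by (intro M.minus_equality) (simp_all add: lsmult_one)
  then show ?thesis using sub_smult[OF _ assms, of "\<ominus>\<^bsub>R\<^esub> \<one>\<^bsub>R\<^esub>"] by simp
qed

lemma abelian_subgroup_sub: "abelian_subgroup B M"
proof (rule abelian_subgroupI3)
  show "additive_subgroup B M"
    using sub_carrier sub_zero sub_add sub_uminus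
    by (intro additive_subgroup.intro subgroup.intro) (auto simp: a_inv_def)
  show "abelian_group M" by (rule M.abelian_group_axioms)
qed

lemma coset_eq_iff:
  assumes "x \<in> carrier M" "y \<in> carrier M"
  shows "B +>\<^bsub>M\<^esub> x = B +>\<^bsub>M\<^esub> y \<longleftrightarrow> x \<ominus>\<^bsub>M\<^esub> y \<in> B"
proof -
  interpret B: abelian_subgroup B M by (rule abelian_subgroup_sub)
  have "B +>\<^bsub>M\<^esub> x = B +>\<^bsub>M\<^esub> y \<longleftrightarrow> x \<in> B +>\<^bsub>M\<^esub> y"
    using B.a_repr_independence'[of x y] B.a_rcos_self[OF assms(1)] assms by auto
  also have "\<dots> \<longleftrightarrow> x \<ominus>\<^bsub>M\<^esub> y \<in> B"
    using B.a_rcos_module[OF assms(2,1)] by (simp add: a_minus_def)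
  finally show ?thesis .
qed

lemma quotient_carrier: "carrier (quotient_module M B) = (\<lambda>x. B +>\<^bsub>M\<^esub> x) ` carrier M"
  by (auto simp: quotient_module_def A_RCOSETS_def RCOSETS_def a_r_coset_def)

lemma quotient_zero: "\<zero>\<^bsub>quotient_module M B\<^esub> = B +>\<^bsub>M\<^esub> \<zero>\<^bsub>M\<^esub>"
proof -
  interpret B: abelian_subgroup B M by (rule abelian_subgroup_sub)
  show ?thesis using B.a_rcos_const[OF sub_zero] by (simp add: quotient_module_def)
qed

lemma quotient_add:
  "x \<in> carrier M \<Longrightarrow> y \<in> carrier M \<Longrightarrow>
    (B +>\<^bsub>M\<^esub> x) \<oplus>\<^bsub>quotient_module M B\<^esub> (B +>\<^bsub>M\<^esub> y) = B +>\<^bsub>M\<^esub> (x \<oplus>\<^bsub>M\<^esub> y)"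
  using abelian_subgroup.a_rcos_sum[OF abelian_subgroup_sub] by (simp add: quotient_module_def)

lemma quotient_smult:
  assumes "a \<in> carrier R" "x \<in> carrier M"
  shows "a \<odot>\<^bsub>quotient_module M B\<^esub> (B +>\<^bsub>M\<^esub> x) = B +>\<^bsub>M\<^esub> (a \<odot>\<^bsub>M\<^esub> x)"
proof -
  interpret B: abelian_subgroup B M by (rule abelian_subgroup_sub)
  have *: "B +>\<^bsub>M\<^esub> (a \<odot>\<^bsub>M\<^esub> y) = B +>\<^bsub>M\<^esub> (a \<odot>\<^bsub>M\<^esub> x)" if y: "y \<in> B +>\<^bsub>M\<^esub> x" for y
  proof -
    have yc: "y \<in> carrier M" using y sub_carrier assms(2) by (auto simp: a_r_coset_def')
    have "y \<ominus>\<^bsub>M\<^esub> x \<in> B" using B.a_rcos_module[OF assms(2) yc] y by (simp add: a_minus_def)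
    then have "a \<odot>\<^bsub>M\<^esub> (y \<ominus>\<^bsub>M\<^esub> x) \<in> B" using assms(1) by (rule sub_smult[rotated])
    moreover have "a \<odot>\<^bsub>M\<^esub> (y \<ominus>\<^bsub>M\<^esub> x) = a \<odot>\<^bsub>M\<^esub> y \<ominus>\<^bsub>M\<^esub> a \<odot>\<^bsub>M\<^esub> x"
      using assms yc by (simp add: a_minus_def lsmult_r_distr lsmult_r_minus)
    ultimately show ?thesis using assms yc by (simp add: coset_eq_iff lsmult_closed)
  qed
  have "a \<odot>\<^bsub>quotient_module M B\<^esub> (B +>\<^bsub>M\<^esub> x) = (\<Union>y\<in>B +>\<^bsub>M\<^esub> x. B +>\<^bsub>M\<^esub> (a \<odot>\<^bsub>M\<^esub> y))"
    by (simp add: quotient_module_def)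
  also have "\<dots> = (\<Union>y\<in>B +>\<^bsub>M\<^esub> x. B +>\<^bsub>M\<^esub> (a \<odot>\<^bsub>M\<^esub> x))"
    by (rule SUP_cong[OF refl *])
  also have "\<dots> = B +>\<^bsub>M\<^esub> (a \<odot>\<^bsub>M\<^esub> x)"
    using B.a_rcos_self[OF assms(2)] by blast
  finally show ?thesis .
qed

lemma quotient_cases:
  assumes "C \<in> carrier (quotient_module M B)"
  obtains x where "x \<in> carrier M" "C = B +>\<^bsub>M\<^esub> x"
  using assms by (auto simp: quotient_carrier)

lemma coset_closed: "x \<in> carrier M \<Longrightarrow> B +>\<^bsub>M\<^esub> x \<in> carrier (quotient_module M B)"
  by (simp add: quotient_carrier)

lemma left_module_quotient: "left_module R (quotient_module M B)"
proof (intro left_module.intro left_module_axioms.intro R.ring_axioms abelian_groupI)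
  fix C assume "C \<in> carrier (quotient_module M B)"
  then obtain x where x: "x \<in> carrier M" "C = B +>\<^bsub>M\<^esub> x" by (rule quotient_cases)
  show "\<exists>D\<in>carrier (quotient_module M B). D \<oplus>\<^bsub>quotient_module M B\<^esub> C = \<zero>\<^bsub>quotient_module M B\<^esub>"
    using x(1) unfolding x(2)
    by (intro bexI[of _ "B +>\<^bsub>M\<^esub> (\<ominus>\<^bsub>M\<^esub> x)"])
      (simp_all add: quotient_add quotient_zero M.l_neg coset_closed)
  show "\<zero>\<^bsub>quotient_module M B\<^esub> \<oplus>\<^bsub>quotient_module M B\<^esub> C = C"
    "\<one>\<^bsub>R\<^esub> \<odot>\<^bsub>quotient_module M B\<^esub> C = C"
    using x(1) unfolding x(2) by (simp_all add: quotient_add quotient_zero quotient_smult lsmult_one)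
next
  fix C D assume "C \<in> carrier (quotient_module M B)" "D \<in> carrier (quotient_module M B)"
  then obtain x y where x: "x \<in> carrier M" "C = B +>\<^bsub>M\<^esub> x" and y: "y \<in> carrier M" "D = B +>\<^bsub>M\<^esub> y"
    by (elim quotient_cases)
  show "C \<oplus>\<^bsub>quotient_module M B\<^esub> D \<in> carrier (quotient_module M B)"
    "C \<oplus>\<^bsub>quotient_module M B\<^esub> D = D \<oplus>\<^bsub>quotient_module M B\<^esub> C"
    using x(1) y(1) unfolding x(2) y(2) by (simp_all add: quotient_add coset_closed M.a_comm)
  fix a assume a: "a \<in> carrier R"
  show "a \<odot>\<^bsub>quotient_module M B\<^esub> C \<in> carrier (quotient_module M B)"
    "a \<odot>\<^bsub>quotient_module M B\<^esub> (C \<oplus>\<^bsub>quotient_module M B\<^esub> D) =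
      a \<odot>\<^bsub>quotient_module M B\<^esub> C \<oplus>\<^bsub>quotient_module M B\<^esub> a \<odot>\<^bsub>quotient_module M B\<^esub> D"
    using a x(1) y(1) unfolding x(2) y(2)
    by (simp_all add: quotient_add quotient_smult coset_closed lsmult_closed lsmult_r_distr)
next
  fix C D E assume "C \<in> carrier (quotient_module M B)" "D \<in> carrier (quotient_module M B)"
    "E \<in> carrier (quotient_module M B)"
  then obtain x y z where x: "x \<in> carrier M" "C = B +>\<^bsub>M\<^esub> x" and y: "y \<in> carrier M" "D = B +>\<^bsub>M\<^esub> y"
    and z: "z \<in> carrier M" "E = B +>\<^bsub>M\<^esub> z"
    by (elim quotient_cases)
  show "C \<oplus>\<^bsub>quotient_module M B\<^esub> D \<oplus>\<^bsub>quotient_module M B\<^esub> E =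
      C \<oplus>\<^bsub>quotient_module M B\<^esub> (D \<oplus>\<^bsub>quotient_module M B\<^esub> E)"
    using x(1) y(1) z(1) unfolding x(2) y(2) z(2) by (simp add: quotient_add M.a_assoc)
next
  fix a b C assume ab: "a \<in> carrier R" "b \<in> carrier R" and "C \<in> carrier (quotient_module M B)"
  then obtain x where x: "x \<in> carrier M" "C = B +>\<^bsub>M\<^esub> x" by (elim quotient_cases)
  show "(a \<oplus>\<^bsub>R\<^esub> b) \<odot>\<^bsub>quotient_module M B\<^esub> C =
      a \<odot>\<^bsub>quotient_module M B\<^esub> C \<oplus>\<^bsub>quotient_module M B\<^esub> b \<odot>\<^bsub>quotient_module M B\<^esub> C"
    "(a \<otimes>\<^bsub>R\<^esub> b) \<odot>\<^bsub>quotient_module M B\<^esub> C =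
      a \<odot>\<^bsub>quotient_module M B\<^esub> (b \<odot>\<^bsub>quotient_module M B\<^esub> C)"
    using ab x(1) unfolding x(2)
    by (simp_all add: quotient_smult quotient_add lsmult_closed lsmult_l_distr lsmult_assoc)
next
  show "\<zero>\<^bsub>quotient_module M B\<^esub> \<in> carrier (quotient_module M B)"
    by (simp add: quotient_zero coset_closed)
qed

lemma coset_hom: "(\<lambda>x. B +>\<^bsub>M\<^esub> x) \<in> lmod_hom R M (quotient_module M B)"
  by (rule lmod_homI) (simp_all add: coset_closed quotient_add quotient_smult)

lemma coset_eq_zero_iff:
  assumes "x \<in> carrier M"
  shows "B +>\<^bsub>M\<^esub> x = \<zero>\<^bsub>quotient_module M B\<^esub> \<longleftrightarrow> x \<in> B"
proof -
  have "\<ominus>\<^bsub>M\<^esub> \<zero>\<^bsub>M\<^esub> = \<zero>\<^bsub>M\<^esub>" by (rule M.minus_equality) simp_all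
  then have "x \<ominus>\<^bsub>M\<^esub> \<zero>\<^bsub>M\<^esub> = x" using assms by (simp only: a_minus_def M.r_zero)
  then show ?thesis
    using assms coset_eq_iff[of x "\<zero>\<^bsub>M\<^esub>"] by (simp add: quotient_zero)
qed

end

section \<open>The algebra as a left module over itself\<close>

lemma left_module_regular: "ring A \<Longrightarrow> left_module A (regular_module A)"
proof -
  assume "ring A"
  interpret ring A by fact
  show ?thesis
  proof (intro left_module.intro left_module_axioms.intro \<open>ring A\<close> abelian_groupI)
    fix x assume "x \<in> carrier (regular_module A)"
    then show "\<exists>y\<in>carrier (regular_module A). y \<oplus>\<^bsub>regular_module A\<^esub> x = \<zero>\<^bsub>regular_module A\<^esub>"
      by (intro bexI[of _ "\<ominus>\<^bsub>A\<^esub> x"]) (simp_all add: regular_module_def l_neg)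
  qed (simp_all add: regular_module_def a_ac l_distr r_distr m_assoc)
qed

lemma regular_module_simps [simp]:
  "carrier (regular_module A) = carrier A" "\<zero>\<^bsub>regular_module A\<^esub> = \<zero>\<^bsub>A\<^esub>"
  "x \<oplus>\<^bsub>regular_module A\<^esub> y = x \<oplus>\<^bsub>A\<^esub> y" "a \<odot>\<^bsub>regular_module A\<^esub> x = a \<otimes>\<^bsub>A\<^esub> x"
  by (simp_all add: regular_module_def)

lemma finsum_regular_module: "finsum (regular_module A) f T = finsum A f T"
  by (simp add: finsum_def finprod_def regular_module_def)

section \<open>Projectors and freeness of the tensor modules\<close>

interpretation tensor_alg_pair: vector_space_pair
  "tscale :: 'k::field \<Rightarrow> ('q, 'k) tensor_alg \<Rightarrow> _" "tscale :: 'k \<Rightarrow> ('p, 'k) tensor_alg \<Rightarrow> _"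
  by unfold_locales

interpretation tensor_alg_functional: vector_space_pair
  "tscale :: 'k::field \<Rightarrow> ('q, 'k) tensor_alg \<Rightarrow> _" "(*) :: 'k \<Rightarrow> 'k \<Rightarrow> 'k"
  by unfold_locales (simp_all add: algebra_simps)

text \<open>A chosen linear retraction of the tensor algebra onto \<open>V\<close>. It makes A
  \<otimes> V a direct summand of a free module indexed by words, with no choice of a basis of
  \<open>V\<close>.\<close>

definition projector ::
  "('q, 'k::field) tensor_alg set \<Rightarrow> ('q, 'k) tensor_alg \<Rightarrow> ('q, 'k) tensor_alg" where
  "projector V = (SOME g. range g \<subseteq> V \<and> Vector_Spaces.linear tscale tscale g \<and> (\<forall>v\<in>V. g v = v))"

lemma projector_properties:
  fixes V :: "('q, 'k::field) tensor_alg set"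
  assumes "tensor_alg.subspace V"
  shows "projector V p \<in> V" "Vector_Spaces.linear tscale tscale (projector V)"
    "v \<in> V \<Longrightarrow> projector V v = v"
proof -
  have "\<exists>g :: ('q, 'k) tensor_alg \<Rightarrow> ('q, 'k) tensor_alg.
      range g \<subseteq> V \<and> Vector_Spaces.linear tscale tscale g \<and> (\<forall>v\<in>V. g (id v) = v)"
    using tensor_alg.linear_id assms by (rule tensor_alg_pair.linear_exists_left_inverse_on) simp
  then have "\<exists>g :: ('q, 'k) tensor_alg \<Rightarrow> ('q, 'k) tensor_alg.
      range g \<subseteq> V \<and> Vector_Spaces.linear tscale tscale g \<and> (\<forall>v\<in>V. g v = v)" by simp
  then have "range (projector V) \<subseteq> V \<and> Vector_Spaces.linear tscale tscale (projector V) \<and>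
      (\<forall>v\<in>V. projector V v = v)"
    unfolding projector_def by (rule someI_ex)
  then show "projector V p \<in> V" "Vector_Spaces.linear tscale tscale (projector V)"
    "v \<in> V \<Longrightarrow> projector V v = v" by auto
qed

text \<open>Image of 1 \<otimes> u under the identity of A tensored with the projection onto
  \<open>V\<close>. Taken over all words of the degree of \<open>V\<close>, these tensors generate A
  \<otimes> V but need not be independent.\<close>

definition spanning_tensor ::
  "('q, 'k::field) tensor_alg set \<Rightarrow> ('q, 'k) tensor_alg set \<Rightarrow> 'q list \<Rightarrow> ('q, 'k) universe" where
  "spanning_tensor R V u = pure_tensor R 1 (projector V (Poly_Mapping.single u 1))"

lemma spanning_tensor_closed:
  "tensor_alg.subspace V \<Longrightarrow> spanning_tensor R V u \<in> tensor (hom_alg R) V"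
  unfolding spanning_tensor_def by (intro pure_tensor_closed projector_properties)

text \<open>The representatives can be chosen at all words at once so that invariance under the
  projection holds in the tensor algebra itself, not only modulo the ideal. A pure tensor has this
  property because the projection fixes \<open>v\<close>, and sums inherit it.\<close>

lemma tensor_representative:
  fixes R V :: "('q::finite, 'k::field) tensor_alg set"
  assumes V: "tensor_alg.subspace V" "V \<subseteq> tensor_power n" and t: "t \<in> tensor (hom_alg R) V"
  shows "\<exists>\<tau>. t = (\<lambda>w. cls R (\<tau> w)) \<and>
    (\<forall>w. \<tau> w = (\<Sum>u | length u = n.
      tscale (Poly_Mapping.lookup (projector V (Poly_Mapping.single u 1)) w) (\<tau> u)))"
  using t
proof (induction rule: tensor_induct_pure)
  case zero
  show ?case by (intro exI[of _ "\<lambda>w. 0"]) (simp add: cls_zero)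
next
  case (add t p v)
  let ?c = "\<lambda>u w. Poly_Mapping.lookup (projector V (Poly_Mapping.single u 1)) w"
  note lin = projector_properties(2)[OF V(1)]
  obtain \<tau> where \<tau>': "t = (\<lambda>w. cls R (\<tau> w))" "\<forall>w. \<tau> w = (\<Sum>u | length u = n. tscale (?c u w) (\<tau> u))"
    using add.IH by (elim exE conjE)
  note \<tau> = \<tau>'(1) \<tau>'(2)[rule_format]
  have v: "Poly_Mapping.lookup v w = (\<Sum>u | length u = n. ?c u w * Poly_Mapping.lookup v u)" for w
  proof -
    have "v = projector V v" using add.hyps by (simp add: projector_properties(3)[OF V(1)])
    also have "\<dots> = projector V (\<Sum>u | length u = n.
        tscale (Poly_Mapping.lookup v u) (Poly_Mapping.single u 1))"
      using tensor_power_expand[of v n] add.hyps V(2) by auto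
    also have "\<dots> = (\<Sum>u | length u = n.
        tscale (Poly_Mapping.lookup v u) (projector V (Poly_Mapping.single u 1)))"
      by (simp add: tensor_alg_pair.linear_sum[OF lin] tensor_alg_pair.linear_scale[OF lin])
    finally have "Poly_Mapping.lookup v w = Poly_Mapping.lookup (\<Sum>u | length u = n.
        tscale (Poly_Mapping.lookup v u) (projector V (Poly_Mapping.single u 1))) w" by simp
    then show ?thesis by (simp add: lookup_sum lookup_tscale mult.commute)
  qed
  define \<sigma> where "\<sigma> w = \<tau> w + tscale (Poly_Mapping.lookup v w) p" for w
  have "\<sigma> w = (\<Sum>u | length u = n. tscale (?c u w) (\<sigma> u))" for w
  proof -
    have "(\<Sum>u | length u = n. tscale (?c u w) (\<sigma> u)) =
        (\<Sum>u | length u = n. tscale (?c u w) (\<tau> u)) +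
        tscale (\<Sum>u | length u = n. ?c u w * Poly_Mapping.lookup v u) p"
      by (simp add: \<sigma>_def tensor_alg.scale_right_distrib sum.distrib tensor_alg.scale_sum_left)
    then show ?thesis using \<tau>(2)[of w] v[of w] by (simp add: \<sigma>_def)
  qed
  moreover have "(\<lambda>w. t w \<oplus>\<^bsub>hom_alg R\<^esub> pure_tensor R p v w) = (\<lambda>w. cls R (\<sigma> w))"
    by (simp add: \<tau>(1) pure_tensor_def cls_add \<sigma>_def)
  ultimately show ?case by (intro exI[of _ \<sigma>] conjI allI)
qed

text \<open>Invariance of \<open>t\<close> under the projection, read as an expansion: the values of
  \<open>t\<close> are themselves the coefficients on the spanning tensors. A homomorphism out of A
  \<otimes> V is therefore controlled by its values on these.\<close>

lemma tensor_expand: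
  fixes R V :: "('q::finite, 'k::field) tensor_alg set"
  assumes V: "tensor_alg.subspace V" "V \<subseteq> tensor_power n" and t: "t \<in> tensor (hom_alg R) V"
  shows "t = finsum (tensor_module R V)
    (\<lambda>u. t u \<odot>\<^bsub>tensor_module R V\<^esub> spanning_tensor R V u) {u. length u = n}"
proof -
  let ?c = "\<lambda>u w. Poly_Mapping.lookup (projector V (Poly_Mapping.single u 1)) w"
  obtain \<tau> where \<tau>': "t = (\<lambda>w. cls R (\<tau> w))" "\<forall>w. \<tau> w = (\<Sum>u | length u = n. tscale (?c u w) (\<tau> u))"
    using tensor_representative[OF assms] by (elim exE conjE)
  note \<tau> = \<tau>'(1) \<tau>'(2)[rule_format]
  have e: "t u \<odot>\<^bsub>tensor_module R V\<^esub> spanning_tensor R V u = (\<lambda>w. cls R (tscale (?c u w) (\<tau> u)))" for u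
    by (simp add: \<tau>(1) spanning_tensor_def pure_tensor_def cls_mult tscale_mult_right)
  have "(\<lambda>w. cls R (tscale (?c u w) (\<tau> u))) \<in> tensor (hom_alg R) V" for u
    using tensor_smult_closed[OF spanning_tensor_closed[OF V(1), of R u] cls_closed, of "\<tau> u"] e[of u]
    by (simp add: \<tau>(1))
  then have "finsum (tensor_module R V) (\<lambda>u. t u \<odot>\<^bsub>tensor_module R V\<^esub> spanning_tensor R V u) {u. length u = n}
      = (\<lambda>w. cls R (\<Sum>u | length u = n. tscale (?c u w) (\<tau> u)))"
    unfolding e by (intro finsum_tensor_module) simp_all
  also have "\<dots> = t" unfolding \<tau>(1) \<tau>(2)[symmetric] ..
  finally show ?thesis by (rule sym)
qed

lemma tensor_module_hom_expand:
  fixes R V :: "('q::finite, 'k::field) tensor_alg set"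
  assumes V: "tensor_alg.subspace V" "V \<subseteq> tensor_power n" and t: "t \<in> tensor (hom_alg R) V"
    and f: "f \<in> lmod_hom (hom_alg R) (tensor_module R V) M" and M: "left_module (hom_alg R) M"
  shows "f t = finsum M (\<lambda>u. t u \<odot>\<^bsub>M\<^esub> f (spanning_tensor R V u)) {u. length u = n}"
proof -
  interpret T: left_module "hom_alg R" "tensor_module R V" by (rule left_module_tensor_module)
  interpret M: left_module "hom_alg R" M by (rule M)
  have c: "spanning_tensor R V u \<in> carrier (tensor_module R V)" for u
    using spanning_tensor_closed[OF V(1)] by simp
  have s: "t u \<odot>\<^bsub>tensor_module R V\<^esub> spanning_tensor R V u \<in> carrier (tensor_module R V)" for u
    using tensor_value[OF t] c by (rule T.lsmult_closed)
  have "f t = f (finsum (tensor_module R V)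
      (\<lambda>u. t u \<odot>\<^bsub>tensor_module R V\<^esub> spanning_tensor R V u) {u. length u = n})"
    using tensor_expand[OF V t] by (rule arg_cong)
  also have "\<dots> = finsum M (\<lambda>u. f (t u \<odot>\<^bsub>tensor_module R V\<^esub> spanning_tensor R V u)) {u. length u = n}"
    using f T.M.abelian_group_axioms M.M.abelian_group_axioms finite_words s by (rule lmod_hom_finsum)
  also have "(\<lambda>u. f (t u \<odot>\<^bsub>tensor_module R V\<^esub> spanning_tensor R V u)) =
      (\<lambda>u. t u \<odot>\<^bsub>M\<^esub> f (spanning_tensor R V u))"
    using lmod_hom_smult[OF f tensor_value[OF t] c] by (rule ext)
  finally show ?thesis .
qed

text \<open>\<open>projective_lmod\<close> takes bases inside the carrier type of the module, here
  functions from words to sets. Words are embedded there as indicator functions; nothing but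
  injectivity matters, so the values need not be cosets.\<close>

definition word_code :: "'q list \<Rightarrow> ('q, 'k::field) universe" where
  "word_code u = (\<lambda>w. if w = u then UNIV else {})"

lemma inj_word_code: "inj word_code"
  by (rule injI) (metis word_code_def UNIV_not_empty)

text \<open>The section reads off the values at words of length \<open>n\<close>, and the retraction
  sends the basis element of a word to its spanning tensor; that they compose to the identity is
  \<open>tensor_expand\<close>.\<close>

lemma projective_tensor_module:
  fixes R V :: "('q::finite, 'k::field) tensor_alg set"
  assumes V: "tensor_alg.subspace V" "V \<subseteq> tensor_power n"
  shows "projective_lmod (hom_alg R) (tensor_module R V)"
  unfolding projective_lmod_def
proof (intro conjI left_module_tensor_module)
  interpret A: ring "hom_alg R" by (rule ring_hom_alg)
  interpret T: left_module "hom_alg R" "tensor_module R V" by (rule left_module_tensor_module)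
  define S :: "('q, 'k) universe set" where "S = word_code ` {u. length u = n}"
  define s where "s t i = (if i \<in> S then t (inv_into UNIV word_code i) else \<zero>\<^bsub>hom_alg R\<^esub>)"
    for t :: "('q, 'k) universe" and i :: "('q, 'k) universe"
  have S: "finite S" by (simp add: S_def)
  have inv: "inv_into UNIV word_code (word_code u :: ('q, 'k) universe) = u" for u :: "'q list"
    by (rule inv_f_f[OF inj_word_code])
  have fin: "finite {i. s t i \<noteq> \<zero>\<^bsub>hom_alg R\<^esub>}" for t
    by (rule finite_subset[OF _ S]) (auto simp: s_def)
  have s: "s \<in> lmod_hom (hom_alg R) (tensor_module R V) (free_module (hom_alg R) S)"
  proof (rule lmod_homI)
    show sc: "s t \<in> carrier (free_module (hom_alg R) S)" if "t \<in> carrier (tensor_module R V)" for t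
    proof -
      have tt: "t \<in> tensor (hom_alg R) V" using that by simp
      have 1: "\<forall>i \<in> S. s t i \<in> carrier (hom_alg R)" using tensor_value[OF tt] by (simp add: s_def)
      have 2: "\<forall>i. i \<notin> S \<longrightarrow> s t i = \<zero>\<^bsub>hom_alg R\<^esub>" by (simp add: s_def)
      show ?thesis using fin 1 2 by (simp add: free_module_def)
    qed
    show "s (x \<oplus>\<^bsub>tensor_module R V\<^esub> y) = s x \<oplus>\<^bsub>free_module (hom_alg R) S\<^esub> s y"
      if "x \<in> carrier (tensor_module R V)" "y \<in> carrier (tensor_module R V)" for x y
      by (rule ext) (simp add: s_def free_module_def)
    show "s (a \<odot>\<^bsub>tensor_module R V\<^esub> x) = a \<odot>\<^bsub>free_module (hom_alg R) S\<^esub> s x"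
      if "a \<in> carrier (hom_alg R)" "x \<in> carrier (tensor_module R V)" for a x
      using that by (intro ext) (simp add: s_def free_module_def)
  qed
  have "\<exists>r \<in> lmod_hom (hom_alg R) (free_module (hom_alg R) S) (tensor_module R V).
      \<forall>i \<in> S. r (free_basis (hom_alg R) i) = spanning_tensor R V (inv_into UNIV word_code i)"
    using spanning_tensor_closed[OF V(1)]
    by (intro free_module_lift ring_hom_alg left_module_tensor_module) simp
  then obtain r where r: "r \<in> lmod_hom (hom_alg R) (free_module (hom_alg R) S) (tensor_module R V)"
    and ri: "\<forall>i \<in> S. r (free_basis (hom_alg R) i) = spanning_tensor R V (inv_into UNIV word_code i)" by (elim bexE)
  have rs: "r (s t) = t" if t: "t \<in> carrier (tensor_module R V)" for t
  proof -
    have tt: "t \<in> tensor (hom_alg R) V" using t by simp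
    have "r (s t) = finsum (tensor_module R V)
        (\<lambda>i. s t i \<odot>\<^bsub>tensor_module R V\<^esub> r (free_basis (hom_alg R) i)) S"
      using ring_hom_alg left_module_tensor_module r S subset_refl lmod_hom_closed[OF s t]
      by (rule free_module_hom_expand) (simp add: s_def)
    also have "\<dots> = finsum (tensor_module R V)
        (\<lambda>u. s t (word_code u) \<odot>\<^bsub>tensor_module R V\<^esub> r (free_basis (hom_alg R) (word_code u))) {u. length u = n}"
      unfolding S_def
    proof (rule T.M.add.finprod_reindex)
      show "inj_on (word_code :: 'q list \<Rightarrow> ('q, 'k) universe) {u. length u = n}"
        using inj_word_code by (rule inj_on_subset) simp
      show "(\<lambda>i. s t i \<odot>\<^bsub>tensor_module R V\<^esub> r (free_basis (hom_alg R) i)) \<in>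
          word_code ` {u. length u = n} \<rightarrow> carrier (tensor_module R V)"
      proof
        fix i :: "('q, 'k) universe" assume "i \<in> word_code ` {u. length u = n}"
        then have i: "i \<in> S" by (simp add: S_def)
        have "s t i \<in> carrier (hom_alg R)" using i tensor_value[OF tt] by (simp add: s_def)
        moreover have "r (free_basis (hom_alg R) i) \<in> carrier (tensor_module R V)"
          using r free_basis_closed[OF ring_hom_alg i] by (rule lmod_hom_closed)
        ultimately show "s t i \<odot>\<^bsub>tensor_module R V\<^esub> r (free_basis (hom_alg R) i) \<in> carrier (tensor_module R V)"
          by (rule T.lsmult_closed)
      qed
    qed
    also have "\<dots> = finsum (tensor_module R V)
        (\<lambda>u. t u \<odot>\<^bsub>tensor_module R V\<^esub> spanning_tensor R V u) {u. length u = n}"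
    proof (rule T.M.finsum_cong'[OF refl])
      show "(\<lambda>u. t u \<odot>\<^bsub>tensor_module R V\<^esub> spanning_tensor R V u) \<in> {u. length u = n} \<rightarrow> carrier (tensor_module R V)"
        using tensor_value[OF tt] spanning_tensor_closed[OF V(1)] by (intro Pi_I T.lsmult_closed) simp_all
      fix u :: "'q list" assume "u \<in> {u. length u = n}"
      then have "word_code u \<in> S" by (simp add: S_def)
      then show "s t (word_code u) \<odot>\<^bsub>tensor_module R V\<^esub> r (free_basis (hom_alg R) (word_code u)) =
          t u \<odot>\<^bsub>tensor_module R V\<^esub> spanning_tensor R V u"
        using ri by (simp add: s_def inv)
    qed
    also have "\<dots> = t" using tensor_expand[OF V tt] by (rule sym)
    finally show ?thesis .
  qed
  show "\<exists>(S :: ('q, 'k) universe set). \<exists>s \<in> lmod_hom (hom_alg R) (tensor_module R V) (free_module (hom_alg R) S).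
      \<exists>r \<in> lmod_hom (hom_alg R) (free_module (hom_alg R) S) (tensor_module R V).
        \<forall>x \<in> carrier (tensor_module R V). r (s x) = x"
    using rs by (intro exI[of _ S] bexI[OF _ s] bexI[OF _ r] ballI)
qed

subsection \<open>The augmentation ideal\<close>

definition augmentation_ideal :: "('q, 'k::field) tensor_alg set \<Rightarrow> ('q, 'k) tensor_alg set set" where
  "augmentation_ideal R = cls R ` words_ge 1"

lemma words_ge_1_iff:
  "p \<in> words_ge 1 \<longleftrightarrow> Poly_Mapping.lookup p [] = 0"
  "p \<in> words_ge (Suc 0) \<longleftrightarrow> Poly_Mapping.lookup p [] = 0"
  by (auto simp: words_ge_def)

text \<open>The constant term does not depend on the representative, since for
  \<open>N \<ge> 1\<close> no element of the ideal of relations has one.\<close>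

lemma cls_augmentation_ideal:
  assumes "R \<subseteq> tensor_power N" "N \<ge> 1"
  shows "cls R p \<in> augmentation_ideal R \<longleftrightarrow> Poly_Mapping.lookup p [] = 0"
proof
  assume "cls R p \<in> augmentation_ideal R"
  then obtain q where q: "cls R p = cls R q" "q \<in> words_ge 1" by (auto simp: augmentation_ideal_def)
  have "Poly_Mapping.lookup p [] = cls_coeff (cls R p) []"
    using assms(2) by (intro cls_coeff_cls[OF assms(1), symmetric]) simp
  also have "\<dots> = Poly_Mapping.lookup q []"
    unfolding q(1) using assms(2) by (intro cls_coeff_cls[OF assms(1)]) simp
  finally show "Poly_Mapping.lookup p [] = 0" using q(2) unfolding words_ge_1_iff by simp
qed (auto simp: augmentation_ideal_def words_ge_1_iff)

lemma left_submodule_augmentation_ideal: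
  "left_submodule (hom_alg R) (regular_module (hom_alg R)) (augmentation_ideal R)"
proof (intro left_submodule.intro left_submodule_axioms.intro left_module_regular ring_hom_alg)
  show "augmentation_ideal R \<subseteq> carrier (regular_module (hom_alg R))"
    by (auto simp: augmentation_ideal_def)
  show "\<zero>\<^bsub>regular_module (hom_alg R)\<^esub> \<in> augmentation_ideal R"
    by (auto simp: augmentation_ideal_def cls_zero words_ge_def)
  show "x \<oplus>\<^bsub>regular_module (hom_alg R)\<^esub> y \<in> augmentation_ideal R"
    if "x \<in> augmentation_ideal R" "y \<in> augmentation_ideal R" for x y
    using that by (auto simp: augmentation_ideal_def cls_add words_ge_add)
  show "a \<odot>\<^bsub>regular_module (hom_alg R)\<^esub> x \<in> augmentation_ideal R"
    if "a \<in> carrier (hom_alg R)" "x \<in> augmentation_ideal R" for a x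
    using that by (auto simp: augmentation_ideal_def cls_mult words_ge_mult elim!: hom_alg_cases)
qed

lemma augmentation_ideal_mult_right:
  assumes "a \<in> augmentation_ideal R" "b \<in> carrier (hom_alg R)"
  shows "a \<otimes>\<^bsub>hom_alg R\<^esub> b \<in> augmentation_ideal R"
proof -
  from assms(2) obtain q where "b = cls R q" by (rule hom_alg_cases)
  then show ?thesis using assms(1) by (auto simp: augmentation_ideal_def cls_mult words_ge_mult)
qed

text \<open>In the expansion along spanning tensors the values of \<open>t\<close> stand on the
  left, and the augmentation ideal absorbs right multiplication. Together with minimality of the
  Koszul differentials this substitutes for tensoring with the trivial module.\<close>

lemma regular_hom_augmentation:
  fixes R V :: "('q::finite, 'k::field) tensor_alg set"
  assumes V: "tensor_alg.subspace V" "V \<subseteq> tensor_power n" and t: "t \<in> tensor (hom_alg R) V"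
    and f: "f \<in> lmod_hom (hom_alg R) (tensor_module R V) (regular_module (hom_alg R))"
    and pos: "\<And>w. t w \<in> augmentation_ideal R"
  shows "f t \<in> augmentation_ideal R"
proof -
  interpret B: left_submodule "hom_alg R" "regular_module (hom_alg R)" "augmentation_ideal R"
    by (rule left_submodule_augmentation_ideal)
  have fc: "f (spanning_tensor R V u) \<in> carrier (hom_alg R)" for u
    using lmod_hom_closed[OF f, of "spanning_tensor R V u"] spanning_tensor_closed[OF V(1)] by simp
  have m: "t u \<odot>\<^bsub>regular_module (hom_alg R)\<^esub> f (spanning_tensor R V u) \<in> augmentation_ideal R" for u
    using augmentation_ideal_mult_right[OF pos fc] by simp
  have "f t = finsum (regular_module (hom_alg R))
      (\<lambda>u. t u \<odot>\<^bsub>regular_module (hom_alg R)\<^esub> f (spanning_tensor R V u)) {u. length u = n}"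
    using V t f left_module_regular[OF ring_hom_alg] by (rule tensor_module_hom_expand)
  also have "\<dots> \<in> augmentation_ideal R"
    using B.M.abelian_group_axioms finite_words _ m B.sub_zero B.sub_add
  proof (rule finsum_mem)
    show "t u \<odot>\<^bsub>regular_module (hom_alg R)\<^esub> f (spanning_tensor R V u) \<in> carrier (regular_module (hom_alg R))" for u
      using m B.sub_carrier by (rule rev_subsetD)
  qed
  finally show ?thesis .
qed

text \<open>Evaluation at the word \<open>w\<close> is a homomorphism to the algebra, which reduces
  the claim to homomorphisms with values in the regular module.\<close>

lemma tensor_hom_augmentation:
  fixes R V :: "('q::finite, 'k::field) tensor_alg set"
  assumes V: "tensor_alg.subspace V" "V \<subseteq> tensor_power n" and t: "t \<in> tensor (hom_alg R) V"
    and f: "f \<in> lmod_hom (hom_alg R) (tensor_module R V) (tensor_module R V')"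
    and pos: "\<And>w. t w \<in> augmentation_ideal R"
  shows "f t w \<in> augmentation_ideal R"
proof (rule regular_hom_augmentation[OF V t _ pos, of "\<lambda>t. f t w"])
  show "(\<lambda>t. f t w) \<in> lmod_hom (hom_alg R) (tensor_module R V) (regular_module (hom_alg R))"
  proof (rule lmod_homI)
    show "f t w \<in> carrier (regular_module (hom_alg R))" if "t \<in> carrier (tensor_module R V)" for t
      using lmod_hom_closed[OF f that] tensor_value by simp
    show "f (x \<oplus>\<^bsub>tensor_module R V\<^esub> y) w = f x w \<oplus>\<^bsub>regular_module (hom_alg R)\<^esub> f y w"
      if "x \<in> carrier (tensor_module R V)" "y \<in> carrier (tensor_module R V)" for x y
      using lmod_hom_add[OF f that] by simp
    show "f (a \<odot>\<^bsub>tensor_module R V\<^esub> x) w = a \<odot>\<^bsub>regular_module (hom_alg R)\<^esub> f x w"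
      if "a \<in> carrier (hom_alg R)" "x \<in> carrier (tensor_module R V)" for a x
      using lmod_hom_smult[OF f that] by simp
  qed
qed

section \<open>The Koszul complex as a projective resolution\<close>

lemma trivial_module_eq:
  "trivial_module R = quotient_module (regular_module (hom_alg R)) (augmentation_ideal R)"
proof -
  have "{p :: ('a, 'b) tensor_alg. \<forall>w \<in> Poly_Mapping.keys p. length w \<ge> 1} = words_ge 1"
    by (auto simp: words_ge_def in_keys_iff Suc_le_eq)
  then show ?thesis by (simp add: trivial_module_def augmentation_ideal_def)
qed

lemma representative:
  assumes "\<And>w. t w \<in> carrier (hom_alg R)"
  obtains \<tau> where "t = (\<lambda>w. cls R (\<tau> w))"
proof -
  have "\<forall>w. \<exists>p. t w = cls R p" using assms by (auto simp: carrier_hom_alg)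
  then obtain \<tau> where "\<forall>w. t w = cls R (\<tau> w)" by (rule choice[THEN exE])
  then show ?thesis by (intro that ext) simp
qed

lemma tensor_support:
  fixes R V :: "('q, 'k::field) tensor_alg set"
  assumes "t \<in> tensor (hom_alg R) V" "V \<subseteq> tensor_power n" "length w \<noteq> n"
  shows "t w = \<zero>\<^bsub>hom_alg R\<^esub>"
proof -
  interpret ring "hom_alg R" by (rule ring_hom_alg)
  show ?thesis using assms(1)
  proof (induction rule: tensor_induct_pure)
    case (add t p v)
    then have "Poly_Mapping.lookup v w = 0" using assms(2,3) by (auto intro: tensor_powerD)
    then show ?case using add by (simp add: pure_tensor_def flip: cls_zero)
  qed simp
qed

text \<open>There are finitely many words of length \<open>n\<close>, so a function supported on
  them is the finite sum of its values tensored with the words.\<close>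

lemma tensor_tensor_powerI:
  fixes R :: "('q::finite, 'k::field) tensor_alg set" and t :: "('q, 'k) universe"
  assumes "\<And>w. t w \<in> carrier (hom_alg R)" "\<And>w. length w \<noteq> n \<Longrightarrow> t w = \<zero>\<^bsub>hom_alg R\<^esub>"
  shows "t \<in> tensor (hom_alg R) (tensor_power n)"
proof -
  interpret T: left_module "hom_alg R" "tensor_module R (tensor_power n)"
    by (rule left_module_tensor_module)
  obtain \<sigma> where \<sigma>: "t = (\<lambda>w. cls R (\<sigma> w))" using assms(1) by (rule representative)
  define \<tau> where "\<tau> w = (if length w = n then \<sigma> w else 0)" for w
  have t: "t w = cls R (\<tau> w)" for w using assms(2)[of w] by (simp add: \<tau>_def \<sigma> cls_zero)
  let ?f = "\<lambda>u w. tscale (Poly_Mapping.lookup (Poly_Mapping.single u 1) w) (\<tau> u)"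
  have c: "(\<lambda>w. cls R (?f u w)) \<in> tensor (hom_alg R) (tensor_power n)" if "length u = n" for u
    using pure_tensor_closed[of "Poly_Mapping.single u 1" "tensor_power n" R "\<tau> u"]
      single_tensor_power[of u "1 :: 'k"] that by (simp add: pure_tensor_def)
  have "(\<Sum>u | length u = n. ?f u w) = \<tau> w" for w
  proof -
    have "(\<Sum>u | length u = n. ?f u w) = (\<Sum>u | length u = n. if w = u then \<tau> u else 0)"
      by (intro sum.cong refl) (auto simp: lookup_single when_def)
    also have "\<dots> = \<tau> w" by (simp add: \<tau>_def)
    finally show ?thesis .
  qed
  then have "t = (\<lambda>w. cls R (\<Sum>u | length u = n. ?f u w))" using t by auto
  also have "\<dots> = finsum (tensor_module R (tensor_power n)) (\<lambda>u w. cls R (?f u w)) {u. length u = n}"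
    using c by (intro finsum_tensor_module[symmetric]) simp_all
  also have "\<dots> \<in> carrier (tensor_module R (tensor_power n))"
    using c by (intro T.M.finsum_closed Pi_I) simp
  finally show ?thesis by simp
qed

section \<open>The Koszul differential and its powers on representatives\<close>

lemma koszul_d_cls:
  "koszul_d R (\<lambda>w. cls R (\<tau> w)) = (\<lambda>w. cls R (\<Sum>l\<in>UNIV. \<tau> (l # w) * gen l))"
  by (simp add: koszul_d_def cls_mult cls_sum)

text \<open>The \<open>k\<close>-fold differential moves a whole prefix of length \<open>k\<close>
  into the algebra. The induction splits off the differential that is applied first, so that the
  letters accumulate in reading order.\<close>

lemma koszul_d_power_cls:
  "(koszul_d R ^^ k) (\<lambda>w. cls R (\<tau> w)) =
    (\<lambda>w. cls R (\<Sum>u | length u = k. \<tau> (u @ w) * Poly_Mapping.single u 1))"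
proof (induction k arbitrary: \<tau>)
  case 0
  have "{u :: 'a list. length u = 0} = {[]}" by auto
  then show ?case by (simp add: single_one_Nil)
next
  case (Suc k)
  have "(koszul_d R ^^ Suc k) (\<lambda>w. cls R (\<tau> w)) =
      (koszul_d R ^^ k) (\<lambda>w. cls R (\<Sum>l\<in>UNIV. \<tau> (l # w) * gen l))"
    by (simp add: funpow_swap1 koszul_d_cls)
  also have "\<dots> = (\<lambda>w. cls R (\<Sum>u | length u = k. (\<Sum>l\<in>UNIV. \<tau> (l # (u @ w)) * gen l) * Poly_Mapping.single u 1))"
    by (rule Suc.IH)
  also have "\<dots> = (\<lambda>w. cls R (\<Sum>u | length u = Suc k. \<tau> (u @ w) * Poly_Mapping.single u 1))"
  proof (intro ext arg_cong[where f = "cls R"])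
    fix w
    have s: "gen l * Poly_Mapping.single u 1 = (Poly_Mapping.single (l # u) 1 :: ('a, 'b) tensor_alg)" for l u
      by (simp add: gen_def mult_single plus_list_def)
    have "(\<Sum>u | length u = k. (\<Sum>l\<in>UNIV. \<tau> (l # (u @ w)) * gen l) * Poly_Mapping.single u 1) =
        (\<Sum>u | length u = k. \<Sum>l\<in>UNIV. \<tau> (l # (u @ w)) * Poly_Mapping.single (l # u) 1)"
      by (simp add: sum_distrib_right mult.assoc s)
    also have "\<dots> = (\<Sum>l\<in>UNIV. \<Sum>u | length u = k. \<tau> (l # (u @ w)) * Poly_Mapping.single (l # u) 1)"
      by (rule sum.swap)
    also have "\<dots> = (\<Sum>u | length u = Suc k. \<tau> (u @ w) * Poly_Mapping.single u 1)"
      by (simp add: sum_words_Suc)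
    finally show "(\<Sum>u | length u = k. (\<Sum>l\<in>UNIV. \<tau> (l # (u @ w)) * gen l) * Poly_Mapping.single u 1) =
        (\<Sum>u | length u = Suc k. \<tau> (u @ w) * Poly_Mapping.single u 1)" .
  qed
  finally show ?case .
qed

text \<open>Minimality of the Koszul complex: after \<open>k \<ge> 1\<close> steps each coefficient
  is a sum of products ending in a word of length \<open>k\<close>, hence has no constant
  term.\<close>

lemma koszul_d_power_augmentation:
  assumes "\<And>w. t w \<in> carrier (hom_alg R)" "k \<ge> 1"
  shows "(koszul_d R ^^ k) t w \<in> augmentation_ideal R"
proof -
  obtain \<tau> where \<tau>: "t = (\<lambda>w. cls R (\<tau> w))" using assms(1) by (rule representative)
  have "Poly_Mapping.lookup (\<Sum>u | length u = k. \<tau> (u @ w) * Poly_Mapping.single u 1) [] = 0"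
  proof -
    have "\<tau> (u @ w) * Poly_Mapping.single u 1 \<in> words_ge 1" if "length u = k" for u
      using that assms(2) by (intro words_ge_mult) (auto simp: words_ge_def lookup_single when_def)
    then show ?thesis unfolding words_ge_1_iff by (simp add: lookup_sum)
  qed
  then show ?thesis unfolding \<tau> koszul_d_power_cls augmentation_ideal_def
    by (intro imageI) (simp only: words_ge_1_iff)
qed

text \<open>Linearity is visible in the closed formula for the power; only that it lands in A
  \<otimes> V' has to be supplied.\<close>

lemma koszul_d_power_hom:
  fixes R V V' :: "('q::finite, 'k::field) tensor_alg set"
  assumes "\<And>t. t \<in> tensor (hom_alg R) V \<Longrightarrow> (koszul_d R ^^ k) t \<in> tensor (hom_alg R) V'"
  shows "koszul_d R ^^ k \<in> lmod_hom (hom_alg R) (tensor_module R V) (tensor_module R V')"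
proof (rule lmod_homI)
  fix s assume "s \<in> carrier (tensor_module R V)"
  then have st: "s \<in> tensor (hom_alg R) V" by simp
  obtain \<sigma> where \<sigma>: "s = (\<lambda>w. cls R (\<sigma> w))" using tensor_value[OF st] by (rule representative)
  show "(koszul_d R ^^ k) s \<in> carrier (tensor_module R V')" using assms[OF st] by simp
  {
    fix t assume "t \<in> carrier (tensor_module R V)"
    then have tt: "t \<in> tensor (hom_alg R) V" by simp
    obtain \<tau> where \<tau>: "t = (\<lambda>w. cls R (\<tau> w))" using tensor_value[OF tt] by (rule representative)
    show "(koszul_d R ^^ k) (s \<oplus>\<^bsub>tensor_module R V\<^esub> t) =
        (koszul_d R ^^ k) s \<oplus>\<^bsub>tensor_module R V'\<^esub> (koszul_d R ^^ k) t"
      by (simp add: \<sigma> \<tau> cls_add koszul_d_power_cls distrib_right sum.distrib)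
  next
    fix a assume "a \<in> carrier (hom_alg R)"
    then obtain b where b: "a = cls R b" by (rule hom_alg_cases)
    show "(koszul_d R ^^ k) (a \<odot>\<^bsub>tensor_module R V\<^esub> s) =
        a \<odot>\<^bsub>tensor_module R V'\<^esub> (koszul_d R ^^ k) s"
      by (simp add: \<sigma> b cls_mult koszul_d_power_cls sum_distrib_left mult.assoc)
  }
qed

section \<open>The augmented Koszul complex and its exactness\<close>

definition koszul_degree :: "nat \<Rightarrow> nat \<Rightarrow> nat" where
  "koszul_degree N m = (if even m then N * (m div 2) else N * (m div 2) + 1)"

definition koszul_module ::
  "nat \<Rightarrow> ('q::finite, 'k::field) tensor_alg set \<Rightarrow> nat \<Rightarrow>
    (('q, 'k) tensor_alg set, ('q, 'k) universe) module" where
  "koszul_module N R m = tensor_module R (koszul_space N R (koszul_degree N m))"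

definition augmentation ::
  "('q, 'k::field) tensor_alg set \<Rightarrow> ('q, 'k) universe \<Rightarrow> ('q, 'k) tensor_alg set set" where
  "augmentation R t = augmentation_ideal R +>\<^bsub>regular_module (hom_alg R)\<^esub> t []"

lemma carrier_koszul_module: "carrier (koszul_module N R m) = koszul_complex N R m"
  by (simp add: koszul_module_def koszul_complex_def koszul_degree_def)

locale homogeneous_relations =
  fixes N :: nat and R :: "('q::finite, 'k::field) tensor_alg set"
  assumes N_ge_2: "N \<ge> 2" and subspace_R: "tensor_alg.subspace R" and R_tensor_power: "R \<subseteq> tensor_power N"
begin

lemma koszul_space_low: "n < N \<Longrightarrow> koszul_space N R n = tensor_power n"
  by (simp add: koszul_space_def)

lemma koszul_diff_power: "koszul_diff N R m = koszul_d R ^^ (if even m then N - 1 else 1)"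
  by (simp add: koszul_diff_def)

lemma koszul_diff_augmentation:
  assumes "\<And>w. t w \<in> carrier (hom_alg R)"
  shows "koszul_diff N R m t w \<in> augmentation_ideal R"
  unfolding koszul_diff_power using assms N_ge_2 by (intro koszul_d_power_augmentation) auto

lemma projective_koszul_module: "projective_lmod (hom_alg R) (koszul_module N R m)"
  unfolding koszul_module_def
  using subspace_koszul_space koszul_space_tensor_power[OF R_tensor_power] by (rule projective_tensor_module)

lemma augmentation_hom: "augmentation R \<in> lmod_hom (hom_alg R) (koszul_module N R 0) (trivial_module R)"
proof -
  interpret B: left_submodule "hom_alg R" "regular_module (hom_alg R)" "augmentation_ideal R"
    by (rule left_submodule_augmentation_ideal)
  have "(\<lambda>t. t []) \<in> lmod_hom (hom_alg R) (koszul_module N R 0) (regular_module (hom_alg R))"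
    by (rule lmod_homI) (simp_all add: koszul_module_def tensor_value)
  then show ?thesis
    unfolding augmentation_def trivial_module_eq using B.coset_hom by (rule lmod_hom_comp)
qed

text \<open>The definition of \<open>koszul\<close> places boundaries inside the complex only in
  homological degrees at least 1; that the last differential lands in degree 0 is checked by
  supports.\<close>

lemma koszul_diff_1_closed:
  assumes "t \<in> koszul_complex N R 1"
  shows "koszul_diff N R 1 t \<in> koszul_complex N R 0"
proof -
  have t: "t \<in> tensor (hom_alg R) (tensor_power 1)"
    using assms N_ge_2 by (simp add: koszul_complex_def koszul_space_low)
  obtain \<tau> where \<tau>: "t = (\<lambda>w. cls R (\<tau> w))" using tensor_value[OF t] by (rule representative)
  interpret ring "hom_alg R" by (rule ring_hom_alg)
  have "koszul_d R t \<in> tensor (hom_alg R) (tensor_power 0)"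
  proof (rule tensor_tensor_powerI)
    show "koszul_d R t w \<in> carrier (hom_alg R)" for w by (simp add: \<tau> koszul_d_cls)
    fix w :: "'q list" assume "length w \<noteq> 0"
    then have "t (l # w) = \<zero>\<^bsub>hom_alg R\<^esub>" for l
      by (intro tensor_support[OF t order_refl]) simp
    then show "koszul_d R t w = \<zero>\<^bsub>hom_alg R\<^esub>" by (simp add: koszul_d_def)
  qed
  then show ?thesis using N_ge_2 by (simp add: koszul_complex_def koszul_space_low koszul_diff_def)
qed

lemma augmentation_exact:
  "{t \<in> koszul_complex N R 0. augmentation R t = \<zero>\<^bsub>trivial_module R\<^esub>} =
    koszul_diff N R 1 ` koszul_complex N R 1"
proof -
  interpret A: ring "hom_alg R" by (rule ring_hom_alg)
  interpret B: left_submodule "hom_alg R" "regular_module (hom_alg R)" "augmentation_ideal R"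
    by (rule left_submodule_augmentation_ideal)
  have c0: "koszul_complex N R 0 = tensor (hom_alg R) (tensor_power 0)"
    and c1: "koszul_complex N R 1 = tensor (hom_alg R) (tensor_power 1)"
    using N_ge_2 by (simp_all add: koszul_complex_def koszul_space_low)
  have aug: "augmentation R t = \<zero>\<^bsub>trivial_module R\<^esub> \<longleftrightarrow> t [] \<in> augmentation_ideal R"
    if "t \<in> koszul_complex N R 0" for t
    using that unfolding augmentation_def trivial_module_eq
    by (intro B.coset_eq_zero_iff) (simp add: c0 tensor_value)
  show ?thesis
  proof (intro equalityI subsetI)
    fix t assume "t \<in> {t \<in> koszul_complex N R 0. augmentation R t = \<zero>\<^bsub>trivial_module R\<^esub>}"
    then have t: "t \<in> tensor (hom_alg R) (tensor_power 0)" and t0: "t [] \<in> augmentation_ideal R"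
      using aug by (auto simp: c0)
    from t0 obtain p where p: "t [] = cls R p" "p \<in> words_ge 1" by (auto simp: augmentation_ideal_def)
    \<comment> \<open>A preimage of \<open>t\<close>: strip the last letter of \<open>p\<close> and
      keep that letter as the tensor factor. Here \<open>hd w\<close> is the only letter of a word
      of length 1.\<close>
    define s where "s w = cls R (if length w = 1 then strip_right (hd w) p else 0)" for w
    have s: "s \<in> tensor (hom_alg R) (tensor_power 1)"
      by (rule tensor_tensor_powerI) (simp_all add: s_def cls_zero)
    \<comment> \<open>An element without constant term is recovered by splitting its words at the
      last letter.\<close>
    have pe: "(\<Sum>l\<in>UNIV. strip_right l p * gen l) = p"
    proof (rule poly_mapping_eqI)
      fix w
      show "Poly_Mapping.lookup (\<Sum>l\<in>UNIV. strip_right l p * gen l) w = Poly_Mapping.lookup p w"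
      proof (cases w rule: rev_cases)
        case Nil
        have "strip_right l p * gen l \<in> words_ge 1" for l
          by (intro words_ge_mult) (auto simp: words_ge_def gen_def lookup_single when_def)
        then show ?thesis using p(2) unfolding words_ge_1_iff by (simp add: Nil lookup_sum)
      next
        case (snoc v k)
        have "Poly_Mapping.lookup (strip_right l p * gen l) w =
            (if l = k then Poly_Mapping.lookup p w else 0)" for l
          using lookup_mult_single[of "[l]" "[k]" "strip_right l p" 1 v]
          by (simp add: snoc gen_def lookup_strip_right)
        then show ?thesis by (simp add: lookup_sum)
      qed
    qed
    have "koszul_d R s = t"
    proof
      fix w
      show "koszul_d R s w = t w"
      proof (cases "w = []")
        case True
        then show ?thesis unfolding s_def koszul_d_cls by (simp add: pe p(1))
      next
        case False
        then have "t w = \<zero>\<^bsub>hom_alg R\<^esub>" by (intro tensor_support[OF t order_refl]) simp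
        then show ?thesis using False unfolding s_def koszul_d_cls by (simp add: cls_zero)
      qed
    qed
    then have "t = koszul_diff N R 1 s" by (simp add: koszul_diff_def)
    moreover have "s \<in> koszul_complex N R 1" unfolding c1 by (rule s)
    ultimately show "t \<in> koszul_diff N R 1 ` koszul_complex N R 1" by (rule image_eqI)
  next
    fix t assume "t \<in> koszul_diff N R 1 ` koszul_complex N R 1"
    then obtain s where s: "s \<in> koszul_complex N R 1" "t = koszul_diff N R 1 s" by (elim imageE)
    have "t \<in> koszul_complex N R 0" using koszul_diff_1_closed[OF s(1)] s(2) by simp
    moreover have "s w \<in> carrier (hom_alg R)" for w
      using s(1) unfolding c1 by (rule tensor_value)
    then have "t [] \<in> augmentation_ideal R" unfolding s(2) by (rule koszul_diff_augmentation)
    ultimately show "t \<in> {t \<in> koszul_complex N R 0. augmentation R t = \<zero>\<^bsub>trivial_module R\<^esub>}"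
      using aug by simp
  qed
qed

lemma augmentation_surj: "augmentation R ` koszul_complex N R 0 = carrier (trivial_module R)"
proof -
  interpret A: ring "hom_alg R" by (rule ring_hom_alg)
  interpret B: left_submodule "hom_alg R" "regular_module (hom_alg R)" "augmentation_ideal R"
    by (rule left_submodule_augmentation_ideal)
  have c0: "koszul_complex N R 0 = tensor (hom_alg R) (tensor_power 0)"
    using N_ge_2 by (simp add: koszul_complex_def koszul_space_low)
  show ?thesis
  proof (intro equalityI subsetI)
    fix y assume "y \<in> augmentation R ` koszul_complex N R 0"
    then show "y \<in> carrier (trivial_module R)"
      using lmod_hom_closed[OF augmentation_hom] by (auto simp: carrier_koszul_module)
  next
    fix y assume "y \<in> carrier (trivial_module R)"
    then obtain a where a: "a \<in> carrier (hom_alg R)"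
      "y = augmentation_ideal R +>\<^bsub>regular_module (hom_alg R)\<^esub> a"
      unfolding trivial_module_eq by (auto elim: B.quotient_cases)
    have "(\<lambda>w. if w = [] then a else \<zero>\<^bsub>hom_alg R\<^esub>) \<in> koszul_complex N R 0"
      unfolding c0 by (rule tensor_tensor_powerI) (simp_all add: a(1))
    then show "y \<in> augmentation R ` koszul_complex N R 0"
      by (rule rev_image_eqI) (simp add: augmentation_def a(2))
  qed
qed

end

locale koszul_relations = homogeneous_relations N R
  for N :: nat and R :: "('q::finite, 'k::field) tensor_alg set" +
  assumes koszul: "koszul N R"
begin

lemma koszul_exact:
  "{t \<in> koszul_complex N R (Suc n). koszul_diff N R (Suc n) t = (\<lambda>w. \<zero>\<^bsub>hom_alg R\<^esub>)} =
    koszul_diff N R (Suc (Suc n)) ` koszul_complex N R (Suc (Suc n))"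
  using koszul[unfolded koszul_def, rule_format, of "Suc n"] by simp

text \<open>Well-definedness into degrees n \<ge> 1 is extracted from exactness: the image of the
  differential equals a kernel, which by definition lies in the complex.\<close>

lemma koszul_diff_hom:
  "koszul_diff N R (Suc n) \<in> lmod_hom (hom_alg R) (koszul_module N R (Suc n)) (koszul_module N R n)"
  unfolding koszul_module_def koszul_diff_power
proof (rule koszul_d_power_hom)
  fix t assume "t \<in> tensor (hom_alg R) (koszul_space N R (koszul_degree N (Suc n)))"
  then have t: "t \<in> koszul_complex N R (Suc n)" by (simp add: koszul_complex_def koszul_degree_def)
  have "koszul_diff N R (Suc n) t \<in> koszul_complex N R n"
  proof (cases n)
    case 0
    then show ?thesis using koszul_diff_1_closed t by simp
  next
    case (Suc m)
    have "koszul_diff N R (Suc n) t \<in> koszul_diff N R (Suc (Suc m)) ` koszul_complex N R (Suc (Suc m))"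
      using t unfolding Suc by (rule imageI)
    then show ?thesis unfolding koszul_exact[symmetric] by (simp add: Suc)
  qed
  then show "(koszul_d R ^^ (if even (Suc n) then N - 1 else 1)) t
      \<in> tensor (hom_alg R) (koszul_space N R (koszul_degree N n))"
    unfolding koszul_diff_power by (simp add: koszul_complex_def koszul_degree_def)
qed

lemma koszul_projective_resolution:
  "projective_resolution (hom_alg R) (trivial_module R) (koszul_module N R)
    (\<lambda>n. koszul_diff N R (Suc n)) (augmentation R)"
proof -
  have z: "\<zero>\<^bsub>koszul_module N R n\<^esub> = (\<lambda>w. \<zero>\<^bsub>hom_alg R\<^esub>)" for n by (simp add: koszul_module_def)
  show ?thesis
    unfolding projective_resolution_def carrier_koszul_module z
    using projective_koszul_module augmentation_hom koszul_diff_hom augmentation_surj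
      augmentation_exact koszul_exact
    by simp
qed

end

section \<open>Vanishing of the Koszul complex above the global dimension\<close>

lemma left_module_trivial_module: "left_module (hom_alg R) (trivial_module R)"
  unfolding trivial_module_eq
  by (rule left_submodule.left_module_quotient[OF left_submodule_augmentation_ideal])

lemma lookup_tscale_one: "Poly_Mapping.lookup (tscale c (1 :: ('q, 'k::field) tensor_alg)) [] = c"
  by (simp add: lookup_tscale lookup_one zero_list_def)

context koszul_relations
begin

text \<open>The identity of the degree-four term of the complex is homotopic to a map that vanishes on the
  generators in lowest degree, whereas both differentials have coefficients in the augmentation ideal.\<close>

lemma koszul_space_2N:
  assumes "has_global_dimension R 3"
  shows "koszul_space N R (2 * N) = {0}"
proof -
  let ?A = "hom_alg R" and ?F = "koszul_module N R"
  let ?d = "\<lambda>n. koszul_diff N R (Suc n)"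
  have "\<exists>P \<delta> \<epsilon>. projective_resolution ?A (trivial_module R) (P :: nat \<Rightarrow> (_, ('q, 'k) universe) module) \<delta> \<epsilon> \<and>
        (\<forall>n > 3. carrier (P n) = {\<zero>\<^bsub>P n\<^esub>})"
    using assms unfolding has_global_dimension_def has_projective_dimension_def
      has_projective_resolution_of_length_def by (rule conjunct1)
  then obtain P \<delta> \<epsilon> where P: "projective_resolution ?A (trivial_module R) (P :: nat \<Rightarrow> (_, ('q, 'k) universe) module) \<delta> \<epsilon>"
    and len: "\<forall>n > 3. carrier (P n) = {\<zero>\<^bsub>P n\<^esub>}" by (elim exE conjE)
  have len4: "carrier (P (Suc (Suc 2))) = {\<zero>\<^bsub>P (Suc (Suc 2))\<^esub>}" using len by simp
  have "\<exists>h \<in> lmod_hom ?A (?F (Suc 2)) (?F (Suc (Suc 2))). \<forall>x \<in> carrier (?F (Suc (Suc 2))).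
      x \<ominus>\<^bsub>?F (Suc (Suc 2))\<^esub> h (?d (Suc 2) x) \<in> ?d (Suc (Suc 2)) ` carrier (?F (Suc (Suc (Suc 2))))"
    using P koszul_projective_resolution left_module_trivial_module len4
    by (rule resolution_retract_above_length)
  then obtain h where h: "h \<in> lmod_hom ?A (?F 3) (?F 4)"
    and hx: "\<forall>x \<in> carrier (?F 4). x \<ominus>\<^bsub>?F 4\<^esub> h (?d 3 x) \<in> ?d 4 ` carrier (?F 5)"
    by (elim bexE) (simp add: numeral_eq_Suc)
  interpret A: ring ?A by (rule ring_hom_alg)
  interpret F4: left_module ?A "?F 4" unfolding koszul_module_def by (rule left_module_tensor_module)
  interpret B: left_submodule ?A "regular_module ?A" "augmentation_ideal R"
    by (rule left_submodule_augmentation_ideal)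
  have deg: "koszul_degree N 4 = 2 * N" by (simp add: koszul_degree_def)
  have "k = 0" if k: "k \<in> koszul_space N R (2 * N)" for k
  proof (rule poly_mapping_eqI)
    fix w
    define x where "x = pure_tensor R 1 k"
    have xt: "x \<in> tensor ?A (koszul_space N R (2 * N))" unfolding x_def using k by (rule pure_tensor_closed)
    have x: "x \<in> carrier (?F 4)" using xt by (simp add: koszul_module_def deg)
    have dx: "?d 3 x \<in> carrier (?F 3)" using koszul_diff_hom[of 3] x by (simp add: lmod_hom_def Pi_def)
    have hdx: "h (?d 3 x) \<in> carrier (?F 4)" using h dx by (rule lmod_hom_closed)
    have "?d 3 x v \<in> augmentation_ideal R" for v
      using tensor_value[OF xt] by (rule koszul_diff_augmentation)
    with subspace_koszul_space koszul_space_tensor_power[OF R_tensor_power]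
      dx[unfolded koszul_module_def tensor_module_simps(1)] h[unfolded koszul_module_def]
    have 1: "h (?d 3 x) w \<in> augmentation_ideal R" by (rule tensor_hom_augmentation)
    obtain z where z: "z \<in> carrier (?F 5)" "x \<ominus>\<^bsub>?F 4\<^esub> h (?d 3 x) = ?d 4 z"
      using hx[rule_format, OF x] by (elim imageE)
    have "z v \<in> carrier ?A" for v using z(1) by (simp add: koszul_module_def tensor_value)
    then have 2: "?d 4 z w \<in> augmentation_ideal R" by (rule koszul_diff_augmentation)
    \<comment> \<open>Splits 1 \<otimes> k into a boundary and a value of \<open>h\<close> on a
      boundary. Both have coefficients in the augmentation ideal, whereas those of 1 \<otimes> k are
      the scalar coefficients of \<open>k\<close>, which must therefore vanish.\<close>
    have "x = (x \<ominus>\<^bsub>?F 4\<^esub> h (?d 3 x)) \<oplus>\<^bsub>?F 4\<^esub> h (?d 3 x)"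
      using x hdx by (simp add: a_minus_def F4.M.a_assoc F4.M.l_neg)
    then have "x = ?d 4 z \<oplus>\<^bsub>?F 4\<^esub> h (?d 3 x)" unfolding z(2) .
    then have "x w = ?d 4 z w \<oplus>\<^bsub>?A\<^esub> h (?d 3 x) w"
      unfolding koszul_module_def tensor_module_simps(3) by (rule fun_cong)
    then have "x w \<in> augmentation_ideal R" using B.sub_add[OF 2 1] by simp
    then have "cls R (tscale (Poly_Mapping.lookup k w) 1) \<in> augmentation_ideal R"
      by (simp add: x_def pure_tensor_def)
    then show "Poly_Mapping.lookup k w = Poly_Mapping.lookup 0 w"
      using cls_augmentation_ideal[OF R_tensor_power] N_ge_2 by (simp add: lookup_tscale_one)
  qed
  then show ?thesis using tensor_alg.subspace_0[OF subspace_koszul_space] by auto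
qed

end

section \<open>Ext of a resolution\<close>

lemma hom_scalar:
  shows hom_scalar_closed: "c \<odot>\<^bsub>hom_alg R\<^esub> \<one>\<^bsub>hom_alg R\<^esub> \<in> carrier (hom_alg R)"
    and hom_scalar_add: "(c + d) \<odot>\<^bsub>hom_alg R\<^esub> \<one>\<^bsub>hom_alg R\<^esub> =
      c \<odot>\<^bsub>hom_alg R\<^esub> \<one>\<^bsub>hom_alg R\<^esub> \<oplus>\<^bsub>hom_alg R\<^esub> d \<odot>\<^bsub>hom_alg R\<^esub> \<one>\<^bsub>hom_alg R\<^esub>"
    and hom_scalar_mult: "(c * d) \<odot>\<^bsub>hom_alg R\<^esub> \<one>\<^bsub>hom_alg R\<^esub> =
      (c \<odot>\<^bsub>hom_alg R\<^esub> \<one>\<^bsub>hom_alg R\<^esub>) \<otimes>\<^bsub>hom_alg R\<^esub> (d \<odot>\<^bsub>hom_alg R\<^esub> \<one>\<^bsub>hom_alg R\<^esub>)"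
    and hom_scalar_one: "1 \<odot>\<^bsub>hom_alg R\<^esub> \<one>\<^bsub>hom_alg R\<^esub> = \<one>\<^bsub>hom_alg R\<^esub>"
    and hom_scalar_zero: "0 \<odot>\<^bsub>hom_alg R\<^esub> \<one>\<^bsub>hom_alg R\<^esub> = \<zero>\<^bsub>hom_alg R\<^esub>"
  by (simp_all add: hom_alg_ops tensor_alg.scale_left_distrib tscale_mult_left)

text \<open>Scalars act on homomorphisms through their image in the algebra; centrality makes the
  scaled map linear again.\<close>

lemma hom_scalar_central:
  assumes "a \<in> carrier (hom_alg R)"
  shows "(c \<odot>\<^bsub>hom_alg R\<^esub> \<one>\<^bsub>hom_alg R\<^esub>) \<otimes>\<^bsub>hom_alg R\<^esub> a = a \<otimes>\<^bsub>hom_alg R\<^esub> (c \<odot>\<^bsub>hom_alg R\<^esub> \<one>\<^bsub>hom_alg R\<^esub>)"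
proof -
  from assms obtain p where "a = cls R p" by (rule hom_alg_cases)
  then show ?thesis by (simp add: hom_alg_ops tscale_mult_left tscale_mult_right)
qed

lemma Hom_space_simps [simp]:
  "carrier (Hom_space A M N) = lmod_hom A M N \<inter> extensional (carrier M)"
  "\<zero>\<^bsub>Hom_space A M N\<^esub> = (\<lambda>x \<in> carrier M. \<zero>\<^bsub>N\<^esub>)"
  "f \<oplus>\<^bsub>Hom_space A M N\<^esub> g = (\<lambda>x \<in> carrier M. f x \<oplus>\<^bsub>N\<^esub> g x)"
  "c \<odot>\<^bsub>Hom_space A M N\<^esub> f = (\<lambda>x \<in> carrier M. (c \<odot>\<^bsub>A\<^esub> \<one>\<^bsub>A\<^esub>) \<odot>\<^bsub>N\<^esub> f x)"
  by (simp_all add: Hom_space_def)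

lemma restrict_hom:
  assumes "f \<in> lmod_hom A M N" "left_module A M"
  shows "restrict f (carrier M) \<in> carrier (Hom_space A M N)"
proof -
  interpret left_module A M by fact
  show ?thesis using assms(1) by (auto intro!: lmod_homI simp: lmod_homD lsmult_closed)
qed

lemma Hom_space_closed:
  assumes M: "left_module (hom_alg R) M" and N: "left_module (hom_alg R) N"
  shows Hom_space_zero_closed: "\<zero>\<^bsub>Hom_space (hom_alg R) M N\<^esub> \<in> carrier (Hom_space (hom_alg R) M N)"
    and Hom_space_add_closed: "f \<in> carrier (Hom_space (hom_alg R) M N) \<Longrightarrow> g \<in> carrier (Hom_space (hom_alg R) M N) \<Longrightarrow>
      f \<oplus>\<^bsub>Hom_space (hom_alg R) M N\<^esub> g \<in> carrier (Hom_space (hom_alg R) M N)"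
    and Hom_space_smult_closed: "f \<in> carrier (Hom_space (hom_alg R) M N) \<Longrightarrow>
      c \<odot>\<^bsub>Hom_space (hom_alg R) M N\<^esub> f \<in> carrier (Hom_space (hom_alg R) M N)"
proof -
  interpret M: left_module "hom_alg R" M by fact
  interpret N: left_module "hom_alg R" N by fact
  have "(\<lambda>x. \<zero>\<^bsub>N\<^esub>) \<in> lmod_hom (hom_alg R) M N"
    by (rule lmod_homI) (simp_all add: N.lsmult_r_null)
  then show "\<zero>\<^bsub>Hom_space (hom_alg R) M N\<^esub> \<in> carrier (Hom_space (hom_alg R) M N)"
    unfolding Hom_space_simps(2) using M by (rule restrict_hom)
  show "f \<oplus>\<^bsub>Hom_space (hom_alg R) M N\<^esub> g \<in> carrier (Hom_space (hom_alg R) M N)"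
    if "f \<in> carrier (Hom_space (hom_alg R) M N)" "g \<in> carrier (Hom_space (hom_alg R) M N)"
  proof -
    have f: "f \<in> lmod_hom (hom_alg R) M N" and g: "g \<in> lmod_hom (hom_alg R) M N" using that by simp_all
    have "(\<lambda>x. f x \<oplus>\<^bsub>N\<^esub> g x) \<in> lmod_hom (hom_alg R) M N"
      by (rule lmod_homI)
        (simp_all add: lmod_homD[OF f] lmod_homD[OF g] N.lsmult_r_distr N.M.a_ac)
    then show ?thesis unfolding Hom_space_simps(3) using M by (rule restrict_hom)
  qed
  show "c \<odot>\<^bsub>Hom_space (hom_alg R) M N\<^esub> f \<in> carrier (Hom_space (hom_alg R) M N)"
    if "f \<in> carrier (Hom_space (hom_alg R) M N)"
  proof -
    have f: "f \<in> lmod_hom (hom_alg R) M N" using that by simp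
    let ?c = "c \<odot>\<^bsub>hom_alg R\<^esub> \<one>\<^bsub>hom_alg R\<^esub>"
    have "(\<lambda>x. ?c \<odot>\<^bsub>N\<^esub> f x) \<in> lmod_hom (hom_alg R) M N"
    proof (rule lmod_homI)
      show "?c \<odot>\<^bsub>N\<^esub> f x \<in> carrier N" if "x \<in> carrier M" for x
        using hom_scalar_closed lmod_hom_closed[OF f that] by (rule N.lsmult_closed)
      show "?c \<odot>\<^bsub>N\<^esub> f (x \<oplus>\<^bsub>M\<^esub> y) = ?c \<odot>\<^bsub>N\<^esub> f x \<oplus>\<^bsub>N\<^esub> ?c \<odot>\<^bsub>N\<^esub> f y"
        if "x \<in> carrier M" "y \<in> carrier M" for x y
        unfolding lmod_hom_add[OF f that]
        using hom_scalar_closed lmod_hom_closed[OF f that(1)] lmod_hom_closed[OF f that(2)]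
        by (rule N.lsmult_r_distr)
      show "?c \<odot>\<^bsub>N\<^esub> f (a \<odot>\<^bsub>M\<^esub> x) = a \<odot>\<^bsub>N\<^esub> (?c \<odot>\<^bsub>N\<^esub> f x)"
        if "a \<in> carrier (hom_alg R)" "x \<in> carrier M" for a x
        unfolding lmod_hom_smult[OF f that]
        using hom_scalar_closed[of R c] lmod_hom_closed[OF f that(2)] that(1)
        by (simp add: N.lsmult_assoc[symmetric] hom_scalar_central)
    qed
    then show ?thesis unfolding Hom_space_simps(4) using M by (rule restrict_hom)
  qed
qed

text \<open>Stated for an arbitrary closed subset \<open>C\<close> so that it applies to cocycles.
  Homomorphisms are \<open>undefined\<close> off the carrier, so equality of maps is checked
  separately there.\<close>

lemma left_module_Hom_space:
  fixes R :: "('q, 'k::field) tensor_alg set" and C :: "('m \<Rightarrow> 'n) set"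
  assumes M: "left_module (hom_alg R) M" and N: "left_module (hom_alg R) N"
    and C: "C \<subseteq> carrier (Hom_space (hom_alg R) M N)" "\<zero>\<^bsub>Hom_space (hom_alg R) M N\<^esub> \<in> C"
      "\<And>f g. f \<in> C \<Longrightarrow> g \<in> C \<Longrightarrow> f \<oplus>\<^bsub>Hom_space (hom_alg R) M N\<^esub> g \<in> C"
      "\<And>c f. f \<in> C \<Longrightarrow> c \<odot>\<^bsub>Hom_space (hom_alg R) M N\<^esub> f \<in> C"
  shows "left_module (ring_of_type_algebra :: 'k ring) (Hom_space (hom_alg R) M N \<lparr>carrier := C\<rparr>)"
    (is "left_module _ ?H")
proof -
  interpret M: left_module "hom_alg R" M by fact
  interpret N: left_module "hom_alg R" N by fact
  let ?s = "\<lambda>c. c \<odot>\<^bsub>hom_alg R\<^esub> \<one>\<^bsub>hom_alg R\<^esub>"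
  have v: "f x \<in> carrier N" if "f \<in> C" "x \<in> carrier M" for f x
    using that C(1) by (auto intro: lmod_hom_closed)
  have u: "f x = undefined" if "f \<in> C" "x \<notin> carrier M" for f x
    using that C(1) by (auto intro: extensional_arb)
  note sc = hom_scalar_closed[of R]
  show ?thesis
  proof (intro left_module.intro left_module_axioms.intro ring_ring_of_type_algebra abelian_groupI)
    fix f assume "f \<in> carrier ?H"
    then have f: "f \<in> C" by simp
    show "\<zero>\<^bsub>?H\<^esub> \<oplus>\<^bsub>?H\<^esub> f = f" "\<one>\<^bsub>ring_of_type_algebra\<^esub> \<odot>\<^bsub>?H\<^esub> f = f"
      using v[OF f] u[OF f] by (auto simp: fun_eq_iff restrict_def hom_scalar_one N.lsmult_one)
    have "(- 1) \<odot>\<^bsub>?H\<^esub> f \<oplus>\<^bsub>?H\<^esub> f = \<zero>\<^bsub>?H\<^esub>"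
    proof -
      have "?s (- 1) \<odot>\<^bsub>N\<^esub> y \<oplus>\<^bsub>N\<^esub> y = \<zero>\<^bsub>N\<^esub>" if "y \<in> carrier N" for y
      proof -
        have e: "?s (- 1) \<oplus>\<^bsub>hom_alg R\<^esub> \<one>\<^bsub>hom_alg R\<^esub> = \<zero>\<^bsub>hom_alg R\<^esub>"
          using hom_scalar_add[where c = "- 1" and d = 1 and R = R] by (simp add: hom_scalar_one hom_scalar_zero)
        have "?s (- 1) \<odot>\<^bsub>N\<^esub> y \<oplus>\<^bsub>N\<^esub> y = (?s (- 1) \<oplus>\<^bsub>hom_alg R\<^esub> \<one>\<^bsub>hom_alg R\<^esub>) \<odot>\<^bsub>N\<^esub> y"
          using N.lsmult_l_distr[OF sc M.R.one_closed that] that by (simp add: N.lsmult_one)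
        then show ?thesis using that by (simp add: e N.lsmult_l_null)
      qed
      then show ?thesis using v[OF f] by (auto simp: fun_eq_iff restrict_def)
    qed
    then show "\<exists>g\<in>carrier ?H. g \<oplus>\<^bsub>?H\<^esub> f = \<zero>\<^bsub>?H\<^esub>"
      using C(4)[OF f] by (intro bexI[of _ "(- 1) \<odot>\<^bsub>?H\<^esub> f"]) simp_all
    fix c :: 'k
    show "c \<odot>\<^bsub>?H\<^esub> f \<in> carrier ?H" using C(4)[OF f] by simp
    fix d :: 'k
    show "(c \<oplus>\<^bsub>ring_of_type_algebra\<^esub> d) \<odot>\<^bsub>?H\<^esub> f = c \<odot>\<^bsub>?H\<^esub> f \<oplus>\<^bsub>?H\<^esub> d \<odot>\<^bsub>?H\<^esub> f"
      using N.lsmult_l_distr[OF sc sc v[OF f]] by (auto simp: fun_eq_iff restrict_def hom_scalar_add)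
    show "(c \<otimes>\<^bsub>ring_of_type_algebra\<^esub> d) \<odot>\<^bsub>?H\<^esub> f = c \<odot>\<^bsub>?H\<^esub> (d \<odot>\<^bsub>?H\<^esub> f)"
      using N.lsmult_assoc[OF sc sc v[OF f]] by (auto simp: fun_eq_iff restrict_def hom_scalar_mult)
  next
    fix f g assume "f \<in> carrier ?H" "g \<in> carrier ?H"
    then have f: "f \<in> C" and g: "g \<in> C" by simp_all
    show "f \<oplus>\<^bsub>?H\<^esub> g \<in> carrier ?H" using C(3)[OF f g] by simp
    show "f \<oplus>\<^bsub>?H\<^esub> g = g \<oplus>\<^bsub>?H\<^esub> f"
      using N.M.a_comm[OF v[OF f] v[OF g]] by (auto simp: fun_eq_iff restrict_def)
    fix c :: 'k
    show "c \<odot>\<^bsub>?H\<^esub> (f \<oplus>\<^bsub>?H\<^esub> g) = c \<odot>\<^bsub>?H\<^esub> f \<oplus>\<^bsub>?H\<^esub> c \<odot>\<^bsub>?H\<^esub> g"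
      using N.lsmult_r_distr[OF sc v[OF f] v[OF g]] by (auto simp: fun_eq_iff restrict_def)
  next
    fix f g h assume "f \<in> carrier ?H" "g \<in> carrier ?H" "h \<in> carrier ?H"
    then have f: "f \<in> C" and g: "g \<in> C" and h: "h \<in> C" by simp_all
    show "f \<oplus>\<^bsub>?H\<^esub> g \<oplus>\<^bsub>?H\<^esub> h = f \<oplus>\<^bsub>?H\<^esub> (g \<oplus>\<^bsub>?H\<^esub> h)"
      using N.M.a_assoc[OF v[OF f] v[OF g] v[OF h]] by (auto simp: fun_eq_iff restrict_def)
  next
    show "\<zero>\<^bsub>?H\<^esub> \<in> carrier ?H" using C(2) by simp
  qed
qed

section \<open>Cocycles, coboundaries and Ext in positive degrees\<close>

locale ext_resolution =
  fixes R :: "('q, 'k::field) tensor_alg set" and T :: "(('q, 'k) tensor_alg set, 'x) module"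
    and F :: "nat \<Rightarrow> (('q, 'k) tensor_alg set, 'm) module" and d :: "nat \<Rightarrow> 'm \<Rightarrow> 'm" and \<eta> :: "'m \<Rightarrow> 'x"
    and N :: "(('q, 'k) tensor_alg set, 'n) module"
  assumes resolution: "projective_resolution (hom_alg R) T F d \<eta>" and coefficients: "left_module (hom_alg R) N"
begin

abbreviation "Hom n \<equiv> Hom_space (hom_alg R) (F n) N"
abbreviation "Z n \<equiv> cocycles (hom_alg R) F d N n"
abbreviation "B n \<equiv> coboundaries (hom_alg R) F d N n"
abbreviation "ground_ring \<equiv> (ring_of_type_algebra :: 'k ring)"

lemmas resolutionD = projective_resolutionD[OF resolution]

sublocale N: left_module "hom_alg R" N by (rule coefficients)

lemma d_closed: "x \<in> carrier (F (Suc n)) \<Longrightarrow> d n x \<in> carrier (F n)"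
  using resolutionD(5) by (rule lmod_hom_closed)

lemma cocycleI:
  "f \<in> carrier (Hom n) \<Longrightarrow> (\<And>x. x \<in> carrier (F (Suc n)) \<Longrightarrow> f (d n x) = \<zero>\<^bsub>N\<^esub>) \<Longrightarrow> f \<in> Z n"
  by (simp add: cocycles_def)

lemma cocycleD:
  assumes "f \<in> Z n"
  shows "f \<in> carrier (Hom n)" "x \<in> carrier (F (Suc n)) \<Longrightarrow> f (d n x) = \<zero>\<^bsub>N\<^esub>"
  using assms by (simp_all add: cocycles_def)

lemma cocycle_closed:
  shows zero_cocycle: "\<zero>\<^bsub>Hom n\<^esub> \<in> Z n"
    and add_cocycle: "f \<in> Z n \<Longrightarrow> g \<in> Z n \<Longrightarrow> f \<oplus>\<^bsub>Hom n\<^esub> g \<in> Z n"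
    and smult_cocycle: "f \<in> Z n \<Longrightarrow> c \<odot>\<^bsub>Hom n\<^esub> f \<in> Z n"
proof -
  note H = Hom_space_closed[OF resolutionD(2) coefficients]
  show "\<zero>\<^bsub>Hom n\<^esub> \<in> Z n"
    using H(1) by (rule cocycleI) (simp add: d_closed)
  show "f \<oplus>\<^bsub>Hom n\<^esub> g \<in> Z n" if "f \<in> Z n" "g \<in> Z n"
    using H(2)[OF cocycleD(1)[OF that(1)] cocycleD(1)[OF that(2)]]
    by (rule cocycleI) (simp add: d_closed cocycleD(2)[OF that(1)] cocycleD(2)[OF that(2)])
  show "c \<odot>\<^bsub>Hom n\<^esub> f \<in> Z n" if "f \<in> Z n"
    using H(3)[OF cocycleD(1)[OF that]]
    by (rule cocycleI) (simp add: d_closed cocycleD(2)[OF that] N.lsmult_r_null hom_scalar_closed)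
qed

lemma left_module_cocycles: "left_module ground_ring (Hom n \<lparr>carrier := Z n\<rparr>)"
  using resolutionD(2) coefficients
proof (rule left_module_Hom_space)
  show "Z n \<subseteq> carrier (Hom n)" using cocycleD(1) by (rule subsetI)
qed (use cocycle_closed in blast)+

lemma coboundary_Suc: "B (Suc m) = (\<lambda>g. \<lambda>x \<in> carrier (F (Suc m)). g (d m x)) ` carrier (Hom m)"
  by (simp add: coboundaries_def)

lemma coboundary_cocycle: "B (Suc m) \<subseteq> Z (Suc m)"
proof
  fix f assume "f \<in> B (Suc m)"
  then obtain g where g: "g \<in> carrier (Hom m)" and f: "f = (\<lambda>x \<in> carrier (F (Suc m)). g (d m x))"
    unfolding coboundary_Suc by (elim imageE)
  have gh: "g \<in> lmod_hom (hom_alg R) (F m) N" using g by simp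
  show "f \<in> Z (Suc m)"
  proof (rule cocycleI)
    have "(\<lambda>x. g (d m x)) \<in> lmod_hom (hom_alg R) (F (Suc m)) N"
      using resolutionD(5) gh by (rule lmod_hom_comp)
    then show "f \<in> carrier (Hom (Suc m))" unfolding f using resolutionD(2) by (rule restrict_hom)
    fix x assume x: "x \<in> carrier (F (Suc (Suc m)))"
    then show "f (d (Suc m) x) = \<zero>\<^bsub>N\<^esub>"
      using projective_resolution_cycle(2)[OF resolution x]
        lmod_hom_zero[OF gh resolutionD(3) N.M.abelian_group_axioms]
      by (simp add: f d_closed)
  qed
qed

lemma submodule_coboundaries:
  "left_submodule ground_ring (Hom (Suc m) \<lparr>carrier := Z (Suc m)\<rparr>) (B (Suc m))"
proof (intro left_submodule.intro left_submodule_axioms.intro left_module_cocycles)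
  note H = Hom_space_closed[OF resolutionD(2)[of m] coefficients]
  show "B (Suc m) \<subseteq> carrier (Hom (Suc m) \<lparr>carrier := Z (Suc m)\<rparr>)"
    using coboundary_cocycle by simp
  have z: "\<zero>\<^bsub>Hom (Suc m)\<^esub> = (\<lambda>x \<in> carrier (F (Suc m)). \<zero>\<^bsub>Hom m\<^esub> (d m x))"
    by (auto simp: restrict_def d_closed fun_eq_iff)
  then have "\<zero>\<^bsub>Hom (Suc m)\<^esub> \<in> B (Suc m)" unfolding coboundary_Suc using H(1) by (rule image_eqI)
  then show "\<zero>\<^bsub>Hom (Suc m) \<lparr>carrier := Z (Suc m)\<rparr>\<^esub> \<in> B (Suc m)" by simp
  {
    fix f assume "f \<in> B (Suc m)"
    then obtain f' where f': "f' \<in> carrier (Hom m)" and f: "f = (\<lambda>x \<in> carrier (F (Suc m)). f' (d m x))"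
      unfolding coboundary_Suc by (elim imageE)
    {
      fix g assume "g \<in> B (Suc m)"
      then obtain g' where g': "g' \<in> carrier (Hom m)" and g: "g = (\<lambda>x \<in> carrier (F (Suc m)). g' (d m x))"
        unfolding coboundary_Suc by (elim imageE)
      have "f \<oplus>\<^bsub>Hom (Suc m)\<^esub> g = (\<lambda>x \<in> carrier (F (Suc m)). (f' \<oplus>\<^bsub>Hom m\<^esub> g') (d m x))"
        by (auto simp: f g restrict_def d_closed fun_eq_iff)
      then have "f \<oplus>\<^bsub>Hom (Suc m)\<^esub> g \<in> B (Suc m)"
        unfolding coboundary_Suc using H(2)[OF f' g'] by (rule image_eqI)
      then show "f \<oplus>\<^bsub>Hom (Suc m) \<lparr>carrier := Z (Suc m)\<rparr>\<^esub> g \<in> B (Suc m)" by simp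
    next
      fix c :: 'k
      have "c \<odot>\<^bsub>Hom (Suc m)\<^esub> f = (\<lambda>x \<in> carrier (F (Suc m)). (c \<odot>\<^bsub>Hom m\<^esub> f') (d m x))"
        by (auto simp: f restrict_def d_closed fun_eq_iff)
      then have "c \<odot>\<^bsub>Hom (Suc m)\<^esub> f \<in> B (Suc m)"
        unfolding coboundary_Suc using H(3)[OF f'] by (rule image_eqI)
      then show "c \<odot>\<^bsub>Hom (Suc m) \<lparr>carrier := Z (Suc m)\<rparr>\<^esub> f \<in> B (Suc m)" by simp
    }
  }
qed

lemma Ext_eq: "Ext (hom_alg R) F d N n = quotient_module (Hom n \<lparr>carrier := Z n\<rparr>) (B n)"
  by (simp add: Ext_def)

lemma Ext_trivial:
  assumes "carrier (Ext (hom_alg R) F d N (Suc m)) = {\<zero>\<^bsub>Ext (hom_alg R) F d N (Suc m)\<^esub>}"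
    and f: "f \<in> Z (Suc m)"
  shows "f \<in> B (Suc m)"
proof -
  interpret Q: left_submodule ground_ring "Hom (Suc m) \<lparr>carrier := Z (Suc m)\<rparr>" "B (Suc m)"
    by (rule submodule_coboundaries)
  have fc: "f \<in> carrier (Hom (Suc m) \<lparr>carrier := Z (Suc m)\<rparr>)" using f by simp
  show ?thesis
    using Q.coset_closed[OF fc] assms(1) Q.coset_eq_zero_iff[OF fc] unfolding Ext_eq by simp
qed

lemma Ext_one_dimensional:
  assumes "lmod_isomorphic ground_ring (Ext (hom_alg R) F d N (Suc m)) (regular_module ground_ring)"
  shows Ext_one_nontrivial: "\<exists>f \<in> Z (Suc m). f \<notin> B (Suc m)"
    and Ext_one_dependent: "f \<in> Z (Suc m) \<Longrightarrow> g \<in> Z (Suc m) \<Longrightarrow>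
      \<exists>a b. (a \<noteq> 0 \<or> b \<noteq> 0) \<and> a \<odot>\<^bsub>Hom (Suc m)\<^esub> f \<oplus>\<^bsub>Hom (Suc m)\<^esub> b \<odot>\<^bsub>Hom (Suc m)\<^esub> g \<in> B (Suc m)"
proof -
  let ?H = "Hom (Suc m) \<lparr>carrier := Z (Suc m)\<rparr>"
  let ?Q = "quotient_module ?H (B (Suc m))"
  interpret Q: left_submodule ground_ring ?H "B (Suc m)" by (rule submodule_coboundaries)
  interpret QQ: left_module ground_ring ?Q by (rule Q.left_module_quotient)
  interpret KK: left_module ground_ring "regular_module ground_ring"
    by (rule left_module_regular[OF ring_ring_of_type_algebra])
  obtain \<phi> where \<phi>: "\<phi> \<in> lmod_hom ground_ring ?Q (regular_module ground_ring)"
    "bij_betw \<phi> (carrier ?Q) (carrier (regular_module ground_ring))"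
    using assms unfolding Ext_eq lmod_isomorphic_def by (elim bexE)
  have \<phi>0: "\<phi> \<zero>\<^bsub>?Q\<^esub> = 0"
    using lmod_hom_zero[OF \<phi>(1) QQ.M.abelian_group_axioms KK.M.abelian_group_axioms] by simp
  have inj: "x = y" if "x \<in> carrier ?Q" "y \<in> carrier ?Q" "\<phi> x = \<phi> y" for x y
    using bij_betw_imp_inj_on[OF \<phi>(2)] that by (simp add: inj_on_def)
  have "1 \<in> \<phi> ` carrier ?Q" using bij_betw_imp_surj_on[OF \<phi>(2)] by simp
  then obtain x where x: "x \<in> carrier ?Q" "\<phi> x = 1" by (elim imageE) simp
  obtain f where f: "f \<in> carrier ?H" "x = B (Suc m) +>\<^bsub>?H\<^esub> f" using x(1) by (rule Q.quotient_cases)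
  have "f \<notin> B (Suc m)"
  proof
    assume "f \<in> B (Suc m)"
    then have "x = \<zero>\<^bsub>?Q\<^esub>" using Q.coset_eq_zero_iff[OF f(1)] f(2) by simp
    then show False using x(2) \<phi>0 by simp
  qed
  then show "\<exists>f \<in> Z (Suc m). f \<notin> B (Suc m)" using f(1) by auto
  show "\<exists>a b. (a \<noteq> 0 \<or> b \<noteq> 0) \<and> a \<odot>\<^bsub>Hom (Suc m)\<^esub> f \<oplus>\<^bsub>Hom (Suc m)\<^esub> b \<odot>\<^bsub>Hom (Suc m)\<^esub> g \<in> B (Suc m)"
    if "f \<in> Z (Suc m)" "g \<in> Z (Suc m)" for f g
  proof -
    have fc: "f \<in> carrier ?H" and gc: "g \<in> carrier ?H" using that by simp_all
    let ?f = "B (Suc m) +>\<^bsub>?H\<^esub> f" and ?g = "B (Suc m) +>\<^bsub>?H\<^esub> g"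
    \<comment> \<open>A linear relation between the scalars assigned to the two classes: the swapped
      pair with a sign if the first scalar is nonzero, and 1, 0 otherwise, so that the coefficients
      never both vanish.\<close>
    define a b where "a = (if \<phi> ?f = 0 then 1 else \<phi> ?g)" and "b = (if \<phi> ?f = 0 then 0 else - \<phi> ?f)"
    have ab: "a \<noteq> 0 \<or> b \<noteq> 0" and s: "a * \<phi> ?f + b * \<phi> ?g = 0" by (simp_all add: a_def b_def)
    let ?h = "a \<odot>\<^bsub>?H\<^esub> f \<oplus>\<^bsub>?H\<^esub> b \<odot>\<^bsub>?H\<^esub> g"
    have af: "a \<odot>\<^bsub>?H\<^esub> f \<in> carrier ?H" and bg: "b \<odot>\<^bsub>?H\<^esub> g \<in> carrier ?H"
      using Q.lsmult_closed[OF _ fc, of a] Q.lsmult_closed[OF _ gc, of b] by simp_all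
    have h: "?h \<in> carrier ?H" using af bg by (rule Q.M.a_closed)
    have "B (Suc m) +>\<^bsub>?H\<^esub> ?h = a \<odot>\<^bsub>?Q\<^esub> ?f \<oplus>\<^bsub>?Q\<^esub> b \<odot>\<^bsub>?Q\<^esub> ?g"
      using Q.quotient_add[OF af bg] Q.quotient_smult[OF _ fc, of a] Q.quotient_smult[OF _ gc, of b] by simp
    moreover have "\<phi> (a \<odot>\<^bsub>?Q\<^esub> ?f \<oplus>\<^bsub>?Q\<^esub> b \<odot>\<^bsub>?Q\<^esub> ?g) = a * \<phi> ?f + b * \<phi> ?g"
      using Q.coset_closed[OF fc] Q.coset_closed[OF gc] lmod_hom_add[OF \<phi>(1)]
        lmod_hom_smult[OF \<phi>(1)] QQ.lsmult_closed by simp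
    ultimately have "\<phi> (B (Suc m) +>\<^bsub>?H\<^esub> ?h) = \<phi> \<zero>\<^bsub>?Q\<^esub>" using s \<phi>0 by simp
    then have "B (Suc m) +>\<^bsub>?H\<^esub> ?h = \<zero>\<^bsub>?Q\<^esub>"
      using Q.coset_closed[OF h] QQ.M.zero_closed by (intro inj)
    then have "?h \<in> B (Suc m)" using Q.coset_eq_zero_iff[OF h] by simp
    then have "a \<odot>\<^bsub>Hom (Suc m)\<^esub> f \<oplus>\<^bsub>Hom (Suc m)\<^esub> b \<odot>\<^bsub>Hom (Suc m)\<^esub> g \<in> B (Suc m)" by simp
    then show ?thesis using ab by (intro exI conjI)
  qed
qed

end

section \<open>Homomorphisms from tensor modules to the algebra\<close>

text \<open>A basis of \<open>S\<close> stays independent after adjoining \<open>p\<close>, so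
  values can be prescribed on the enlarged set.\<close>

lemma separating_functional:
  fixes S :: "('q, 'k::field) tensor_alg set"
  assumes "tensor_alg.subspace S" "p \<notin> S"
  shows "\<exists>\<gamma>. Vector_Spaces.linear tscale (*) \<gamma> \<and> (\<forall>s\<in>S. \<gamma> s = 0) \<and> \<gamma> p = 1"
proof -
  obtain B where B: "B \<subseteq> S" "tensor_alg.independent B" "S \<subseteq> tensor_alg.span B"
    using tensor_alg.basis_exists[of S] by (metis (no_types))
  have SB: "S = tensor_alg.span B"
    using B assms(1) tensor_alg.span_minimal by (metis subset_antisym)
  then have "tensor_alg.independent (insert p B)"
    using B(2) assms(2) by (simp add: tensor_alg.independent_insert)
  then have "\<exists>\<gamma>. Vector_Spaces.linear tscale (*) \<gamma> \<and> (\<forall>x\<in>insert p B. \<gamma> x = (if x = p then 1 else (0::'k)))"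
    by (rule tensor_alg_functional.linear_independent_extend)
  then obtain \<gamma> where \<gamma>: "Vector_Spaces.linear tscale (*) \<gamma>"
    "\<forall>x\<in>insert p B. \<gamma> x = (if x = p then 1 else (0::'k))" by (elim exE conjE)
  have "\<gamma> b = 0" if "b \<in> B" for b using \<gamma>(2) that B(1) assms(2) by auto
  then have "\<gamma> s = 0" if "s \<in> S" for s
    using that tensor_alg_functional.linear_eq_0_on_span[OF \<gamma>(1), of B s] SB by simp
  then show ?thesis using \<gamma> by (intro exI[of _ \<gamma>]) simp
qed

lemma functional_expand:
  fixes p :: "('q::finite, 'k::field) tensor_alg"
  assumes "Vector_Spaces.linear tscale (*) \<gamma>" "p \<in> tensor_power n"
  shows "(\<Sum>w | length w = n. Poly_Mapping.lookup p w * \<gamma> (Poly_Mapping.single w 1)) = \<gamma> p"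
proof -
  have "\<gamma> p = \<gamma> (\<Sum>w | length w = n. tscale (Poly_Mapping.lookup p w) (Poly_Mapping.single w 1))"
    using tensor_power_expand[OF assms(2)] by (rule arg_cong)
  then show ?thesis
    by (simp add: tensor_alg_functional.linear_sum[OF assms(1)] tensor_alg_functional.linear_scale[OF assms(1)])
qed

text \<open>The homomorphism a \<otimes> w \<mapsto> a \<alpha>(w), restricted to A \<otimes> V.
  Right multiplication commutes with the left action, so \<alpha> is arbitrary. The cochains built
  by hand below have this shape.\<close>

definition eval_hom ::
  "('q::finite, 'k::field) tensor_alg set \<Rightarrow> nat \<Rightarrow> ('q list \<Rightarrow> ('q, 'k) tensor_alg) \<Rightarrow>
    ('q, 'k) universe \<Rightarrow> ('q, 'k) tensor_alg set" where
  "eval_hom R n \<alpha> t = finsum (hom_alg R) (\<lambda>w. t w \<otimes>\<^bsub>hom_alg R\<^esub> cls R (\<alpha> w)) {w. length w = n}"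

lemma eval_hom_cls: "eval_hom R n \<alpha> (\<lambda>w. cls R (\<tau> w)) = cls R (\<Sum>w | length w = n. \<tau> w * \<alpha> w)"
  by (simp add: eval_hom_def cls_mult cls_sum)

lemma eval_hom_hom: "eval_hom R n \<alpha> \<in> lmod_hom (hom_alg R) (tensor_module R V) (regular_module (hom_alg R))"
proof (rule lmod_homI)
  fix s assume "s \<in> carrier (tensor_module R V)"
  then have st: "s \<in> tensor (hom_alg R) V" by simp
  obtain \<sigma> where \<sigma>: "s = (\<lambda>w. cls R (\<sigma> w))" using tensor_value[OF st] by (rule representative)
  show "eval_hom R n \<alpha> s \<in> carrier (regular_module (hom_alg R))" by (simp add: \<sigma> eval_hom_cls)
  {
    fix t assume "t \<in> carrier (tensor_module R V)"
    then have tt: "t \<in> tensor (hom_alg R) V" by simp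
    obtain \<tau> where \<tau>: "t = (\<lambda>w. cls R (\<tau> w))" using tensor_value[OF tt] by (rule representative)
    show "eval_hom R n \<alpha> (s \<oplus>\<^bsub>tensor_module R V\<^esub> t) =
        eval_hom R n \<alpha> s \<oplus>\<^bsub>regular_module (hom_alg R)\<^esub> eval_hom R n \<alpha> t"
      by (simp add: \<sigma> \<tau> cls_add eval_hom_cls distrib_right sum.distrib)
  next
    fix a assume "a \<in> carrier (hom_alg R)"
    then obtain b where b: "a = cls R b" by (rule hom_alg_cases)
    show "eval_hom R n \<alpha> (a \<odot>\<^bsub>tensor_module R V\<^esub> s) =
        a \<odot>\<^bsub>regular_module (hom_alg R)\<^esub> eval_hom R n \<alpha> s"
      by (simp add: \<sigma> b cls_mult eval_hom_cls sum_distrib_left mult.assoc)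
  }
qed

lemma eval_hom_pure:
  "eval_hom R n \<alpha> (pure_tensor R p v) =
    cls R (\<Sum>w | length w = n. tscale (Poly_Mapping.lookup v w) (p * \<alpha> w))"
  by (simp add: pure_tensor_def eval_hom_cls tscale_mult_left)

text \<open>A functional \<gamma> and a fixed \<open>p\<close> give the cochain v \<mapsto>
  \<gamma>(v) p. Taking \<open>p\<close> to be 1 or a generator produces the cochains with values in
  degree zero or one that are tested against Ext.\<close>

lemma eval_hom_functional:
  assumes "Vector_Spaces.linear tscale (*) \<gamma>" "v \<in> tensor_power n"
  shows "eval_hom R n (\<lambda>w. tscale (\<gamma> (Poly_Mapping.single w 1)) p) (pure_tensor R 1 v) =
    cls R (tscale (\<gamma> v) p)"
  using functional_expand[OF assms]
  by (simp add: eval_hom_pure flip: tensor_alg.scale_sum_left)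

section \<open>Values of homomorphisms on pure tensors and on boundaries\<close>

lemma pure_tensor_smult:
  "pure_tensor R p v = cls R p \<odot>\<^bsub>tensor_module R V\<^esub> pure_tensor R 1 v"
  by (simp add: pure_tensor_def cls_mult tscale_mult_right)

lemma hom_pure_tensor:
  assumes "g \<in> lmod_hom (hom_alg R) (tensor_module R V) (regular_module (hom_alg R))" "v \<in> V"
  shows "g (pure_tensor R p v) = cls R p \<otimes>\<^bsub>hom_alg R\<^esub> g (pure_tensor R 1 v)"
proof -
  have "pure_tensor R 1 v \<in> carrier (tensor_module R V)" using pure_tensor_closed[OF assms(2)] by simp
  then show ?thesis
    unfolding pure_tensor_smult[of R p v V] using lmod_hom_smult[OF assms(1) cls_closed, of _ p] by simp
qed

lemma hom_vanishes:
  fixes R V :: "('q, 'k::field) tensor_alg set"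
  assumes g: "g \<in> lmod_hom (hom_alg R) (tensor_module R V) (regular_module (hom_alg R))"
    and z: "\<And>v. v \<in> V \<Longrightarrow> g (pure_tensor R 1 v) = \<zero>\<^bsub>hom_alg R\<^esub>" and t: "t \<in> tensor (hom_alg R) V"
  shows "g t = \<zero>\<^bsub>hom_alg R\<^esub>"
  using t
proof (induction rule: tensor_induct_pure)
  interpret A: ring "hom_alg R" by (rule ring_hom_alg)
  interpret T: left_module "hom_alg R" "tensor_module R V" by (rule left_module_tensor_module)
  interpret reg: left_module "hom_alg R" "regular_module (hom_alg R)"
    by (rule left_module_regular[OF ring_hom_alg])
  case zero
  show ?case using lmod_hom_zero[OF g T.M.abelian_group_axioms reg.M.abelian_group_axioms] by simp
next
  interpret A: ring "hom_alg R" by (rule ring_hom_alg)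
  case (add t p v)
  have "g (t \<oplus>\<^bsub>tensor_module R V\<^esub> pure_tensor R p v) =
      g t \<oplus>\<^bsub>regular_module (hom_alg R)\<^esub> g (pure_tensor R p v)"
    using add pure_tensor_closed[of v V R p] by (intro lmod_hom_add[OF g]) simp_all
  also have "g (pure_tensor R p v) = \<zero>\<^bsub>hom_alg R\<^esub>"
    using hom_pure_tensor[OF g add(2), of p] z[OF add(2)] by simp
  finally show ?case using add by simp
qed

text \<open>Written as a sum inside A \<otimes> V, the boundary can be fed to homomorphisms that are
  additive on A \<otimes> V only.\<close>

lemma koszul_d_pure:
  fixes R V :: "('q::finite, 'k::field) tensor_alg set"
  assumes "\<And>l. strip_left l v \<in> V"
  shows "koszul_d R (pure_tensor R 1 v) =
    finsum (tensor_module R V) (\<lambda>l. pure_tensor R (gen l) (strip_left l v)) UNIV"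
proof -
  have c: "(\<lambda>w. cls R (tscale (Poly_Mapping.lookup (strip_left l v) w) (gen l))) \<in> tensor (hom_alg R) V" for l
    using pure_tensor_closed[OF assms, of R "gen l"] by (simp add: pure_tensor_def)
  have "koszul_d R (pure_tensor R 1 v) =
      (\<lambda>w. cls R (\<Sum>l\<in>UNIV. tscale (Poly_Mapping.lookup (strip_left l v) w) (gen l)))"
    by (simp add: pure_tensor_def koszul_d_cls lookup_strip_left tscale_mult_left)
  also have "\<dots> = finsum (tensor_module R V)
      (\<lambda>l w. cls R (tscale (Poly_Mapping.lookup (strip_left l v) w) (gen l))) UNIV"
    using c by (intro finsum_tensor_module[symmetric]) simp_all
  finally show ?thesis by (simp add: pure_tensor_def)
qed

text \<open>Evaluates the coboundary of \<open>g\<close>. The generators stand on the left, so its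
  coefficient at the single letter \<open>l\<close> is the constant term of
  \<open>\<rho> l\<close>.\<close>

lemma hom_koszul_d_pure:
  fixes R V :: "('q::finite, 'k::field) tensor_alg set"
  assumes V: "\<And>l. strip_left l v \<in> V"
    and g: "g \<in> lmod_hom (hom_alg R) (tensor_module R V) (regular_module (hom_alg R))"
    and \<rho>: "\<And>l. g (pure_tensor R 1 (strip_left l v)) = cls R (\<rho> l)"
  shows "g (koszul_d R (pure_tensor R 1 v)) = cls R (\<Sum>l\<in>UNIV. gen l * \<rho> l)"
proof -
  interpret T: left_module "hom_alg R" "tensor_module R V" by (rule left_module_tensor_module)
  interpret reg: left_module "hom_alg R" "regular_module (hom_alg R)"
    by (rule left_module_regular[OF ring_hom_alg])
  have c: "pure_tensor R (gen l) (strip_left l v) \<in> carrier (tensor_module R V)" for l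
    using pure_tensor_closed[OF V] by simp
  have "g (koszul_d R (pure_tensor R 1 v)) =
      finsum (regular_module (hom_alg R)) (\<lambda>l. g (pure_tensor R (gen l) (strip_left l v))) UNIV"
    unfolding koszul_d_pure[OF V]
    using g T.M.abelian_group_axioms reg.M.abelian_group_axioms finite_class.finite_UNIV c by (rule lmod_hom_finsum)
  also have "(\<lambda>l. g (pure_tensor R (gen l) (strip_left l v))) = (\<lambda>l. cls R (gen l * \<rho> l))"
    by (rule ext) (simp add: hom_pure_tensor[OF g V, of "gen _"] \<rho> cls_mult)
  finally show ?thesis by (simp add: finsum_regular_module cls_sum)
qed

text \<open>On tensors of degree \<open>N\<close>, replacement of the last letter \<open>l\<close>
  by \<open>\<alpha> l\<close>; a prefix of length \<open>N - 1\<close> is kept. For scalar \<alpha>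
  this contracts the last factor with a vector.\<close>

definition right_subst :: "nat \<Rightarrow> ('q::finite \<Rightarrow> ('q, 'k::field) tensor_alg) \<Rightarrow> ('q, 'k) tensor_alg \<Rightarrow> ('q, 'k) tensor_alg" where
  "right_subst N \<alpha> v = (\<Sum>u | length u = N - 1. \<Sum>l\<in>UNIV.
     tscale (Poly_Mapping.lookup v (u @ [l])) (Poly_Mapping.single u 1 * \<alpha> l))"

text \<open>The differential moves all letters but the last into the algebra, and the 1-cochain
  \<alpha> acts on the last one. Hence \<alpha> is a cocycle exactly when
  \<open>right_subst N \<alpha>\<close> maps \<open>R\<close> into the ideal of relations.\<close>

lemma eval_hom_koszul_d_power:
  fixes R :: "('q::finite, 'k::field) tensor_alg set"
  shows "eval_hom R 1 (\<lambda>w. \<alpha> (hd w)) ((koszul_d R ^^ (N - 1)) (pure_tensor R 1 v)) = cls R (right_subst N \<alpha> v)"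
proof -
  have "eval_hom R 1 (\<lambda>w. \<alpha> (hd w)) ((koszul_d R ^^ (N - 1)) (pure_tensor R 1 v)) =
      cls R (\<Sum>w | length w = 1. (\<Sum>u | length u = N - 1.
        tscale (Poly_Mapping.lookup v (u @ w)) 1 * Poly_Mapping.single u 1) * \<alpha> (hd w))"
    unfolding pure_tensor_def koszul_d_power_cls eval_hom_cls ..
  also have "(\<Sum>w | length w = 1. (\<Sum>u | length u = N - 1.
        tscale (Poly_Mapping.lookup v (u @ w)) 1 * Poly_Mapping.single u 1) * \<alpha> (hd w)) =
      (\<Sum>l\<in>UNIV. (\<Sum>u | length u = N - 1.
        tscale (Poly_Mapping.lookup v (u @ [l])) 1 * Poly_Mapping.single u 1) * \<alpha> l)"
    unfolding sum_words_one by simp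
  also have "\<dots> = (\<Sum>l\<in>UNIV. \<Sum>u | length u = N - 1.
        tscale (Poly_Mapping.lookup v (u @ [l])) (Poly_Mapping.single u 1 * \<alpha> l))"
    by (simp add: sum_distrib_right tscale_mult_left)
  also have "\<dots> = right_subst N \<alpha> v" unfolding right_subst_def by (rule sum.swap)
  finally show ?thesis .
qed

lemma lookup_one_Nil: "Poly_Mapping.lookup (1 :: ('q, 'k::field) tensor_alg) [] = 1"
  by (simp add: lookup_one zero_list_def)

lemma lookup_gen_mult:
  "Poly_Mapping.lookup (gen m * p) (l # w) = (if m = l then Poly_Mapping.lookup p w else 0)"
  unfolding gen_def using lookup_single_mult[of "[m]" "[l]" 1 p w] by simp

lemma gen_tensor_power: "gen l \<in> tensor_power 1"
  unfolding gen_def using single_tensor_power[of "[l]"] by simp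

section \<open>Consequences of the Gorenstein property\<close>

locale koszul_gorenstein = koszul_relations N R
  for N :: nat and R :: "('q::finite, 'k::field) tensor_alg set" +
  assumes gldim: "has_global_dimension R 3" and gorenstein: "gorenstein R 3"
begin

sublocale E: ext_resolution R "trivial_module R" "koszul_module N R" "\<lambda>n. koszul_diff N R (Suc n)"
  "augmentation R" "regular_module (hom_alg R)"
  using koszul_projective_resolution left_module_regular[OF ring_hom_alg] by (rule ext_resolution.intro)

abbreviation "alg \<equiv> hom_alg R"
abbreviation "dual V \<equiv> lmod_hom alg (tensor_module R V) (regular_module alg)"
abbreviation "top_space \<equiv> koszul_space N R (N + 1)"

lemma koszul_module_low:
  "koszul_module N R 0 = tensor_module R (tensor_power 0)"
  "koszul_module N R 1 = tensor_module R (tensor_power 1)"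
  "koszul_module N R 2 = tensor_module R R"
  "koszul_module N R 3 = tensor_module R top_space"
  "koszul_module N R 4 = tensor_module R {0}"
  using N_ge_2 koszul_space_2N[OF gldim] koszul_space_N[OF subspace_R, of N]
  by (simp_all add: koszul_module_def koszul_degree_def koszul_space_low mult.commute)

section \<open>Ext of the trivial module computed from the Koszul resolution\<close>

lemma Ext_facts:
  shows "n \<noteq> 3 \<Longrightarrow> carrier (Ext alg (koszul_module N R) (\<lambda>n. koszul_diff N R (Suc n)) (regular_module alg) n) =
      {\<zero>\<^bsub>Ext alg (koszul_module N R) (\<lambda>n. koszul_diff N R (Suc n)) (regular_module alg) n\<^esub>}"
    and "lmod_isomorphic (ring_of_type_algebra :: 'k ring)
      (Ext alg (koszul_module N R) (\<lambda>n. koszul_diff N R (Suc n)) (regular_module alg) 3)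
      (regular_module (ring_of_type_algebra :: 'k ring))"
  using conjunct2[OF gorenstein[unfolded gorenstein_def], rule_format, OF koszul_projective_resolution]
  unfolding Let_def by blast+

text \<open>Removes the extensionality of cochains: restricting \<open>f\<close> to the carrier
  makes it an element of the Hom space and leaves its values on the module unchanged.\<close>

lemma Ext_vanishing:
  assumes f: "f \<in> lmod_hom alg (koszul_module N R (Suc m)) (regular_module alg)" and m: "Suc m \<noteq> 3"
    and z: "\<And>t. t \<in> carrier (koszul_module N R (Suc (Suc m))) \<Longrightarrow> f (koszul_diff N R (Suc (Suc m)) t) = \<zero>\<^bsub>alg\<^esub>"
  shows "\<exists>g \<in> lmod_hom alg (koszul_module N R m) (regular_module alg).
    \<forall>t \<in> carrier (koszul_module N R (Suc m)). f t = g (koszul_diff N R (Suc m) t)"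
proof -
  let ?f = "restrict f (carrier (koszul_module N R (Suc m)))"
  have "?f \<in> E.Z (Suc m)"
    using restrict_hom[OF f E.resolutionD(2)]
    by (rule E.cocycleI) (simp add: E.d_closed z)
  then have "?f \<in> E.B (Suc m)" using Ext_facts(1)[OF m] by (intro E.Ext_trivial)
  then obtain g where g: "g \<in> carrier (E.Hom m)"
    and fg: "?f = (\<lambda>t \<in> carrier (koszul_module N R (Suc m)). g (koszul_diff N R (Suc m) t))"
    unfolding E.coboundary_Suc by (elim imageE)
  have "f t = g (koszul_diff N R (Suc m) t)" if "t \<in> carrier (koszul_module N R (Suc m))" for t
    using fun_cong[OF fg, of t] that by simp
  then show ?thesis using g by (intro bexI[of _ g] ballI) simp_all
qed

lemma Ext_1:
  assumes f: "f \<in> dual (tensor_power 1)"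
    and z: "\<And>t. t \<in> tensor alg R \<Longrightarrow> f ((koszul_d R ^^ (N - 1)) t) = \<zero>\<^bsub>alg\<^esub>"
  shows "\<exists>g \<in> dual (tensor_power 0). \<forall>t \<in> tensor alg (tensor_power 1). f t = g (koszul_d R t)"
  using Ext_vanishing[of f 0] f z koszul_module_low
  by (simp add: numeral_2_eq_2 koszul_diff_def)

lemma Ext_2:
  assumes f: "f \<in> dual R"
    and z: "\<And>t. t \<in> tensor alg top_space \<Longrightarrow> f (koszul_d R t) = \<zero>\<^bsub>alg\<^esub>"
  shows "\<exists>g \<in> dual (tensor_power 1). \<forall>t \<in> tensor alg R. f t = g ((koszul_d R ^^ (N - 1)) t)"
proof -
  have S: "Suc (Suc 1) = 3" "Suc 1 = 2" by simp_all
  show ?thesis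
    using Ext_vanishing[of f 1, unfolded S] f z koszul_module_low by (simp add: koszul_diff_def)
qed

lemma cocycle_3:
  assumes "f \<in> dual top_space"
  shows "restrict f (tensor alg top_space) \<in> E.Z 3"
proof (rule E.cocycleI)
  interpret A: ring alg by (rule ring_hom_alg)
  interpret T: left_module alg "koszul_module N R 3" by (rule E.resolutionD(2))
  have f: "f \<in> lmod_hom alg (koszul_module N R 3) (regular_module alg)"
    using assms by (simp add: koszul_module_low)
  show "restrict f (tensor alg top_space) \<in> carrier (E.Hom 3)"
    using restrict_hom[OF f E.resolutionD(2)] by (simp add: koszul_module_low)
  fix t assume "t \<in> carrier (koszul_module N R (Suc 3))"
  then have "t \<in> tensor alg {0}" using koszul_module_low(5) by (simp add: numeral_eq_Suc)
  then have "t = (\<lambda>w. \<zero>\<^bsub>alg\<^esub>)"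
    by (induction rule: tensor_induct_pure) (simp_all add: pure_tensor_def cls_add cls_zero)
  then have "t = \<zero>\<^bsub>koszul_module N R (Suc 3)\<^esub>" by (simp add: koszul_module_def)
  then have "koszul_diff N R (Suc 3) t = \<zero>\<^bsub>koszul_module N R 3\<^esub>"
    using lmod_hom_zero[OF E.resolutionD(5)[of 3] E.resolutionD(3) E.resolutionD(3)] by simp
  then show "restrict f (tensor alg top_space) (koszul_diff N R (Suc 3) t) = \<zero>\<^bsub>regular_module alg\<^esub>"
    using lmod_hom_zero[OF f E.resolutionD(3) E.N.M.abelian_group_axioms] T.M.zero_closed
    by (simp add: koszul_module_low)
qed

lemma Ext_3_dependent:
  assumes f: "f \<in> dual top_space" and f': "f' \<in> dual top_space"
  shows "\<exists>a b. (a \<noteq> 0 \<or> b \<noteq> 0) \<and> (\<exists>g \<in> dual R. \<forall>t \<in> tensor alg top_space.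
    (a \<odot>\<^bsub>alg\<^esub> \<one>\<^bsub>alg\<^esub>) \<otimes>\<^bsub>alg\<^esub> f t \<oplus>\<^bsub>alg\<^esub>
    (b \<odot>\<^bsub>alg\<^esub> \<one>\<^bsub>alg\<^esub>) \<otimes>\<^bsub>alg\<^esub> f' t = g (koszul_d R t))"
proof -
  have 3: "Suc 2 = 3" by simp
  let ?f = "restrict f (tensor alg top_space)" and ?g = "restrict f' (tensor alg top_space)"
  note Ext_facts(2)[folded 3]
  from E.Ext_one_dependent[OF this, unfolded 3, OF cocycle_3[OF f] cocycle_3[OF f']]
  obtain a b where ab: "a \<noteq> 0 \<or> b \<noteq> 0"
    and B: "a \<odot>\<^bsub>E.Hom 3\<^esub> ?f \<oplus>\<^bsub>E.Hom 3\<^esub> b \<odot>\<^bsub>E.Hom 3\<^esub> ?g \<in> E.B 3" by (elim exE conjE)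
  from B[unfolded E.coboundary_Suc[of 2, unfolded 3]] obtain g where g: "g \<in> carrier (E.Hom 2)"
    and e: "a \<odot>\<^bsub>E.Hom 3\<^esub> ?f \<oplus>\<^bsub>E.Hom 3\<^esub> b \<odot>\<^bsub>E.Hom 3\<^esub> ?g =
      (\<lambda>t \<in> carrier (koszul_module N R 3). g (koszul_diff N R 3 t))"
    by (elim imageE)
  have "(a \<odot>\<^bsub>alg\<^esub> \<one>\<^bsub>alg\<^esub>) \<otimes>\<^bsub>alg\<^esub> f t \<oplus>\<^bsub>alg\<^esub>
      (b \<odot>\<^bsub>alg\<^esub> \<one>\<^bsub>alg\<^esub>) \<otimes>\<^bsub>alg\<^esub> f' t = g (koszul_d R t)"
    if "t \<in> tensor alg top_space" for t
    using fun_cong[OF e, of t] that by (simp add: koszul_module_low koszul_diff_def)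
  moreover have "g \<in> dual R" using g by (simp add: koszul_module_low)
  ultimately show ?thesis using ab by blast
qed

text \<open>If \<open>top_space\<close> were zero, so would be every cochain of degree three, and
  Ext^3 would vanish.\<close>

lemma top_space_nonzero: "top_space \<noteq> {0}"
proof
  assume z: "top_space = {0}"
  have 3: "Suc 2 = 3" by simp
  note Ext_facts(2)[folded 3]
  from E.Ext_one_nontrivial[OF this, unfolded 3] obtain f where f: "f \<in> E.Z 3" "f \<notin> E.B 3" by (elim bexE)
  interpret S: left_submodule E.ground_ring "E.Hom (Suc 2) \<lparr>carrier := E.Z (Suc 2)\<rparr>" "E.B (Suc 2)"
    by (rule E.submodule_coboundaries)
  have fh: "f \<in> dual top_space" and fe: "f \<in> extensional (tensor alg top_space)"
    using E.cocycleD(1)[OF f(1)] by (simp_all add: koszul_module_low)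
  interpret T: left_module alg "tensor_module R top_space" by (rule left_module_tensor_module)
  have "f t = \<zero>\<^bsub>alg\<^esub>" if "t \<in> tensor alg top_space" for t
    using fh _ that
  proof (rule hom_vanishes)
    fix v assume "v \<in> top_space"
    then have "pure_tensor R 1 v = \<zero>\<^bsub>tensor_module R top_space\<^esub>"
      using z by (simp add: pure_tensor_def cls_zero)
    then show "f (pure_tensor R 1 v) = \<zero>\<^bsub>alg\<^esub>"
      using lmod_hom_zero[OF fh T.M.abelian_group_axioms E.N.M.abelian_group_axioms] by simp
  qed
  then have "f = \<zero>\<^bsub>E.Hom 3\<^esub>"
    using fe by (auto simp: koszul_module_low fun_eq_iff restrict_def extensional_def)
  then show False using S.sub_zero f(2) by (simp add: 3)
qed

section \<open>Coefficients in low degree, and the relations generated by a tensor in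
  \<open>top_space\<close>\<close>

lemma cls_eq_lookup:
  "cls R p = cls R q \<Longrightarrow> length w < N \<Longrightarrow> Poly_Mapping.lookup p w = Poly_Mapping.lookup q w"
  using cls_coeff_cls[OF R_tensor_power] by metis

lemma augmentation_zero: "cls R p \<in> augmentation_ideal R \<Longrightarrow> Poly_Mapping.lookup p [] = 0"
  using cls_augmentation_ideal[OF R_tensor_power] N_ge_2 by simp

lemma dual_augmentation:
  assumes "g \<in> dual V" "tensor_alg.subspace V" "V \<subseteq> tensor_power n" "t \<in> tensor alg V"
    and "\<And>w. t w \<in> augmentation_ideal R"
  shows "g t \<in> augmentation_ideal R"
  using assms(2-4) assms(1) assms(5) by (rule regular_hom_augmentation)

lemma top_space_tensor_power: "top_space \<subseteq> tensor_power (N + 1)"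
  by (rule koszul_space_tensor_power[OF R_tensor_power])

lemma strip_left_top: "k \<in> top_space \<Longrightarrow> strip_left l k \<in> R"
  by (rule koszul_space_strip(1)[OF subspace_R])

lemma koszul_d_top:
  assumes "k \<in> top_space"
  shows "koszul_d R (pure_tensor R p k) \<in> tensor alg R"
proof -
  have "pure_tensor R p k \<in> carrier (koszul_module N R 3)"
    using pure_tensor_closed[OF assms] by (simp add: koszul_module_low)
  then have "koszul_diff N R (Suc 2) (pure_tensor R p k) \<in> carrier (koszul_module N R 2)"
    by (intro E.d_closed) simp
  then show ?thesis by (simp add: koszul_module_low koszul_diff_def)
qed

text \<open>Boundaries of lowest degree lie in the augmentation ideal, so a functional on \<open>top_space\<close> extends
  to a coboundary only if it vanishes.\<close>

lemma dual_koszul_d_top: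
  assumes "g \<in> dual R" "k \<in> top_space"
  shows "g (koszul_d R (pure_tensor R p k)) \<in> augmentation_ideal R"
proof (rule dual_augmentation[OF assms(1) subspace_R R_tensor_power koszul_d_top[OF assms(2)]])
  fix w
  have "pure_tensor R p k v \<in> carrier alg" for v by (simp add: pure_tensor_def)
  then have "(koszul_d R ^^ 1) (pure_tensor R p k) w \<in> augmentation_ideal R"
    by (rule koszul_d_power_augmentation) simp
  then show "koszul_d R (pure_tensor R p k) w \<in> augmentation_ideal R" by simp
qed

text \<open>Functionals dual to two independent elements give two cochains that are scalar-valued on
  \<open>top_space\<close>. A combination of them that is a coboundary takes there values that are
  scalars in the augmentation ideal, so it vanishes; evaluating at the two elements kills both
  coefficients.\<close>

lemma top_space_one_dimensional:
  assumes "k \<in> top_space" "k \<noteq> 0"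
  shows "top_space = tensor_alg.span {k}"
proof (rule ccontr)
  have sub: "tensor_alg.span {k} \<subseteq> top_space"
    using assms(1) by (intro tensor_alg.span_minimal subspace_koszul_space) simp
  assume "top_space \<noteq> tensor_alg.span {k}"
  then obtain k' where k': "k' \<in> top_space" "k' \<notin> tensor_alg.span {k}" using sub by blast
  have k: "k \<notin> tensor_alg.span {k'}"
  proof
    assume "k \<in> tensor_alg.span {k'}"
    then obtain c where c: "k = tscale c k'" by (auto simp: tensor_alg.span_singleton)
    then have "c \<noteq> 0" using assms(2) by auto
    then have "k' = tscale (inverse c) k" using c by simp
    then show False using k'(2) by (auto simp: tensor_alg.span_singleton)
  qed
  obtain \<phi> where \<phi>: "Vector_Spaces.linear tscale (*) \<phi>" "\<forall>s\<in>tensor_alg.span {k'}. \<phi> s = 0" "\<phi> k = 1"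
    using separating_functional[OF tensor_alg.subspace_span k] by (elim exE conjE)
  obtain \<psi> where \<psi>: "Vector_Spaces.linear tscale (*) \<psi>" "\<forall>s\<in>tensor_alg.span {k}. \<psi> s = 0" "\<psi> k' = 1"
    using separating_functional[OF tensor_alg.subspace_span k'(2)] by (elim exE conjE)
  let ?f = "\<lambda>\<gamma>. eval_hom R (N + 1) (\<lambda>w. tscale (\<gamma> (Poly_Mapping.single w 1)) 1)"
  obtain a b g where ab: "a \<noteq> 0 \<or> b \<noteq> 0" and g: "g \<in> dual R"
    and e: "\<forall>t \<in> tensor alg top_space.
      (a \<odot>\<^bsub>alg\<^esub> \<one>\<^bsub>alg\<^esub>) \<otimes>\<^bsub>alg\<^esub> ?f \<phi> t \<oplus>\<^bsub>alg\<^esub>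
      (b \<odot>\<^bsub>alg\<^esub> \<one>\<^bsub>alg\<^esub>) \<otimes>\<^bsub>alg\<^esub> ?f \<psi> t = g (koszul_d R t)"
    using Ext_3_dependent[OF eval_hom_hom[of R "N + 1" "\<lambda>w. tscale (\<phi> (Poly_Mapping.single w 1)) 1" top_space]
      eval_hom_hom[of R "N + 1" "\<lambda>w. tscale (\<psi> (Poly_Mapping.single w 1)) 1" top_space]]
    by (elim exE conjE bexE)
  have z: "a * \<phi> v + b * \<psi> v = 0" if v: "v \<in> top_space" for v
  proof -
    have vp: "v \<in> tensor_power (N + 1)" using v top_space_tensor_power by blast
    have "cls R (tscale (a * \<phi> v) 1 + tscale (b * \<psi> v) 1) = g (koszul_d R (pure_tensor R 1 v))"
      using e[rule_format, OF pure_tensor_closed[where p = 1, OF v]]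
      by (simp only: eval_hom_functional[OF \<phi>(1) vp] eval_hom_functional[OF \<psi>(1) vp]
          hom_alg_ops tscale_mult_left mult_1 tensor_alg.scale_scale)
    then have "cls R (tscale (a * \<phi> v) 1 + tscale (b * \<psi> v) 1) \<in> augmentation_ideal R"
      using dual_koszul_d_top[OF g v, of 1] by simp
    then have "Poly_Mapping.lookup (tscale (a * \<phi> v) 1 + tscale (b * \<psi> v) 1 :: ('q, 'k) tensor_alg) [] = 0"
      by (rule augmentation_zero)
    then show ?thesis by (simp add: lookup_add lookup_tscale_one)
  qed
  have "a = 0" using z[OF assms(1)] \<phi>(3) \<psi>(2) tensor_alg.span_base[of k "{k}"] by simp
  moreover have "b = 0" using z[OF k'(1)] \<psi>(3) \<phi>(2) tensor_alg.span_base[of k' "{k'}"] by simp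
  ultimately show False using ab by simp
qed

text \<open>The cochains k \<mapsto> 1 and k \<mapsto> x^m are dependent modulo coboundaries.
  Constant terms exclude the first, so a nonzero multiple b x^m equals the sum of the x^l g(r_l),
  where r_l is the contraction of \<open>k\<close> at l. Thus the constant term of g(r_l) is b for l
  = m and 0 otherwise, and applying \<open>g\<close> to a linear relation between the r_l isolates
  the coefficient at \<open>m\<close>.\<close>

lemma strip_left_independent:
  assumes k: "k \<in> top_space" "k \<noteq> 0" and dep: "(\<Sum>l\<in>UNIV. tscale (c l) (strip_left l k)) = 0"
  shows "c m = 0"
proof -
  have "k \<notin> {0}" using k(2) by simp
  from separating_functional[OF tensor_alg.subspace_single_0 this]
  obtain \<phi> where \<phi>: "Vector_Spaces.linear tscale (*) \<phi>" "\<phi> k = 1" by (elim exE conjE)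
  let ?f = "\<lambda>p. eval_hom R (N + 1) (\<lambda>w. tscale (\<phi> (Poly_Mapping.single w 1)) p)"
  have kp: "k \<in> tensor_power (N + 1)" using k(1) top_space_tensor_power by blast
  obtain a b g where ab: "a \<noteq> 0 \<or> b \<noteq> 0" and g: "g \<in> dual R"
    and e: "\<forall>t \<in> tensor alg top_space.
      (a \<odot>\<^bsub>alg\<^esub> \<one>\<^bsub>alg\<^esub>) \<otimes>\<^bsub>alg\<^esub> ?f 1 t \<oplus>\<^bsub>alg\<^esub>
      (b \<odot>\<^bsub>alg\<^esub> \<one>\<^bsub>alg\<^esub>) \<otimes>\<^bsub>alg\<^esub> ?f (gen m) t = g (koszul_d R t)"
    using Ext_3_dependent[OF eval_hom_hom[of R "N + 1" "\<lambda>w. tscale (\<phi> (Poly_Mapping.single w 1)) 1" top_space]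
      eval_hom_hom[of R "N + 1" "\<lambda>w. tscale (\<phi> (Poly_Mapping.single w 1)) (gen m)" top_space]]
    by (elim exE conjE bexE)
  have eq: "cls R (tscale a 1 + tscale b (gen m)) = g (koszul_d R (pure_tensor R 1 k))"
    using e[rule_format, OF pure_tensor_closed[where p = 1, OF k(1)]]
    by (simp only: eval_hom_functional[OF \<phi>(1) kp] \<phi>(2)
        hom_alg_ops tscale_mult_left mult_1 tensor_alg.scale_scale tensor_alg.scale_one)
  have "cls R (tscale a 1 + tscale b (gen m)) \<in> augmentation_ideal R"
    using dual_koszul_d_top[OF g k(1), of 1] eq by simp
  then have "Poly_Mapping.lookup (tscale a 1 + tscale b (gen m)) [] = 0" by (rule augmentation_zero)
  then have "a = 0" by (simp add: lookup_add lookup_tscale lookup_one_Nil gen_def lookup_single when_def)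
  then have b: "b \<noteq> 0" using ab by simp
  have rR: "strip_left l k \<in> R" for l using k(1) by (rule strip_left_top)
  have gc: "g (pure_tensor R 1 v) \<in> carrier alg" if "v \<in> R" for v
    using lmod_hom_closed[OF g, of "pure_tensor R 1 v"] pure_tensor_closed[OF that] by simp
  have "\<forall>l. \<exists>p. g (pure_tensor R 1 (strip_left l k)) = cls R p"
    using gc[OF rR] by (auto simp: carrier_hom_alg)
  then obtain \<rho> where \<rho>: "\<forall>l. g (pure_tensor R 1 (strip_left l k)) = cls R (\<rho> l)"
    by (rule choice[THEN exE])
  have "cls R (tscale b (gen m)) = cls R (\<Sum>l\<in>UNIV. gen l * \<rho> l)"
    using eq hom_koszul_d_pure[OF rR g, of \<rho>] \<rho> \<open>a = 0\<close> by simp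
  \<comment> \<open>Equality of classes gives equality of coefficients at single letters because
    \<open>N \<ge> 2\<close>.\<close>
  then have "Poly_Mapping.lookup (tscale b (gen m)) [l] = Poly_Mapping.lookup (\<Sum>l\<in>UNIV. gen l * \<rho> l) [l]" for l
    using N_ge_2 by (intro cls_eq_lookup) simp_all
  moreover have "Poly_Mapping.lookup (\<Sum>l\<in>UNIV. gen l * \<rho> l) [l] = Poly_Mapping.lookup (\<rho> l) []" for l
    by (simp add: lookup_sum lookup_gen_mult)
  ultimately have "Poly_Mapping.lookup (\<rho> l) [] = Poly_Mapping.lookup (tscale b (gen m)) [l]" for l
    by simp
  then have \<rho>0: "Poly_Mapping.lookup (\<rho> l) [] = (if l = m then b else 0)" for l
    by (simp add: lookup_tscale gen_def lookup_single when_def)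
  \<comment> \<open>\<open>g\<close> is additive only on A \<otimes> R, so the linear combination is
    rewritten as a sum in that module, with the scalars moved into the algebra.\<close>
  have G: "g (pure_tensor R 1 (\<Sum>l\<in>S. tscale (c l) (strip_left l k))) = cls R (\<Sum>l\<in>S. tscale (c l) (\<rho> l))" for S
  proof -
    interpret T: left_module alg "tensor_module R R" by (rule left_module_tensor_module)
    have c: "pure_tensor R (tscale (c l) 1) (strip_left l k) \<in> tensor alg R" for l
      using rR by (rule pure_tensor_closed)
    have "pure_tensor R 1 (\<Sum>l\<in>S. tscale (c l) (strip_left l k)) =
        (\<lambda>w. cls R (\<Sum>l\<in>S. tscale (Poly_Mapping.lookup (strip_left l k) w) (tscale (c l) 1)))"
      by (simp add: pure_tensor_def lookup_sum lookup_tscale tensor_alg.scale_sum_left mult.commute)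
    also have "\<dots> = finsum (tensor_module R R) (\<lambda>l. pure_tensor R (tscale (c l) 1) (strip_left l k)) S"
      using c unfolding pure_tensor_def by (intro finsum_tensor_module[symmetric]) simp_all
    finally have "g (pure_tensor R 1 (\<Sum>l\<in>S. tscale (c l) (strip_left l k))) =
        g (finsum (tensor_module R R) (\<lambda>l. pure_tensor R (tscale (c l) 1) (strip_left l k)) S)"
      by (rule arg_cong)
    also have "\<dots> = finsum (regular_module alg) (\<lambda>l. g (pure_tensor R (tscale (c l) 1) (strip_left l k))) S"
      using c by (intro lmod_hom_finsum[OF g T.M.abelian_group_axioms E.N.M.abelian_group_axioms]) simp_all
    also have "(\<lambda>l. g (pure_tensor R (tscale (c l) 1) (strip_left l k))) = (\<lambda>l. cls R (tscale (c l) (\<rho> l)))"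
      using \<rho> by (intro ext) (simp add: hom_pure_tensor[OF g rR, of "tscale _ _"] cls_mult tscale_mult_left)
    finally show ?thesis by (simp add: finsum_regular_module cls_sum)
  qed
  interpret T: left_module alg "tensor_module R R" by (rule left_module_tensor_module)
  have "pure_tensor R 1 0 = \<zero>\<^bsub>tensor_module R R\<^esub>" by (simp add: pure_tensor_def cls_zero)
  then have "g (pure_tensor R 1 0) = cls R 0"
    using lmod_hom_zero[OF g T.M.abelian_group_axioms E.N.M.abelian_group_axioms] by (simp add: cls_zero)
  then have "cls R (\<Sum>l\<in>UNIV. tscale (c l) (\<rho> l)) = cls R 0" using G[of UNIV] dep by simp
  then have "Poly_Mapping.lookup (\<Sum>l\<in>UNIV. tscale (c l) (\<rho> l)) [] = Poly_Mapping.lookup (0 :: ('q, 'k) tensor_alg) []"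
    using N_ge_2 by (intro cls_eq_lookup) simp_all
  then have "(\<Sum>l\<in>UNIV. c l * (if l = m then b else 0)) = 0"
    by (simp add: lookup_sum lookup_tscale \<rho>0)
  then show "c m = 0" using b by (simp add: if_distrib cong: if_cong)
qed

text \<open>A functional that vanishes on the contractions of \<open>k\<close> but not on
  \<open>R\<close> gives a 2-cocycle, because \<open>top_space\<close> is spanned by
  \<open>k\<close> and boundaries out of it involve only these contractions. By vanishing of Ext^2
  it is a coboundary and has values in the augmentation ideal at 1 \<otimes> v, although these
  values are scalars, so the functional is zero on \<open>R\<close> after all.\<close>

lemma relations_spanned:
  assumes k: "k \<in> top_space" "k \<noteq> 0"
  shows "R = tensor_alg.span (range (\<lambda>l. strip_left l k))"
proof (rule ccontr)
  let ?S = "tensor_alg.span (range (\<lambda>l. strip_left l k))"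
  have rR: "strip_left l k \<in> R" for l using k(1) by (rule strip_left_top)
  have "?S \<subseteq> R" using rR by (intro tensor_alg.span_minimal subspace_R) auto
  moreover assume "R \<noteq> ?S"
  ultimately obtain r where r: "r \<in> R" "r \<notin> ?S" by blast
  obtain \<gamma> where \<gamma>: "Vector_Spaces.linear tscale (*) \<gamma>" "\<forall>s\<in>?S. \<gamma> s = 0" "\<gamma> r = 1"
    using separating_functional[OF tensor_alg.subspace_span r(2)] by (elim exE conjE)
  let ?f = "eval_hom R N (\<lambda>w. tscale (\<gamma> (Poly_Mapping.single w 1)) 1)"
  have f: "?f \<in> dual R" by (rule eval_hom_hom)
  have fv: "?f (pure_tensor R 1 v) = cls R (tscale (\<gamma> v) 1)" if "v \<in> R" for v
    using R_tensor_power that by (intro eval_hom_functional[OF \<gamma>(1)]) blast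
  have vanish: "?f (koszul_d R t) = \<zero>\<^bsub>alg\<^esub>" if t: "t \<in> tensor alg top_space" for t
  proof (rule hom_vanishes[OF _ _ t, of "\<lambda>t. ?f (koszul_d R t)"])
    have "koszul_d R \<in> lmod_hom alg (tensor_module R top_space) (tensor_module R R)"
      using E.resolutionD(5)[of 2] koszul_module_low by (simp add: koszul_diff_def)
    then show "(\<lambda>t. ?f (koszul_d R t)) \<in> dual top_space" using f by (rule lmod_hom_comp)
    fix v assume v: "v \<in> top_space"
    then obtain c where c: "v = tscale c k"
      using top_space_one_dimensional[OF k] by (auto simp: tensor_alg.span_singleton)
    have "\<gamma> (strip_left l v) = 0" for l
      using \<gamma>(2) tensor_alg.span_base[of "strip_left l k" "range (\<lambda>l. strip_left l k)"]
      by (simp add: c strip_linear tensor_alg_functional.linear_scale[OF \<gamma>(1)])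
    then have "?f (koszul_d R (pure_tensor R 1 v)) = cls R (\<Sum>l\<in>UNIV. gen l * 0)"
      using strip_left_top[OF v] fv by (intro hom_koszul_d_pure[OF _ f]) simp_all
    then show "?f (koszul_d R (pure_tensor R 1 v)) = \<zero>\<^bsub>alg\<^esub>" by (simp add: cls_zero)
  qed
  have "\<exists>g \<in> dual (tensor_power 1). \<forall>t \<in> tensor alg R. ?f t = g ((koszul_d R ^^ (N - 1)) t)"
    using f vanish by (rule Ext_2)
  then obtain g where g: "g \<in> dual (tensor_power 1)"
    and e: "\<forall>t \<in> tensor alg R. ?f t = g ((koszul_d R ^^ (N - 1)) t)" by (elim bexE)
  have pr: "pure_tensor R 1 r \<in> tensor alg R" using r(1) by (rule pure_tensor_closed)
  have "pure_tensor R 1 r \<in> carrier (koszul_module N R 2)" using pr by (simp add: koszul_module_low)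
  then have "koszul_diff N R (Suc 1) (pure_tensor R 1 r) \<in> carrier (koszul_module N R 1)"
    by (intro E.d_closed) (simp add: numeral_2_eq_2)
  then have dr: "(koszul_d R ^^ (N - 1)) (pure_tensor R 1 r) \<in> tensor alg (tensor_power 1)"
    using koszul_module_low(2) by (simp add: koszul_diff_def)
  have "(koszul_d R ^^ (N - 1)) (pure_tensor R 1 r) w \<in> augmentation_ideal R" for w
    using tensor_value[OF pr] N_ge_2 by (intro koszul_d_power_augmentation) simp_all
  then have "g ((koszul_d R ^^ (N - 1)) (pure_tensor R 1 r)) \<in> augmentation_ideal R"
    by (rule dual_augmentation[OF g subspace_tensor_power order_refl dr])
  then have "cls R (tscale (\<gamma> r) 1) \<in> augmentation_ideal R"
    using e pr fv[OF r(1)] by simp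
  then have "\<gamma> r = 0" using augmentation_zero lookup_tscale_one by metis
  then show False using \<gamma>(3) by simp
qed

text \<open>Vanishing of Ext^1 in coordinates. The 1-cochain is x^l \<mapsto> \<alpha> l; a
  0-cochain is determined by its value at 1 \<otimes> 1, the class of \<open>q\<close>, and has
  coboundary x^l \<mapsto> x^l q. One and the same \<open>q\<close> serves all letters, which is
  what forces substitutions of degree one to be scalar.\<close>

lemma right_subst_boundary:
  assumes "\<And>v. v \<in> R \<Longrightarrow> right_subst N \<alpha> v \<in> rel_ideal R"
  shows "\<exists>q. \<forall>l. \<alpha> l - gen l * q \<in> rel_ideal R"
proof -
  let ?f = "eval_hom R 1 (\<lambda>w. \<alpha> (hd w))"
  have f: "?f \<in> dual (tensor_power 1)" by (rule eval_hom_hom)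
  have vanish: "?f ((koszul_d R ^^ (N - 1)) t) = \<zero>\<^bsub>alg\<^esub>" if t: "t \<in> tensor alg R" for t
  proof (rule hom_vanishes[OF _ _ t, of "\<lambda>t. ?f ((koszul_d R ^^ (N - 1)) t)"])
    have "koszul_d R ^^ (N - 1) \<in> lmod_hom alg (tensor_module R R) (tensor_module R (tensor_power 1))"
      using E.resolutionD(5)[of 1] koszul_module_low by (simp add: numeral_2_eq_2 koszul_diff_def)
    then show "(\<lambda>t. ?f ((koszul_d R ^^ (N - 1)) t)) \<in> dual R" using f by (rule lmod_hom_comp)
    fix v assume "v \<in> R"
    then show "?f ((koszul_d R ^^ (N - 1)) (pure_tensor R 1 v)) = \<zero>\<^bsub>alg\<^esub>"
      unfolding eval_hom_koszul_d_power cls_zero cls_eq_iff using assms by simp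
  qed
  have "\<exists>g \<in> dual (tensor_power 0). \<forall>t \<in> tensor alg (tensor_power 1). ?f t = g (koszul_d R t)"
    using f vanish by (rule Ext_1)
  then obtain g where g: "g \<in> dual (tensor_power 0)"
    and e: "\<forall>t \<in> tensor alg (tensor_power 1). ?f t = g (koszul_d R t)" by (elim bexE)
  have one: "(1 :: ('q, 'k) tensor_alg) \<in> tensor_power 0"
    using single_tensor_power[of "[]" "1 :: 'k"] by (simp add: single_one_Nil)
  have "g (pure_tensor R 1 1) \<in> carrier alg"
    using lmod_hom_closed[OF g, of "pure_tensor R 1 1"] pure_tensor_closed[OF one] by simp
  then obtain q where q: "g (pure_tensor R 1 1) = cls R q" by (rule hom_alg_cases)
  have "\<alpha> l - gen l * q \<in> rel_ideal R" for l
  proof -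
    \<comment> \<open>The only contraction of a generator that survives is the one at its own
      letter, and it gives 1; so the boundary of 1 \<otimes> x^l is x^l \<otimes> 1.\<close>
    have s: "strip_left m (gen l :: ('q, 'k) tensor_alg) = (if m = l then 1 else 0)" for m
      by (rule poly_mapping_eqI)
        (auto simp: lookup_strip_left gen_def lookup_single lookup_one when_def zero_list_def)
    have sp: "strip_left m (gen l :: ('q, 'k) tensor_alg) \<in> tensor_power 0" for m
    proof -
      have "(0 :: ('q, 'k) tensor_alg) \<in> tensor_power 0"
        by (rule tensor_alg.subspace_0[OF subspace_tensor_power])
      then show ?thesis using one by (simp add: s)
    qed
    interpret T: left_module alg "tensor_module R (tensor_power 0)" by (rule left_module_tensor_module)
    have "pure_tensor R 1 0 = \<zero>\<^bsub>tensor_module R (tensor_power 0)\<^esub>" by (simp add: pure_tensor_def cls_zero)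
    then have g0: "g (pure_tensor R 1 0) = cls R 0"
      using lmod_hom_zero[OF g T.M.abelian_group_axioms E.N.M.abelian_group_axioms] by (simp add: cls_zero)
    have "g (koszul_d R (pure_tensor R 1 (gen l))) = cls R (\<Sum>m\<in>UNIV. gen m * (if m = l then q else 0))"
      using sp g by (rule hom_koszul_d_pure) (simp add: s q g0)
    also have "(\<Sum>m\<in>UNIV. gen m * (if m = l then q else 0)) = gen l * q"
      by (simp add: if_distrib cong: if_cong)
    finally have gd: "g (koszul_d R (pure_tensor R 1 (gen l))) = cls R (gen l * q)" .
    have "pure_tensor R 1 (gen l) \<in> tensor alg (tensor_power 1)"
      by (rule pure_tensor_closed[OF gen_tensor_power])
    then have 1: "?f (pure_tensor R 1 (gen l)) = cls R (gen l * q)"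
      using e gd by simp
    have "(\<Sum>w | length w = 1. tscale (Poly_Mapping.lookup (gen l) w) (1 * \<alpha> (hd w))) =
        (\<Sum>m\<in>UNIV. if m = l then \<alpha> m else 0)"
      unfolding sum_words_one by (intro sum.cong refl) (simp add: gen_def lookup_single when_def)
    then have "?f (pure_tensor R 1 (gen l)) = cls R (\<alpha> l)" unfolding eval_hom_pure by simp
    with 1 have "cls R (\<alpha> l) = cls R (gen l * q)" by simp
    then show ?thesis by (simp add: cls_eq_iff)
  qed
  then show ?thesis by blast
qed

end

no_notation fps_nth (infixl \<open>$\<close> 75)

section \<open>The multilinear form of a tensor\<close>

text \<open>The length of the argument list selects the homogeneous component of \<open>p\<close>.
  Contractions of a tensor, which have smaller degree, are thus covered by the same definition, and
  a form can be evaluated recursively from either end.\<close>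

definition tensor_form :: "('q::finite, 'k::field) tensor_alg \<Rightarrow> ('q, 'k) form" where
  "tensor_form p xs =
     (\<Sum>w | length w = length xs. Poly_Mapping.lookup p w * prod_list (map2 (\<lambda>x l. x $ l) xs w))"

lemma tensor_form_Nil: "tensor_form p [] = Poly_Mapping.lookup p []"
proof -
  have "{w :: 'a list. length w = 0} = {[]}" by auto
  then show ?thesis by (simp add: tensor_form_def)
qed

lemma tensor_form_Cons: "tensor_form p (x # xs) = (\<Sum>l\<in>UNIV. x $ l * tensor_form (strip_left l p) xs)"
  by (simp add: tensor_form_def sum_words_Suc lookup_strip_left sum_distrib_left mult_ac)

lemma tensor_form_linear_tensor:
  "tensor_form 0 xs = 0"
  "tensor_form (p + q) xs = tensor_form p xs + tensor_form q xs"
  "tensor_form (tscale c p) xs = c * tensor_form p xs"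
  by (simp_all add: tensor_form_def lookup_add lookup_tscale distrib_right sum.distrib
      sum_distrib_left mult.assoc)

lemma tensor_form_sum: "tensor_form (sum f S) xs = (\<Sum>i\<in>S. tensor_form (f i) xs)"
  by (induction S rule: infinite_finite_induct) (simp_all add: tensor_form_linear_tensor)

lemma strip_commute: "strip_right m (strip_left l p) = strip_left l (strip_right m p)"
  by (rule poly_mapping_eqI) (simp add: lookup_strip_left lookup_strip_right)

lemma tensor_form_snoc:
  "tensor_form p (xs @ [x]) = (\<Sum>m\<in>UNIV. x $ m * tensor_form (strip_right m p) xs)"
proof (induction xs arbitrary: p)
  case Nil
  show ?case by (simp add: tensor_form_Cons tensor_form_Nil lookup_strip_left lookup_strip_right)
next
  case (Cons y xs)
  have "tensor_form p ((y # xs) @ [x]) =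
      (\<Sum>l\<in>UNIV. \<Sum>m\<in>UNIV. y $ l * (x $ m * tensor_form (strip_right m (strip_left l p)) xs))"
    by (simp add: tensor_form_Cons Cons.IH sum_distrib_left)
  also have "\<dots> = (\<Sum>m\<in>UNIV. \<Sum>l\<in>UNIV. y $ l * (x $ m * tensor_form (strip_right m (strip_left l p)) xs))"
    by (rule sum.swap)
  also have "\<dots> = (\<Sum>m\<in>UNIV. x $ m * tensor_form (strip_right m p) (y # xs))"
    by (simp add: tensor_form_Cons strip_commute sum_distrib_left mult.left_commute)
  finally show ?case .
qed

lemma tensor_form_additive:
  "tensor_form p (xs @ (x + y) # ys) = tensor_form p (xs @ x # ys) + tensor_form p (xs @ y # ys)"
  by (induction xs arbitrary: p)
    (simp_all add: tensor_form_Cons distrib_right distrib_left sum.distrib)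

lemma tensor_form_homogeneous:
  "tensor_form p (xs @ (c *s x) # ys) = c * tensor_form p (xs @ x # ys)"
  by (induction xs arbitrary: p)
    (simp_all add: tensor_form_Cons sum_distrib_left mult_ac)

lemma multilinear_tensor_form:
  fixes p :: "('q::finite, 'k::field) tensor_alg"
  shows "multilinear n (tensor_form p)"
  unfolding multilinear_def
proof (intro allI impI)
  fix xs ys :: "('k ^ 'q) list"
  show "Vector_Spaces.linear (*s) (*) (\<lambda>x. tensor_form p (xs @ x # ys))"
    by unfold_locales (simp_all add: tensor_form_additive tensor_form_homogeneous algebra_simps)
qed

lemma tensor_form_axis: "tensor_form p (map (\<lambda>i. axis i 1) w) = Poly_Mapping.lookup p w"
proof (induction w arbitrary: p)
  case Nil
  show ?case by (simp add: tensor_form_Nil)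
next
  case (Cons i w)
  have "tensor_form p (map (\<lambda>i. axis i 1) (i # w)) =
      (\<Sum>l\<in>UNIV. axis i 1 $ l * Poly_Mapping.lookup p (l # w))"
    by (simp add: tensor_form_Cons Cons.IH lookup_strip_left)
  also have "\<dots> = (\<Sum>l\<in>UNIV. if l = i then Poly_Mapping.lookup p (l # w) else 0)"
    by (intro sum.cong refl) (simp add: axis_def)
  finally show ?case by simp
qed

lemma tensor_form_eq_0:
  fixes p :: "('q::finite, 'k::field) tensor_alg"
  assumes "p \<in> tensor_power n" "\<And>xs. length xs = n \<Longrightarrow> tensor_form p xs = 0"
  shows "p = 0"
proof (rule poly_mapping_eqI)
  fix w
  show "Poly_Mapping.lookup p w = Poly_Mapping.lookup 0 w"
  proof (cases "length w = n")
    case True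
    then show ?thesis using assms(2)[of "map (\<lambda>i. axis i 1) w"] by (simp add: tensor_form_axis)
  next
    case False
    then show ?thesis using tensor_powerD[OF assms(1)] by simp
  qed
qed

text \<open>Identifies the relations displayed for a form with the contractions of its tensor in the
  first factor; for a nonzero tensor in \<open>top_space\<close> these span
  \<open>R\<close>.\<close>

lemma form_relation_tensor_form:
  assumes "p \<in> tensor_power (N + 1)"
  shows "form_relation N (tensor_form p) l = strip_left l p"
proof -
  have "strip_left l p \<in> tensor_power N"
    using assms by (intro tensor_powerI) (simp add: lookup_strip_left tensor_powerD)
  then have "strip_left l p = (\<Sum>w | length w = N.
      tscale (Poly_Mapping.lookup (strip_left l p) w) (Poly_Mapping.single w 1))"
    by (rule tensor_power_expand)
  then show ?thesis
    using tensor_form_axis[of p "l # _"] by (simp add: form_relation_def prod_list_gen lookup_strip_left)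
qed

lemma vec_linear_expand:
  fixes f :: "'k::field ^ 'q::finite \<Rightarrow> 'k ^ 'q"
  assumes "Vector_Spaces.linear (*s) (*s) f"
  shows "f x = (\<Sum>i\<in>UNIV. x $ i *s f (axis i 1))"
proof -
  have "f x = f (\<Sum>i\<in>UNIV. x $ i *s axis i 1)" by (simp only: basis_expansion)
  then show ?thesis by (simp add: vec.linear_sum[OF assms] vec.linear_scale[OF assms])
qed

section \<open>The 3-regular form of a Koszul Gorenstein algebra\<close>

context koszul_gorenstein
begin

lemma three_regular_form_exists:
  "\<exists>W :: ('q, 'k) form. three_regular N W \<and> R = form_relations N W"
proof -
  obtain k where k: "k \<in> top_space" "k \<noteq> 0"
    using top_space_nonzero tensor_alg.subspace_0[OF subspace_koszul_space, of N R "N + 1"] by blast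
  have kp: "k \<in> tensor_power (N + 1)" using k(1) top_space_tensor_power by blast
  let ?W = "tensor_form k"
  \<comment> \<open>Contraction of the first factor of \<open>k\<close> with a vector. It turns out
    to be a linear isomorphism onto \<open>R\<close>, and it translates between vectors in the first
    slot of the form and relations.\<close>
  define comb where "comb x = (\<Sum>l\<in>UNIV. tscale (x $ l) (strip_left l k))" for x :: "'k ^ 'q"
  have comb_add: "comb (x + y) = comb x + comb y" for x y
    by (simp add: comb_def tensor_alg.scale_left_distrib sum.distrib)
  have comb_scale: "comb (c *s x) = tscale c (comb x)" for c x
    by (simp add: comb_def tensor_alg.scale_sum_right)
  have comb_sum: "comb (\<Sum>i\<in>S. f i) = (\<Sum>i\<in>S. comb (f i))" for f :: "'q \<Rightarrow> 'k ^ 'q" and S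
    by (induction S rule: infinite_finite_induct) (simp_all add: comb_add, simp_all add: comb_def)
  have W_Cons: "?W (x # xs) = tensor_form (comb x) xs" for x xs
    by (simp add: tensor_form_Cons comb_def tensor_form_sum tensor_form_linear_tensor)
  have comb_0: "x = 0" if "comb x = 0" for x
    using strip_left_independent[OF k, of "\<lambda>l. x $ l"] that by (simp add: comb_def vec_eq_iff)
  have comb_R: "comb x \<in> R" for x
    unfolding comb_def using strip_left_top[OF k(1)]
    by (intro tensor_alg.subspace_sum[OF subspace_R] tensor_alg.subspace_scale[OF subspace_R]) simp
  have R_comb: "\<exists>x. v = comb x" if "v \<in> R" for v
  proof -
    have "tensor_alg.span (range (\<lambda>l. strip_left l k)) \<subseteq> range comb"
    proof (rule tensor_alg.span_minimal)
      show "tensor_alg.subspace (range comb)"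
      proof (rule tensor_alg.subspaceI)
        show "0 \<in> range comb" by (rule image_eqI[where x = 0]) (simp_all add: comb_def)
        show "u + v \<in> range comb" if u: "u \<in> range comb" and v: "v \<in> range comb" for u v
        proof -
          obtain x y where "u = comb x" "v = comb y" using u v by (elim rangeE)
          then have "u + v = comb (x + y)" by (simp add: comb_add)
          then show ?thesis by (rule range_eqI)
        qed
        show "tscale c v \<in> range comb" if v: "v \<in> range comb" for c v
        proof -
          obtain x where "v = comb x" using v by (elim rangeE)
          then have "tscale c v = comb (c *s x)" by (simp add: comb_scale)
          then show ?thesis by (rule range_eqI)
        qed
      qed
      have "strip_left l k = comb (axis l 1)" for l
      proof -
        have "comb (axis l 1) = (\<Sum>m\<in>UNIV. if m = l then strip_left m k else 0)"
          unfolding comb_def by (intro sum.cong refl) (simp add: axis_def)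
        then show ?thesis by simp
      qed
      then show "range (\<lambda>l. strip_left l k) \<subseteq> range comb" by auto
    qed
    then show ?thesis using relations_spanned[OF k] that by blast
  qed
  have nondegenerate: "x = 0" if "\<And>xs. length xs = N \<Longrightarrow> ?W (x # xs) = 0" for x
  proof -
    have "comb x \<in> tensor_power N" using comb_R R_tensor_power by blast
    then have "comb x = 0" using that by (intro tensor_form_eq_0[of _ N]) (simp_all add: W_Cons)
    then show ?thesis by (rule comb_0)
  qed

  \<comment> \<open>Right contractions of \<open>k\<close> are relations as well, hence left
    contractions of \<open>k\<close> along some vector; \<open>y m\<close> becomes the value of
    \<open>Q\<close> at the basis vector \<open>axis m 1\<close>.\<close>
  have "\<forall>m. \<exists>y. strip_right m k = comb y"
    using koszul_space_strip(2)[OF subspace_R k(1)] R_comb by blast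
  then obtain y where y: "\<forall>m. strip_right m k = comb (y m)" by (rule choice[THEN exE])
  define Q where "Q x = (\<Sum>m\<in>UNIV. x $ m *s y m)" for x :: "'k ^ 'q"
  have comb_Q: "comb (Q x) = (\<Sum>m\<in>UNIV. tscale (x $ m) (strip_right m k))" for x
    by (simp add: Q_def comb_sum comb_scale y)
  have cyclic: "?W (xs @ [x]) = ?W (Q x # xs)" for xs x
    by (simp add: W_Cons tensor_form_snoc comb_Q tensor_form_sum tensor_form_linear_tensor)
  have Q_linear: "Vector_Spaces.linear (*s) (*s) Q"
    by unfold_locales
      (simp_all add: Q_def vec.scale_left_distrib sum.distrib vec.scale_sum_right)
  \<comment> \<open>The components of \<open>x\<close> serve as a scalar 1-cochain. Its substitution
    into a relation contracts the last factor with \<open>x\<close>. Contractions at the two ends of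
    \<open>k\<close> commute, and the one at the end along \<open>x\<close> is
    \<open>comb (Q x)\<close>, hence zero. So \<open>x $ l\<close> is congruent to x^l q and its
    constant term vanishes.\<close>
  have Q_0: "x = 0" if "Q x = 0" for x
  proof -
    let ?\<alpha> = "\<lambda>l. tscale (x $ l) 1"
    have 0: "(\<Sum>m\<in>UNIV. tscale (x $ m) (strip_right m k)) = 0"
      using comb_Q[of x] that by (simp add: comb_def)
    have sub: "right_subst N ?\<alpha> v \<in> rel_ideal R" if "v \<in> R" for v
    proof -
      obtain z where z: "v = comb z" using R_comb[OF \<open>v \<in> R\<close>] by blast
      have "(\<Sum>l\<in>UNIV. Poly_Mapping.lookup v (u @ [l]) * x $ l) = 0" for u
      proof -
        have "(\<Sum>l\<in>UNIV. Poly_Mapping.lookup v (u @ [l]) * x $ l) =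
            (\<Sum>l\<in>UNIV. \<Sum>i\<in>UNIV. z $ i * (x $ l * Poly_Mapping.lookup (strip_right l k) (i # u)))"
          by (simp add: z comb_def lookup_sum lookup_tscale lookup_strip_left lookup_strip_right
              sum_distrib_left sum_distrib_right mult_ac)
        also have "\<dots> = (\<Sum>i\<in>UNIV. \<Sum>l\<in>UNIV. z $ i * (x $ l * Poly_Mapping.lookup (strip_right l k) (i # u)))"
          by (rule sum.swap)
        also have "\<dots> = (\<Sum>i\<in>UNIV. z $ i *
            Poly_Mapping.lookup (\<Sum>m\<in>UNIV. tscale (x $ m) (strip_right m k)) (i # u))"
          by (simp add: lookup_sum lookup_tscale sum_distrib_left)
        finally show ?thesis by (simp add: 0)
      qed
      then have "right_subst N ?\<alpha> v = 0"
        by (simp add: right_subst_def tscale_mult_right flip: tensor_alg.scale_sum_left)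
      then show ?thesis by (simp add: rel_ideal_zero)
    qed
    obtain q where q: "\<forall>l. tscale (x $ l) 1 - gen l * q \<in> rel_ideal R"
      using right_subst_boundary[of ?\<alpha>, OF sub] by blast
    have "x $ l = 0" for l
    proof -
      have "tscale (x $ l) 1 - gen l * q \<in> words_ge N"
        using q rel_ideal_words_ge[OF R_tensor_power] by blast
      then have "Poly_Mapping.lookup (tscale (x $ l) 1 - gen l * q) [] = 0"
        using N_ge_2 by (simp add: words_ge_def)
      moreover have "gen l * q \<in> words_ge 1"
        by (intro words_ge_mult) (auto simp: words_ge_def gen_def lookup_single when_def)
      then have "Poly_Mapping.lookup (gen l * q) [] = 0" unfolding words_ge_1_iff .
      ultimately show ?thesis by (simp add: lookup_minus lookup_tscale lookup_one_Nil)
    qed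
    then show ?thesis by (simp add: vec_eq_iff)
  qed
  have Q_inj: "inj Q"
    using Q_0 by (simp add: vec.linear_inj_iff_eq_0[OF Q_linear])
  have Q_surj: "surj Q"
    using Q_linear Q_inj by (rule vec.linear_injective_imp_surjective) simp
  have "Q \<in> GL" using Q_linear Q_inj Q_surj by (simp add: GL_def bij_def)
  then have preregular: "preregular N ?W"
    unfolding preregular_def
  proof (intro conjI allI impI)
    show "multilinear (N + 1) ?W" by (rule multilinear_tensor_form)
    show "x = 0" if "\<forall>xs. length xs = N \<longrightarrow> ?W (x # xs) = 0" for x
      using that by (intro nondegenerate) simp
    show "\<exists>Q\<in>GL. \<forall>xs x. length xs = N \<longrightarrow> ?W (xs @ [x]) = ?W (Q x # xs)"
      by (rule bexI[OF _ \<open>Q \<in> GL\<close>], intro allI impI, rule cyclic)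
  qed

  have "\<exists>c. L0 = (\<lambda>x. c *s x) \<and> L1 = (\<lambda>x. c *s x)"
    if L0: "Vector_Spaces.linear (*s) (*s) L0" and L1: "Vector_Spaces.linear (*s) (*s) L1"
      and L: "\<And>x0 x1 xs. length xs = N - 1 \<Longrightarrow> ?W (L0 x0 # x1 # xs) = ?W (x0 # L1 x1 # xs)"
    for L0 L1 :: "'k ^ 'q \<Rightarrow> 'k ^ 'q"
  proof -
    \<comment> \<open>The conjugate of \<open>L0\<close> by \<open>Q\<close>: rotating the last
      argument to the front turns \<open>z\<close> into \<open>Q z\<close>, so an operator on the
      first argument acts on the last one as this conjugate.\<close>
    define M where "M z = inv_into UNIV Q (L0 (Q z))" for z
    have QM: "Q (M z) = L0 (Q z)" for z
      unfolding M_def by (rule surj_f_inv_f[OF Q_surj])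
    have shift: "?W (L1 x # xs @ [z]) = ?W (x # xs @ [M z])" if "length xs = N - 1" for x xs z
    proof -
      have "?W (L1 x # xs @ [z]) = ?W (Q z # L1 x # xs)" using cyclic[of "L1 x # xs" z] by simp
      also have "\<dots> = ?W (Q (M z) # x # xs)" using L[OF that] by (simp add: QM)
      also have "\<dots> = ?W (x # xs @ [M z])" using cyclic[of "x # xs" "M z"] by simp
      finally show ?thesis .
    qed
    \<comment> \<open>The transpose of \<open>M\<close>. Letters are coordinate functions, so
      substituting \<alpha> for the last letter amounts to applying \<open>M\<close> to the last
      argument of the form.\<close>
    define \<alpha> where "\<alpha> l = (\<Sum>m\<in>UNIV. tscale (M (axis m 1) $ l) (gen m))" for l
    have \<alpha>_coeff: "Poly_Mapping.lookup (\<alpha> l) [m] = M (axis m 1) $ l" for l m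
      by (simp add: \<alpha>_def lookup_sum lookup_tscale gen_def lookup_single when_def if_distrib cong: if_cong)
    have \<alpha>_power: "\<alpha> l \<in> tensor_power 1" for l
      unfolding \<alpha>_def using gen_tensor_power
      by (intro tensor_alg.subspace_sum[OF subspace_tensor_power]
          tensor_alg.subspace_scale[OF subspace_tensor_power])
    \<comment> \<open>The substitution carries the relation along \<open>z\<close> to the relation
      along \<open>L1 z\<close>, so it preserves \<open>R\<close> and \<alpha> is a cocycle.
      Coefficients are compared by evaluating at basis vectors, where \<open>shift\<close>
      applies.\<close>
    have subst_eq: "right_subst N \<alpha> (comb z) = comb (L1 z)" for z
    proof (rule poly_mapping_eqI)
      fix w
      have "Poly_Mapping.single u 1 * \<alpha> l \<in> tensor_power N" if "length u = N - 1" for u l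
        using tensor_power_mult[OF single_tensor_power[of u "1 :: 'k"] \<alpha>_power[of l]] that N_ge_2 by simp
      then have rs: "right_subst N \<alpha> (comb z) \<in> tensor_power N"
        unfolding right_subst_def
        by (intro tensor_alg.subspace_sum[OF subspace_tensor_power]
            tensor_alg.subspace_scale[OF subspace_tensor_power]) simp
      show "Poly_Mapping.lookup (right_subst N \<alpha> (comb z)) w = Poly_Mapping.lookup (comb (L1 z)) w"
      proof (cases "length w = N")
        case False
        then show ?thesis using tensor_powerD[OF rs] tensor_powerD[of "comb (L1 z)" N] comb_R R_tensor_power
          by (simp add: subset_iff)
      next
        case True
        then obtain u m where w: "w = u @ [m]" using N_ge_2 by (cases w rule: rev_cases) auto
        then have u: "length u = N - 1" using True by simp
        let ?e = "map (\<lambda>i. axis i 1) u :: ('k ^ 'q) list"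
        have "Poly_Mapping.lookup (right_subst N \<alpha> (comb z)) w =
            (\<Sum>u' | length u' = N - 1. if u' = u then
              (\<Sum>l\<in>UNIV. Poly_Mapping.lookup (comb z) (u @ [l]) * M (axis m 1) $ l) else 0)"
          unfolding right_subst_def lookup_sum
        proof (rule sum.cong[OF refl])
          fix u' assume "u' \<in> {u' :: 'q list. length u' = N - 1}"
          then have "Poly_Mapping.lookup (Poly_Mapping.single u' 1 * \<alpha> l) w =
              (if u' = u then M (axis m 1) $ l else 0)" for l
            using lookup_single_mult[of u' u 1 "\<alpha> l" "[m]"] u by (simp add: w \<alpha>_coeff)
          then show "(\<Sum>l\<in>UNIV. Poly_Mapping.lookup (tscale (Poly_Mapping.lookup (comb z) (u' @ [l]))
                (Poly_Mapping.single u' 1 * \<alpha> l)) w) =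
              (if u' = u then (\<Sum>l\<in>UNIV. Poly_Mapping.lookup (comb z) (u @ [l]) * M (axis m 1) $ l) else 0)"
            by (simp add: lookup_tscale)
        qed
        also have "\<dots> = (\<Sum>l\<in>UNIV. Poly_Mapping.lookup (comb z) (u @ [l]) * M (axis m 1) $ l)"
          using u by simp
        also have "\<dots> = tensor_form (comb z) (?e @ [M (axis m 1)])"
          by (simp add: tensor_form_snoc tensor_form_axis lookup_strip_right mult.commute)
        also have "\<dots> = ?W (z # ?e @ [M (axis m 1)])" by (simp add: W_Cons)
        also have "\<dots> = ?W (L1 z # ?e @ [axis m 1])" using u by (intro shift[symmetric]) simp
        also have "\<dots> = tensor_form (comb (L1 z)) (map (\<lambda>i. axis i 1) w)" by (simp add: W_Cons w)
        finally show ?thesis by (simp only: tensor_form_axis)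
      qed
    qed
    have sub: "right_subst N \<alpha> v \<in> rel_ideal R" if v: "v \<in> R" for v
    proof -
      obtain z where "v = comb z" using R_comb[OF v] by blast
      then show ?thesis using comb_R[of "L1 z"] rel_ideal_superset[of R] by (auto simp: subst_eq)
    qed
    obtain q where q: "\<forall>l. \<alpha> l - gen l * q \<in> rel_ideal R"
      using right_subst_boundary[of \<alpha>, OF sub] by blast
    \<comment> \<open>The elements \<open>\<alpha> l\<close> have degree one, so only the constant
      term of \<open>q\<close> contributes when coefficients at single letters are compared.\<close>
    define c where "c = Poly_Mapping.lookup q []"
    have M_axis: "M (axis m 1) = c *s axis m 1" for m
    proof -
      have "M (axis m 1) $ l = (c *s axis m 1) $ l" for l
      proof -
        have "\<alpha> l - gen l * q \<in> words_ge N"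
          using q rel_ideal_words_ge[OF R_tensor_power] by blast
        then have "Poly_Mapping.lookup (\<alpha> l - gen l * q) [m] = 0"
          using N_ge_2 by (simp add: words_ge_def)
        then show ?thesis by (simp add: lookup_minus \<alpha>_coeff lookup_gen_mult c_def axis_def)
      qed
      then show ?thesis by (simp add: vec_eq_iff)
    qed
    have L0_Q: "L0 (Q x) = c *s Q x" for x
    proof -
      have "L0 (Q x) = L0 (\<Sum>i\<in>UNIV. x $ i *s Q (axis i 1))"
        using vec_linear_expand[OF Q_linear, of x] by (rule arg_cong)
      also have "\<dots> = (\<Sum>i\<in>UNIV. x $ i *s L0 (Q (axis i 1)))"
        by (simp add: vec.linear_sum[OF L0] vec.linear_scale[OF L0])
      also have "\<dots> = (\<Sum>i\<in>UNIV. x $ i *s (c *s Q (axis i 1)))"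
        by (simp add: M_axis vec.linear_scale[OF Q_linear] flip: QM)
      also have "\<dots> = c *s (\<Sum>i\<in>UNIV. x $ i *s Q (axis i 1))"
        by (simp add: vec.scale_sum_right mult.commute)
      also have "\<dots> = c *s Q x" using vec_linear_expand[OF Q_linear, of x] by simp
      finally show ?thesis .
    qed
    have L0_eq: "L0 = (\<lambda>x. c *s x)"
    proof
      fix x
      obtain x' where "x = Q x'" using surjD[OF Q_surj, of x] by (elim exE)
      then show "L0 x = c *s x" using L0_Q by simp
    qed
    have "L1 x = c *s x" for x
    proof -
      \<comment> \<open>With \<open>L0\<close> known, rotating to the front and back shows that
        \<open>L1 x\<close> and \<open>c *s x\<close> give the same values in the first slot;
        nondegeneracy makes them equal.\<close>
      have "L1 x + (- c) *s x = 0"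
      proof (rule nondegenerate)
        fix ys :: "('k ^ 'q) list" assume ys: "length ys = N"
        then obtain xs z where ys_eq: "ys = xs @ [z]" using N_ge_2 by (cases ys rule: rev_cases) auto
        then have xs: "length xs = N - 1" using ys by simp
        have "?W (L1 x # ys) = ?W (Q z # L1 x # xs)" using cyclic[of "L1 x # xs" z] by (simp add: ys_eq)
        also have "\<dots> = ?W (c *s Q z # x # xs)" using L[OF xs, of "Q z" x] by (simp add: L0_eq)
        also have "\<dots> = c * ?W (Q z # x # xs)" using tensor_form_homogeneous[of k "[]"] by simp
        also have "\<dots> = c * ?W (x # ys)" using cyclic[of "x # xs" z] by (simp add: ys_eq)
        finally have "?W (L1 x # ys) = c * ?W (x # ys)" .
        moreover have "?W ((L1 x + (- c) *s x) # ys) = ?W (L1 x # ys) + ?W ((- c) *s x # ys)"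
          using tensor_form_additive[of k "[]"] by (simp only: append_Nil)
        moreover have "?W ((- c) *s x # ys) = (- c) * ?W (x # ys)"
          using tensor_form_homogeneous[of k "[]"] by (simp only: append_Nil)
        ultimately show "?W ((L1 x + (- c) *s x) # ys) = 0" by simp
      qed
      then show ?thesis by (simp add: vec_eq_iff)
    qed
    then have "L1 = (\<lambda>x. c *s x)" by (rule ext)
    then show ?thesis using L0_eq by (intro exI[of _ c] conjI)
  qed
  then have "three_regular N ?W"
    unfolding three_regular_def by (intro conjI allI impI preregular) simp
  moreover have "R = form_relations N ?W"
    unfolding form_relations_def using relations_spanned[OF k] form_relation_tensor_form[OF kp] by simp
  ultimately show ?thesis by (intro exI[of _ ?W] conjI)
qed

end

section \<open>Linear substitutions\<close>

definition subst :: "('q \<Rightarrow> ('p, 'k::field) tensor_alg) \<Rightarrow> ('q, 'k) tensor_alg \<Rightarrow> ('p, 'k) tensor_alg" where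
  "subst \<beta> p = (\<Sum>w\<in>Poly_Mapping.keys p. tscale (Poly_Mapping.lookup p w) (prod_list (map \<beta> w)))"

lemma subst_zero: "subst \<beta> 0 = 0"
  by (simp add: subst_def)

lemma subst_add: "subst \<beta> (p + q) = subst \<beta> p + subst \<beta> q"
  unfolding subst_def
  by (rule setsum_keys_plus_distrib) (simp_all add: tensor_alg.scale_left_distrib)

lemma subst_single: "subst \<beta> (Poly_Mapping.single w c) = tscale c (prod_list (map \<beta> w))"
  by (simp add: subst_def)

lemma subst_tscale: "subst \<beta> (tscale c p) = tscale c (subst \<beta> p)"
  by (induction p rule: tensor_alg_induct)
    (simp_all add: subst_zero subst_add subst_single tscale_single tensor_alg.scale_right_distrib)

lemma subst_sum: "subst \<beta> (sum f S) = (\<Sum>i\<in>S. subst \<beta> (f i))"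
  by (induction S rule: infinite_finite_induct) (simp_all add: subst_zero subst_add)

lemma subst_one: "subst \<beta> 1 = 1"
  using subst_single[of \<beta> "[]" 1] by (simp add: single_one_Nil)

lemma subst_gen: "subst \<beta> (gen l) = \<beta> l"
  by (simp add: gen_def subst_single)

lemma subst_mult: "subst \<beta> (p * q) = subst \<beta> p * subst \<beta> q"
proof (induction p rule: tensor_alg_induct)
  case (single w c)
  show ?case
    by (induction q rule: tensor_alg_induct)
      (simp_all add: subst_zero subst_add subst_single distrib_left mult_single plus_list_def
        tscale_mult_left tscale_mult_right)
qed (simp_all add: subst_zero subst_add distrib_right)

lemma subst_prod_list: "subst \<beta> (prod_list ps) = prod_list (map (subst \<beta>) ps)"
  by (induction ps) (simp_all add: subst_one subst_mult)

lemma subst_subst: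
  assumes "\<And>l. subst \<gamma> (\<beta> l) = gen l"
  shows "subst \<gamma> (subst \<beta> p) = p"
proof (induction p rule: tensor_alg_induct)
  case (single w c)
  have "subst \<gamma> (prod_list (map \<beta> w)) = prod_list (map gen w)"
    by (simp add: subst_prod_list comp_def assms)
  then show ?case by (simp add: subst_single subst_tscale prod_list_gen tscale_single)
qed (simp_all add: subst_zero subst_add)

text \<open>The pullback of the coordinate function \<open>l\<close> along \<open>B\<close>, that
  is, substitution by the transpose matrix. Composition of substitutions therefore reverses the
  order of the maps.\<close>

definition linear_subst :: "('k::field ^ 'q::finite \<Rightarrow> 'k ^ 'q) \<Rightarrow> 'q \<Rightarrow> ('q, 'k) tensor_alg" where
  "linear_subst B l = (\<Sum>m\<in>UNIV. tscale (B (axis m 1) $ l) (gen m))"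

lemma linear_subst_inverse:
  assumes L: "Vector_Spaces.linear (*s) (*s) L" and B: "Vector_Spaces.linear (*s) (*s) B"
    and BL: "\<And>x. B (L x) = x"
  shows "subst (linear_subst L) (subst (linear_subst B) p) = p"
proof (rule subst_subst)
  fix l
  have "subst (linear_subst L) (linear_subst B l) =
      (\<Sum>m\<in>UNIV. \<Sum>n\<in>UNIV. tscale (B (axis m 1) $ l * L (axis n 1) $ m) (gen n))"
    by (simp add: linear_subst_def subst_sum subst_tscale subst_gen tensor_alg.scale_sum_right)
  also have "\<dots> = (\<Sum>n\<in>UNIV. \<Sum>m\<in>UNIV. tscale (B (axis m 1) $ l * L (axis n 1) $ m) (gen n))"
    by (rule sum.swap)
  also have "\<dots> = (\<Sum>n\<in>UNIV. tscale (B (L (axis n 1)) $ l) (gen n))"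
    by (subst vec_linear_expand[OF B, of "L _"])
      (simp add: tensor_alg.scale_sum_left mult.commute)
  also have "\<dots> = (\<Sum>n\<in>UNIV. if n = l then gen n else 0)"
    by (intro sum.cong refl) (simp add: BL axis_def)
  finally show "subst (linear_subst L) (linear_subst B l) = gen l" by simp
qed

lemma prod_list_linear_subst:
  fixes B :: "'k::field ^ 'q::finite \<Rightarrow> 'k ^ 'q"
  shows "prod_list (map (linear_subst B) v) = (\<Sum>w | length w = length v.
    tscale (prod_list (map2 (\<lambda>x l. x $ l) (map (\<lambda>m. B (axis m 1)) w) v)) (Poly_Mapping.single w 1))"
proof (induction v)
  case Nil
  have "{w :: 'q list. length w = 0} = {[]}" by auto
  then show ?case by (simp add: single_one_Nil)
next
  case (Cons l v)
  have s: "gen m * Poly_Mapping.single w 1 = (Poly_Mapping.single (m # w) 1 :: ('q, 'k) tensor_alg)" for m w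
    by (simp add: gen_def mult_single plus_list_def)
  let ?P = "\<lambda>w v. prod_list (map2 (\<lambda>x l. x $ l) (map (\<lambda>m. B (axis m 1)) w) v)"
  have "prod_list (map (linear_subst B) (l # v)) = (\<Sum>m\<in>UNIV. tscale (B (axis m 1) $ l) (gen m)) *
      (\<Sum>w | length w = length v. tscale (?P w v) (Poly_Mapping.single w 1))"
    unfolding Cons.IH[symmetric] by (simp add: linear_subst_def)
  also have "\<dots> = (\<Sum>m\<in>UNIV. \<Sum>w | length w = length v.
      tscale (B (axis m 1) $ l * ?P w v) (Poly_Mapping.single (m # w) 1))"
    by (simp add: sum_product tscale_mult_left tscale_mult_right s mult.commute)
  also have "\<dots> = (\<Sum>w | length w = length (l # v). tscale (?P w (l # v)) (Poly_Mapping.single w 1))"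
    by (simp add: sum_words_Suc)
  finally show ?case .
qed

lemma subst_linear_subst_tensor_power:
  fixes B :: "'k::field ^ 'q::finite \<Rightarrow> 'k ^ 'q"
  assumes "p \<in> tensor_power n"
  shows "subst (linear_subst B) p \<in> tensor_power n"
proof -
  have "prod_list (map (linear_subst B) v) \<in> tensor_power (length v)" for v
    unfolding prod_list_linear_subst
  proof (intro tensor_alg.subspace_sum[OF subspace_tensor_power]
      tensor_alg.subspace_scale[OF subspace_tensor_power])
    fix w assume "w \<in> {w :: 'q list. length w = length v}"
    then show "Poly_Mapping.single w 1 \<in> tensor_power (length v)"
      using single_tensor_power[of w] by simp
  qed
  then have "prod_list (map (linear_subst B) v) \<in> tensor_power n" if "v \<in> Poly_Mapping.keys p" for v
    using assms that unfolding tensor_power_def by fastforce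
  then show ?thesis
    unfolding subst_def
    by (intro tensor_alg.subspace_sum[OF subspace_tensor_power]
        tensor_alg.subspace_scale[OF subspace_tensor_power])
qed

section \<open>Isomorphic algebras from equivalent forms\<close>

text \<open>The prefix \<open>ys\<close> collects the arguments already replaced by basis vectors,
  so the induction can expand one argument at a time inside the form.\<close>

lemma multilinear_expand:
  fixes W :: "('q::finite, 'k::field) form"
  assumes "multilinear n W" "length ys + length xs = n"
  shows "W (ys @ xs) = (\<Sum>v | length v = length xs.
    prod_list (map2 (\<lambda>x l. x $ l) xs v) * W (ys @ map (\<lambda>i. axis i 1) v))"
  using assms(2)
proof (induction xs arbitrary: ys)
  case Nil
  have "{v :: 'q list. length v = 0} = {[]}" by auto
  then show ?case by simp
next
  case (Cons x xs)
  have lin: "Vector_Spaces.linear (*s) (*) (\<lambda>x. W (ys @ x # xs))"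
    using assms(1) Cons.prems by (simp add: multilinear_def)
  have "W (ys @ x # xs) = W (ys @ (\<Sum>l\<in>UNIV. x $ l *s axis l 1) # xs)" by (simp only: basis_expansion)
  also have "\<dots> = (\<Sum>l\<in>UNIV. x $ l * W (ys @ axis l 1 # xs))"
  proof -
    interpret lin: Vector_Spaces.linear "(*s)" "(*)" "\<lambda>x. W (ys @ x # xs)" by (rule lin)
    show ?thesis by (simp add: lin.sum lin.scale)
  qed
  also have "\<dots> = (\<Sum>l\<in>UNIV. \<Sum>v | length v = length xs.
      x $ l * (prod_list (map2 (\<lambda>x l. x $ l) xs v) * W (ys @ axis l 1 # map (\<lambda>i. axis i 1) v)))"
  proof (intro sum.cong refl)
    fix l
    show "x $ l * W (ys @ axis l 1 # xs) = (\<Sum>v | length v = length xs.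
        x $ l * (prod_list (map2 (\<lambda>x l. x $ l) xs v) * W (ys @ axis l 1 # map (\<lambda>i. axis i 1) v)))"
      using Cons.IH[of "ys @ [axis l 1]"] Cons.prems by (simp add: sum_distrib_left)
  qed
  also have "\<dots> = (\<Sum>v | length v = length (x # xs).
      prod_list (map2 (\<lambda>x l. x $ l) (x # xs) v) * W (ys @ map (\<lambda>i. axis i 1) v))"
    by (simp add: sum_words_Suc mult.assoc)
  finally show ?case .
qed

text \<open>Substituting for the letters applies \<open>B\<close> to every argument except the
  first, which only labels the relation.\<close>

lemma subst_form_relation:
  fixes W :: "('q::finite, 'k::field) form"
  assumes W: "multilinear (N + 1) W"
  shows "subst (linear_subst B) (form_relation N W i) =
    (\<Sum>w | length w = N. tscale (W (axis i 1 # map (\<lambda>m. B (axis m 1)) w)) (Poly_Mapping.single w 1))"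
proof -
  let ?P = "\<lambda>w v. prod_list (map2 (\<lambda>x l. x $ l) (map (\<lambda>m. B (axis m 1)) w) v)"
  let ?W = "\<lambda>v. W (axis i 1 # map (\<lambda>i. axis i 1) v)"
  have "subst (linear_subst B) (form_relation N W i) =
      (\<Sum>v | length v = N. \<Sum>w | length w = N. tscale (?W v * ?P w v) (Poly_Mapping.single w 1))"
    unfolding form_relation_def subst_sum
  proof (rule sum.cong[OF refl])
    fix v assume "v \<in> {v :: 'q list. length v = N}"
    then show "subst (linear_subst B) (tscale (W (map (\<lambda>i. axis i 1) (i # v))) (prod_list (map gen v))) =
        (\<Sum>w | length w = N. tscale (?W v * ?P w v) (Poly_Mapping.single w 1))"
      by (simp add: prod_list_gen subst_tscale subst_single prod_list_linear_subst
          tensor_alg.scale_sum_right)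
  qed
  also have "\<dots> = (\<Sum>w | length w = N. \<Sum>v | length v = N. tscale (?W v * ?P w v) (Poly_Mapping.single w 1))"
    by (rule sum.swap)
  also have "\<dots> = (\<Sum>w | length w = N.
      tscale (W (axis i 1 # map (\<lambda>m. B (axis m 1)) w)) (Poly_Mapping.single w 1))"
  proof (rule sum.cong[OF refl])
    fix w assume "w \<in> {w :: 'q list. length w = N}"
    then have "W ([axis i 1] @ map (\<lambda>m. B (axis m 1)) w) = (\<Sum>v | length v = N. ?P w v * W ([axis i 1] @ map (\<lambda>i. axis i 1) v))"
      using multilinear_expand[OF W, of "[axis i 1]" "map (\<lambda>m. B (axis m 1)) w"] by simp
    then show "(\<Sum>v | length v = N. tscale (?W v * ?P w v) (Poly_Mapping.single w 1)) =
        tscale (W (axis i 1 # map (\<lambda>m. B (axis m 1)) w)) (Poly_Mapping.single w 1)"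
      by (simp add: tensor_alg.scale_sum_left mult.commute)
  qed
  finally show ?thesis .
qed

text \<open>The substitution leaves the first argument alone. Applying \<open>B\<close> to it as
  well mixes the relations, with the coordinates of \<open>B (axis l 1)\<close> as
  coefficients.\<close>

lemma form_relation_transform:
  fixes W W' :: "('q::finite, 'k::field) form"
  assumes W: "multilinear (N + 1) W" and W': "\<And>xs. length xs = N + 1 \<Longrightarrow> W' xs = W (map B xs)"
  shows "form_relation N W' l =
    (\<Sum>i\<in>UNIV. tscale (B (axis l 1) $ i) (subst (linear_subst B) (form_relation N W i)))"
proof -
  have "(\<Sum>i\<in>UNIV. tscale (B (axis l 1) $ i) (subst (linear_subst B) (form_relation N W i))) =
      (\<Sum>i\<in>UNIV. \<Sum>w | length w = N. tscale (B (axis l 1) $ i * W (axis i 1 # map (\<lambda>m. B (axis m 1)) w))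
        (Poly_Mapping.single w 1))"
    by (simp add: subst_form_relation[OF W] tensor_alg.scale_sum_right)
  also have "\<dots> = (\<Sum>w | length w = N. \<Sum>i\<in>UNIV. tscale (B (axis l 1) $ i * W (axis i 1 # map (\<lambda>m. B (axis m 1)) w))
        (Poly_Mapping.single w 1))"
    by (rule sum.swap)
  also have "\<dots> = form_relation N W' l"
    unfolding form_relation_def
  proof (rule sum.cong[OF refl])
    fix w assume "w \<in> {w :: 'q list. length w = N}"
    then have w: "length w = N" by simp
    let ?xs = "map (\<lambda>m. B (axis m 1)) w"
    have lin: "Vector_Spaces.linear (*s) (*) (\<lambda>x. W ([] @ x # ?xs))"
      using W[unfolded multilinear_def, rule_format, of "[]" ?xs] w by simp
    interpret lin: Vector_Spaces.linear "(*s)" "(*)" "\<lambda>x. W ([] @ x # ?xs)" by (rule lin)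
    have "W' (map (\<lambda>i. axis i 1) (l # w)) = W (B (axis l 1) # ?xs)"
      using W'[of "map (\<lambda>i. axis i 1) (l # w)"] w by (simp add: comp_def)
    also have "\<dots> = W ([] @ (\<Sum>i\<in>UNIV. B (axis l 1) $ i *s axis i 1) # ?xs)"
      by (simp only: basis_expansion append_Nil)
    also have "\<dots> = (\<Sum>i\<in>UNIV. B (axis l 1) $ i * W (axis i 1 # ?xs))"
      unfolding lin.sum lin.scale by simp
    finally show "(\<Sum>i\<in>UNIV. tscale (B (axis l 1) $ i * W (axis i 1 # ?xs)) (Poly_Mapping.single w 1)) =
        tscale (W' (map (\<lambda>i. axis i 1) (l # w))) (prod_list (map gen w))"
      by (simp add: prod_list_gen tensor_alg.scale_sum_left)
  qed
  finally show ?thesis by simp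
qed

text \<open>One inclusion suffices, because the other one arises from the inverse map with the two
  forms exchanged.\<close>

lemma form_relations_transform:
  fixes W W' :: "('q::finite, 'k::field) form"
  assumes "multilinear (N + 1) W" "\<And>xs. length xs = N + 1 \<Longrightarrow> W' xs = W (map B xs)"
  shows "form_relations N W' \<subseteq> subst (linear_subst B) ` form_relations N W"
  unfolding form_relations_def
proof (rule tensor_alg.span_minimal)
  let ?S = "tensor_alg.span (range (form_relation N W))"
  show "tensor_alg.subspace (subst (linear_subst B) ` ?S)"
  proof (rule tensor_alg.subspaceI)
    show "0 \<in> subst (linear_subst B) ` ?S"
      by (rule image_eqI[where f = "subst (linear_subst B)", OF subst_zero[symmetric] tensor_alg.span_zero])
    fix p q assume "p \<in> subst (linear_subst B) ` ?S" "q \<in> subst (linear_subst B) ` ?S"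
    then show "p + q \<in> subst (linear_subst B) ` ?S"
      by (elim imageE, hypsubst, intro image_eqI[where f = "subst (linear_subst B)", OF subst_add[symmetric]] tensor_alg.span_add)
  next
    fix c p assume "p \<in> subst (linear_subst B) ` ?S"
    then show "tscale c p \<in> subst (linear_subst B) ` ?S"
      by (elim imageE, hypsubst, intro image_eqI[where f = "subst (linear_subst B)", OF subst_tscale[symmetric]] tensor_alg.span_scale)
  qed
  show "range (form_relation N W') \<subseteq> subst (linear_subst B) ` ?S"
  proof (rule image_subsetI)
    fix l
    have "form_relation N W' l = subst (linear_subst B) (\<Sum>i\<in>UNIV. tscale (B (axis l 1) $ i) (form_relation N W i))"
      using form_relation_transform[OF assms] by (simp add: subst_sum subst_tscale)
    moreover have "(\<Sum>i\<in>UNIV. tscale (B (axis l 1) $ i) (form_relation N W i)) \<in> ?S"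
      by (intro tensor_alg.span_sum tensor_alg.span_scale tensor_alg.span_base) simp
    ultimately show "form_relation N W' l \<in> subst (linear_subst B) ` ?S" by (rule image_eqI)
  qed
qed

section \<open>Isomorphisms of algebras induced by substitutions\<close>

lemma subst_rel_ideal:
  assumes "\<And>p. p \<in> R \<Longrightarrow> subst \<beta> p \<in> rel_ideal S"
  shows "p \<in> rel_ideal R \<Longrightarrow> subst \<beta> p \<in> rel_ideal S"
proof -
  have "rel_ideal R \<subseteq> {p. subst \<beta> p \<in> rel_ideal S}"
    by (rule rel_ideal_minimal)
      (auto simp: assms subst_zero subst_add subst_mult rel_ideal_closed)
  then show "p \<in> rel_ideal R \<Longrightarrow> subst \<beta> p \<in> rel_ideal S" by auto
qed

lemma hom_alg_isomorphic_subst: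
  fixes R S :: "('q, 'k::field) tensor_alg set"
  assumes \<beta>: "\<And>p. p \<in> R \<Longrightarrow> subst \<beta> p \<in> S" and \<gamma>: "\<And>p. p \<in> S \<Longrightarrow> subst \<gamma> p \<in> R"
    and \<beta>\<gamma>: "\<And>p. subst \<beta> (subst \<gamma> p) = p" and \<gamma>\<beta>: "\<And>p. subst \<gamma> (subst \<beta> p) = p"
    and grade: "\<And>n p. p \<in> tensor_power n \<Longrightarrow> subst \<beta> p \<in> tensor_power n"
      "\<And>n p. p \<in> tensor_power n \<Longrightarrow> subst \<gamma> p \<in> tensor_power n"
  shows "hom_alg_isomorphic R S"
proof -
  have I\<beta>: "subst \<beta> p \<in> rel_ideal S" if "p \<in> rel_ideal R" for p
    by (rule subst_rel_ideal[OF _ that]) (use rel_ideal_superset[of S] \<beta> in blast)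
  have I\<gamma>: "subst \<gamma> p \<in> rel_ideal R" if "p \<in> rel_ideal S" for p
    by (rule subst_rel_ideal[OF _ that]) (use rel_ideal_superset[of R] \<gamma> in blast)
  have minus: "subst \<delta> (p - q) = subst \<delta> p - subst \<delta> q" for \<delta> :: "'q \<Rightarrow> ('q, 'k) tensor_alg" and p q
    using subst_add[of \<delta> "p - q" q] by simp
  \<comment> \<open>The two implications show at once that the substitution descends to classes and
    that the descended map is injective.\<close>
  have cls_iff: "cls S (subst \<beta> p) = cls S (subst \<beta> q) \<longleftrightarrow> cls R p = cls R q" for p q
    using I\<beta>[of "p - q"] I\<gamma>[of "subst \<beta> (p - q)"] by (auto simp: cls_eq_iff minus \<gamma>\<beta>)
  define h where "h a = cls S (subst \<beta> (SOME p. a = cls R p))" for a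
  have h: "h (cls R p) = cls S (subst \<beta> p)" for p
    unfolding h_def cls_iff by (rule someI2[of _ p]) simp_all
  have "h \<in> ring_iso (hom_alg R) (hom_alg S)"
    unfolding ring_iso_def
  proof (intro CollectI conjI)
    show "h \<in> ring_hom (hom_alg R) (hom_alg S)"
      by (rule ring_hom_memI)
        (auto elim!: hom_alg_cases simp: h cls_mult cls_add cls_one subst_mult subst_add subst_one)
    show "bij_betw h (carrier (hom_alg R)) (carrier (hom_alg S))"
      unfolding bij_betw_def
    proof
      show "inj_on h (carrier (hom_alg R))"
        by (rule inj_onI) (auto elim!: hom_alg_cases simp: h cls_iff)
      have "cls S p \<in> h ` carrier (hom_alg R)" for p
        using h[of "subst \<gamma> p"] by (intro image_eqI[of _ _ "cls R (subst \<gamma> p)"]) (simp_all add: \<beta>\<gamma>)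
      then show "h ` carrier (hom_alg R) = carrier (hom_alg S)"
        by (auto elim!: hom_alg_cases simp: h)
    qed
  qed
  moreover have "h (c \<odot>\<^bsub>hom_alg R\<^esub> a) = c \<odot>\<^bsub>hom_alg S\<^esub> h a" if "a \<in> carrier (hom_alg R)" for c a
    using that by (auto elim!: hom_alg_cases simp: h cls_smult subst_tscale)
  moreover have "h ` hom_alg_grade R n = hom_alg_grade S n" for n
  proof -
    have "subst \<beta> ` tensor_power n = tensor_power n"
      using grade \<beta>\<gamma> by (auto intro!: image_eqI[of _ "subst \<beta>" "subst \<gamma> _"])
    moreover have "h ` hom_alg_grade R n = cls S ` subst \<beta> ` tensor_power n"
      by (simp add: hom_alg_grade_def image_image h)
    ultimately show ?thesis by (simp add: hom_alg_grade_def)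
  qed
  ultimately show ?thesis unfolding hom_alg_isomorphic_def by blast
qed

lemma same_orbit_isomorphic:
  fixes W W' :: "('q::finite, 'k::field) form"
  assumes W: "multilinear (N + 1) W" and W': "multilinear (N + 1) W'" and orbit: "same_GL_orbit (N + 1) W W'"
  shows "hom_alg_isomorphic (form_relations N W) (form_relations N W')"
proof -
  obtain L where L: "Vector_Spaces.linear (*s) (*s) L" "bij L"
    and WL: "\<And>xs. length xs = N + 1 \<Longrightarrow> W' xs = W (map (inv_into UNIV L) xs)"
    using orbit by (auto simp: same_GL_orbit_def GL_def form_act_def)
  define B where "B = inv_into UNIV L"
  have LB: "L (B x) = x" and BL: "B (L x) = x" for x
    using L(2) by (simp_all add: B_def bij_is_surj surj_f_inv_f bij_is_inj)
  interpret L: Vector_Spaces.linear "(*s)" "(*s)" L by (rule L(1))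
  have B: "Vector_Spaces.linear (*s) (*s) B"
  proof unfold_locales
    show "B (x + y) = B x + B y" for x y by (metis LB BL L.add)
    show "B (c *s x) = c *s B x" for c x by (metis LB BL L.scale)
  qed
  let ?\<beta> = "linear_subst B" and ?\<gamma> = "linear_subst L"
  have inv: "subst ?\<beta> (subst ?\<gamma> p) = p" "subst ?\<gamma> (subst ?\<beta> p) = p" for p
    using linear_subst_inverse[OF B L(1) LB] linear_subst_inverse[OF L(1) B BL] by simp_all
  have 1: "form_relations N W' \<subseteq> subst ?\<beta> ` form_relations N W"
    using W WL unfolding B_def by (rule form_relations_transform)
  have 2: "form_relations N W \<subseteq> subst ?\<gamma> ` form_relations N W'"
  proof (rule form_relations_transform[OF W'])
    fix xs :: "('k ^ 'q) list" assume "length xs = N + 1"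
    then show "W xs = W' (map L xs)"
      using WL[of "map L xs"] by (simp add: comp_def BL flip: B_def)
  qed
  show ?thesis
  proof (rule hom_alg_isomorphic_subst[of _ ?\<beta> _ ?\<gamma>])
    \<comment> \<open>By the inclusion for the inverse map, a relation of \<open>W\<close> is the
      image under \<open>?\<gamma>\<close> of one of \<open>W'\<close>, and \<open>?\<beta>\<close>
      undoes \<open>?\<gamma>\<close>.\<close>
    show "subst ?\<beta> p \<in> form_relations N W'" if "p \<in> form_relations N W" for p
      using 2 that inv(1) by auto
    show "subst ?\<gamma> p \<in> form_relations N W" if "p \<in> form_relations N W'" for p
      using 1 that inv(2) by auto
  qed (simp_all add: inv subst_linear_subst_tensor_power)
qed

theorem theorem3p3:
  fixes N :: nat
  assumes "N \<ge> 2" and "CARD('q::finite) \<ge> 2"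
  shows
    "(\<forall>R :: ('q, 'k::{alg_closed_field, field_char_0}) tensor_alg set.
        tensor_alg.subspace R \<and> R \<subseteq> tensor_power N \<and>
        koszul N R \<and> has_global_dimension R 3 \<and> gorenstein R 3 \<longrightarrow>
          (\<exists>W :: ('q, 'k) form. three_regular N W \<and> R = form_relations N W)) \<and>
     (\<forall>W W' :: ('q, 'k) form.
        three_regular N W \<and> three_regular N W' \<and> same_GL_orbit (N + 1) W W' \<longrightarrow>
          hom_alg_isomorphic (form_relations N W) (form_relations N W'))"
proof (intro conjI allI impI)
  fix R :: "('q, 'k) tensor_alg set"
  assume R: "tensor_alg.subspace R \<and> R \<subseteq> tensor_power N \<and>
    koszul N R \<and> has_global_dimension R 3 \<and> gorenstein R 3"
  interpret koszul_gorenstein N R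
    using R assms(1) by unfold_locales auto
  show "\<exists>W :: ('q, 'k) form. three_regular N W \<and> R = form_relations N W"
    by (rule three_regular_form_exists)
next
  fix W W' :: "('q, 'k) form"
  assume "three_regular N W \<and> three_regular N W' \<and> same_GL_orbit (N + 1) W W'"
  then show "hom_alg_isomorphic (form_relations N W) (form_relations N W')"
    by (intro same_orbit_isomorphic) (simp_all add: three_regular_def preregular_def)
qed

end
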